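(* Let $a\in\mathbb{R}$, $\boldsymbol n\in\mathbb{R}^m$ with $|\boldsymbol n|=1$, and $K:=\{\boldsymbol x\in\mathbb{R}^m:\boldsymbol n\cdot\boldsymbol x\ge a\}$. Then $$\big\|\mathcal{D}(\varphi)|_{\mathbb{R}^m\setminus K}\big\|\le C_{\mathrm{sym}}\|\varphi\|\quad\text{for all real-valued }\varphi\in L^2(K,\mathbb{R}),$$ with a constant $C_{\mathrm{sym}}$ independent of $\mathfrak f,m,a,\boldsymbol n,\varphi$ satisfying $C_{\mathrm{sym}}\le\max_{x\in\mathbb{R}}\operatorname{sym}(\tilde\theta)(x)\le0.837$. In contrast, for complex-valued functions no such bound holds with a constant $<1$: for every $c<1$ there exists $h\in L^2(K)$ with $\|\mathcal{D}(h)|_{\mathbb{R}^m\setminus K}\|>c\|h\|$.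
   Context: Fourier transform $\mathcal{F}(f)(\boldsymbol\xi)=(2\pi)^{-m/2}\int e^{-\mathrm{i}\boldsymbol\xi\cdot\boldsymbol x}f(\boldsymbol x)\,\mathrm{d}\boldsymbol x$ (unitary). Fix $\mathfrak f>0$; $\mathcal{D}(h)=\mathcal{F}^{-1}(m_{\mathfrak f}\mathcal{F}(h))$, $m_{\mathfrak f}(\boldsymbol\xi)=\exp(-\mathrm{i}|\boldsymbol\xi|^2/(2\mathfrak f))$. $\tilde\theta(y)=\tfrac12-\tfrac{1-\mathrm i}{2}(\mathrm C(-y/\sqrt\pi)+\mathrm i\,\mathrm S(-y/\sqrt\pi))$ with Fresnel integrals $\mathrm C(x)=\int_0^x\cos(\tfrac\pi2t^2)\mathrm dt$, $\mathrm S(x)=\int_0^x\sin(\tfrac\pi2t^2)\mathrm dt$. For a function $p$ on $\mathbb{R}$, $\operatorname{sym}(p)(x):=2^{-1/2}(|p(x)|^2+|p(-x)|^2)^{1/2}$. $f|_A:=\mathbf 1_Af$; $L^2(K)$ ($L^2(K,\mathbb{R})$) = complex (real) functions in $L^2(\mathbb{R}^m)$ supported in $K$. *)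

theory Defs
  imports "HOL-Analysis.Analysis"
begin

definition L2fun :: "('a::euclidean_space \<Rightarrow> complex) \<Rightarrow> bool" where
  "L2fun f \<longleftrightarrow> f \<in> borel_measurable lebesgue \<and>
     integrable lebesgue (\<lambda>x. (cmod (f x))\<^sup>2)"

definition L2norm :: "('a::euclidean_space \<Rightarrow> complex) \<Rightarrow> real" where
  "L2norm f = sqrt (integral\<^sup>L lebesgue (\<lambda>x. (cmod (f x))\<^sup>2))"

definition supported_in :: "'a::euclidean_space set \<Rightarrow> ('a \<Rightarrow> complex) \<Rightarrow> bool" where
  "supported_in K f \<longleftrightarrow> (AE x in lebesgue. x \<notin> K \<longrightarrow> f x = 0)"

text \<open>Fourier integral with sign s (s = -1: forward transform, s = 1: inverse transform),
  unitary normalisation, defined for integrable f.\<close>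
definition fourier_int :: "real \<Rightarrow> ('a::euclidean_space \<Rightarrow> complex) \<Rightarrow> 'a \<Rightarrow> complex" where
  "fourier_int s f \<xi> = complex_of_real ((2 * pi) powr (- real DIM('a) / 2)) *
     integral\<^sup>L lebesgue (\<lambda>x. exp (complex_of_real s * \<i> * complex_of_real (\<xi> \<bullet> x)) * f x)"

text \<open>L2 (Plancherel) extension: g is the L2 Fourier transform (sign s) of h iff g is in L2 and
  is the L2-limit of the transforms of the truncations of h to balls of radius n.\<close>
definition fourierL2 :: "real \<Rightarrow> ('a::euclidean_space \<Rightarrow> complex) \<Rightarrow> ('a \<Rightarrow> complex) \<Rightarrow> bool" where
  "fourierL2 s h g \<longleftrightarrow> L2fun g \<and>
     (\<lambda>n::nat. L2norm (\<lambda>\<xi>. g \<xi> - fourier_int s (\<lambda>x. indicator (ball 0 (real n)) x * h x) \<xi>))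
       \<longlonglongrightarrow> 0"

definition mult_f :: "real \<Rightarrow> 'a::euclidean_space \<Rightarrow> complex" where
  "mult_f ff \<xi> = exp (- \<i> * complex_of_real ((norm \<xi>)\<^sup>2 / (2 * ff)))"

text \<open>g is (a representative of) D(h) = F^{-1}(m_f F(h)).\<close>
definition is_D :: "real \<Rightarrow> ('a::euclidean_space \<Rightarrow> complex) \<Rightarrow> ('a \<Rightarrow> complex) \<Rightarrow> bool" where
  "is_D ff h g \<longleftrightarrow> (\<exists>g1. fourierL2 (-1) h g1 \<and> fourierL2 1 (\<lambda>\<xi>. mult_f ff \<xi> * g1 \<xi>) g)"

text \<open>Fresnel integrals (oriented integrals, so negative arguments are handled correctly).\<close>
definition fresnelC :: "real \<Rightarrow> real" where
  "fresnelC x = (LBINT t=0..x. cos (pi / 2 * t\<^sup>2))"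

definition fresnelS :: "real \<Rightarrow> real" where
  "fresnelS x = (LBINT t=0..x. sin (pi / 2 * t\<^sup>2))"

definition theta_tilde :: "real \<Rightarrow> complex" where
  "theta_tilde y = 1/2 - (1 - \<i>) / 2 *
     (complex_of_real (fresnelC (- y / sqrt pi)) + \<i> * complex_of_real (fresnelS (- y / sqrt pi)))"

definition sym :: "(real \<Rightarrow> complex) \<Rightarrow> real \<Rightarrow> real" where
  "sym p x = 2 powr (-1/2) * sqrt ((cmod (p x))\<^sup>2 + (cmod (p (- x)))\<^sup>2)"

end

theory Submission
  imports Defs "HOL-Probability.Characteristic_Functions" "HOL-Complex_Analysis.Conformal_Mappings"
    "HOL-Real_Asymp.Real_Asymp"
begin

text \<open>The propagator \<open>D\<close> is convolution with the chirp \<open>exp (\<i> ff / 2 * (norm z)\<^sup>2)\<close>, up to a constant. If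
  \<open>\<phi>\<close> lives on \<open>n \<bullet> y \<ge> a\<close>, then at points with \<open>n \<bullet> x < a\<close> only the part of the chirp on the half-space
  \<open>n \<bullet> z < 0\<close> contributes. Hence \<open>D \<phi>\<close> agrees there with a Fourier multiplier whose modulus at \<open>\<xi>\<close> is
  that of \<open>theta_tilde\<close> at \<open>- (n \<bullet> \<xi>) / sqrt ff\<close>. By Plancherel its norm is at most that of this multiplier
  times the transform of \<open>\<phi>\<close>; since \<open>\<phi>\<close> is real, the modulus of its transform is even, and averaging
  over \<open>\<xi>\<close> and \<open>- \<xi>\<close> produces \<open>sym theta_tilde\<close>. The argument is carried out with Gaussian damping
  of the chirp, so that only absolutely convergent integrals occur, and the damping is removed at the end.

  For complex functions a modulated chirp makes \<open>D h\<close> a translated and rescaled Fourier transform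
  of a tent function, and the translation can move almost all of its mass across the hyperplane.\<close>

section \<open>Gaussian integrals with complex parameter\<close>

lemma integrable_gaussian_moment:
  fixes a :: real
  assumes "a > 0"
  shows "integrable lborel (\<lambda>x::real. x ^ k * exp (- (a * x\<^sup>2)))"
proof -
  have "integrable lborel (\<lambda>x. std_normal_density (0 + sqrt (2*a) * x) * (0 + sqrt (2*a) * x) ^ k)"
    using assms by (intro lborel_integrable_real_affine[OF integrable_std_normal_moment]) auto
  then have "integrable lborel (\<lambda>x. (sqrt (2*pi) / sqrt (2*a) ^ k) *
      (std_normal_density (0 + sqrt (2*a) * x) * (0 + sqrt (2*a) * x) ^ k))"
    by (rule integrable_mult_right)
  moreover have "(sqrt (2*pi) / sqrt (2*a) ^ k) *
      (std_normal_density (0 + sqrt (2*a) * x) * (0 + sqrt (2*a) * x) ^ k) = x ^ k * exp (- (a * x\<^sup>2))" for x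
    using assms by (simp add: std_normal_density_def power_mult_distrib)
  ultimately show ?thesis
    by simp
qed

lemma gaussian_fourier_real:
  fixes a y :: real
  assumes "a > 0"
  shows "(LINT x|lborel. exp (- (of_real a * (of_real x)\<^sup>2) + \<i> * of_real (y * x))) =
    csqrt (of_real (pi / a)) * exp (- (of_real y)\<^sup>2 / (4 * of_real a))"
proof -
  define c where "c = sqrt (2 * a)"
  have c: "c > 0" "c\<^sup>2 = 2 * a"
    using assms by (auto simp: c_def)
  have "complex_of_real (exp (- ((y / c)\<^sup>2) / 2)) = char std_normal_distribution (y / c)"
    by (simp add: char_std_normal_distribution)
  also have "\<dots> = (LINT x|lborel. std_normal_density x *\<^sub>R exp (\<i> * complex_of_real (y / c * x)))"
    unfolding char_def by (subst integral_density) (auto simp: normal_density_nonneg)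
  also have "\<dots> = c *\<^sub>R (LINT x|lborel. std_normal_density (0 + c * x) *\<^sub>R exp (\<i> * complex_of_real (y / c * (0 + c * x))))"
    using c by (subst lborel_integral_real_affine[where c=c and t=0]) auto
  also have "\<dots> = c *\<^sub>R (LINT x|lborel. (1 / sqrt (2*pi)) *\<^sub>R exp (- (of_real a * (of_real x)\<^sup>2) + \<i> * of_real (y * x)))"
  proof -
    have "std_normal_density (0 + c * x) *\<^sub>R exp (\<i> * complex_of_real (y / c * (0 + c * x))) =
      (1 / sqrt (2*pi)) *\<^sub>R exp (- (of_real a * (of_real x)\<^sup>2) + \<i> * of_real (y * x))" for x
      using c by (simp add: std_normal_density_def power_mult_distrib exp_diff scaleR_conv_of_real
         exp_of_real[symmetric] exp_minus field_simps)
    then show ?thesis by simp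
  qed
  also have "\<dots> = of_real (c / sqrt (2 * pi)) * (LINT x|lborel. exp (- (of_real a * (of_real x)\<^sup>2) + \<i> * of_real (y * x)))"
    by (simp add: scaleR_conv_of_real)
  finally have *: "complex_of_real (exp (- ((y / c)\<^sup>2) / 2)) =
     of_real (c / sqrt (2 * pi)) * (LINT x|lborel. exp (- (of_real a * (of_real x)\<^sup>2) + \<i> * of_real (y * x)))" .
  have e: "complex_of_real (exp (- ((y / c)\<^sup>2) / 2)) = exp (- (of_real y)\<^sup>2 / (4 * of_real a))"
    unfolding exp_of_real[symmetric] by (simp add: power_divide c field_simps)
  have s: "csqrt (of_real (pi / a)) = of_real (sqrt (2 * pi) / c)"
    using assms by (simp add: csqrt_of_real_nonneg c_def real_sqrt_divide real_sqrt_mult)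
  show ?thesis
    unfolding s e[symmetric] * using c by simp
qed

lemma holomorphic_gaussian_integral:
  fixes y :: real
  shows "(\<lambda>g. LINT x|lborel. exp (- (g * (of_real x)\<^sup>2) + \<i> * of_real (y * x))) holomorphic_on {g. Re g > 0}"
proof (rule holomorphic_onI)
  fix g :: complex assume "g \<in> {g. Re g > 0}"
  then have g: "Re g > 0" by simp
  define e where "e g x = exp (- (g * (of_real x)\<^sup>2) + \<i> * of_real (y * x))" for g :: complex and x :: real
  have ne: "norm (e g x) = exp (- (Re g * x\<^sup>2))" for g x
    by (simp add: e_def norm_exp_eq_Re power2_eq_square)
  have [measurable]: "e g \<in> borel_measurable borel" for g
    unfolding e_def by measurable
  have int: "integrable lborel (\<lambda>x. x ^ k *\<^sub>R e h x)" if "Re h > 0" for k h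
    by (rule Bochner_Integration.integrable_bound[OF integrable_norm[OF integrable_gaussian_moment[OF that, of k]]])
       (auto simp: ne abs_mult)
  have int0: "integrable lborel (e h)" if "Re h > 0" for h
    using int[OF that, of 0] by simp
  define D where "D = (LINT x|lborel. - (x\<^sup>2 *\<^sub>R e g x))"
  define r where "r = Re g / 2"
  define B where "B = (LINT x|lborel. x ^ 4 * exp (- (r * x\<^sup>2)))"
  have r: "r > 0" using g by (simp add: r_def)
  have *: "norm (integral\<^sup>L lborel (e (g + h)) - integral\<^sup>L lborel (e g) - D * h) \<le> B * norm h ^ 2"
    if h: "norm h \<le> r" for h
  proof -
    have gh: "Re (g + h) > 0"
      using h abs_Re_le_cmod[of h] g unfolding r_def plus_complex.sel by linarith
    have "integral\<^sup>L lborel (e (g + h)) - integral\<^sup>L lborel (e g) - D * h =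
      (LINT x|lborel. e (g + h) x - e g x - (- (x\<^sup>2 *\<^sub>R e g x)) * h)"
      unfolding D_def using int0[OF gh] int0[OF g] int[OF g, of 2] by (simp flip: mult_scaleR_left)
    also have "norm \<dots> \<le> (LINT x|lborel. norm h ^ 2 * (x ^ 4 * exp (- (r * x\<^sup>2))))"
    proof (rule Bochner_Integration.integral_norm_bound_integral)
      show "integrable lborel (\<lambda>x. e (g + h) x - e g x - (- (x\<^sup>2 *\<^sub>R e g x)) * h)"
        using int0[OF gh] int0[OF g] int[OF g, of 2] by (simp flip: mult_scaleR_left)
      show "integrable lborel (\<lambda>x. norm h ^ 2 * (x ^ 4 * exp (- (r * x\<^sup>2))))"
        by (intro integrable_mult_right integrable_gaussian_moment r)
      fix x :: real
      define z where "z = - (h * of_real (x\<^sup>2))"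
      have "e (g + h) x - e g x - (- (x\<^sup>2 *\<^sub>R e g x)) * h = e g x * (exp z - (1 + z))"
      proof -
        have "e (g + h) x = e g x * exp z"
          by (simp add: e_def z_def exp_add[symmetric] algebra_simps)
        then show ?thesis
          by (simp add: z_def scaleR_conv_of_real algebra_simps)
      qed
      also have "norm \<dots> \<le> exp (- (Re g * x\<^sup>2)) * (norm z ^ 2 * exp (norm z))"
      proof -
        have "norm (exp z - (\<Sum>k\<le>1. z ^ k / fact k)) \<le> exp \<bar>Re z\<bar> * (norm z) ^ (Suc 1) / fact 1"
          by (rule Taylor_exp)
        also have "\<dots> \<le> exp (norm z) * norm z ^ 2"
          using abs_Re_le_cmod[of z] by (simp add: numeral_2_eq_2 mult_right_mono)
        finally have "norm (exp z - (1 + z)) \<le> norm z ^ 2 * exp (norm z)"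
          by (simp add: mult.commute)
        then show ?thesis
          by (simp add: norm_mult ne mult_left_mono)
      qed
      also have "\<dots> = norm h ^ 2 * (x ^ 4 * exp (- (Re g * x\<^sup>2) + norm h * x\<^sup>2))"
        by (simp add: z_def norm_mult norm_power exp_diff exp_minus field_simps power_mult_distrib power2_eq_square[of x] eval_nat_numeral)
      also have "\<dots> \<le> norm h ^ 2 * (x ^ 4 * exp (- (r * x\<^sup>2)))"
      proof -
        have "norm h * x\<^sup>2 \<le> r * x\<^sup>2"
          using h by (simp add: mult_right_mono)
        then have "- (Re g * x\<^sup>2) + norm h * x\<^sup>2 \<le> - (r * x\<^sup>2)"
          by (simp add: r_def)
        then show ?thesis
          by (intro mult_left_mono) auto
      qed
      finally show "norm (e (g + h) x - e g x - (- (x\<^sup>2 *\<^sub>R e g x)) * h) \<le> norm h ^ 2 * (x ^ 4 * exp (- (r * x\<^sup>2)))" .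
    qed
    also have "\<dots> = B * norm h ^ 2"
      by (simp add: B_def)
    finally show ?thesis .
  qed
  have "((\<lambda>h. (integral\<^sup>L lborel (e (g + h)) - integral\<^sup>L lborel (e g)) / h) \<longlongrightarrow> D) (at 0)"
  proof (rule LIM_zero_cancel, rule Lim_null_comparison)
    show "\<forall>\<^sub>F h in at 0. norm ((integral\<^sup>L lborel (e (g + h)) - integral\<^sup>L lborel (e g)) / h - D) \<le> B * norm h"
      unfolding eventually_at
    proof (intro exI[of _ r] conjI ballI impI)
      fix h :: complex assume "h \<noteq> 0 \<and> dist h 0 < r"
      then have h: "h \<noteq> 0" "norm h \<le> r" by auto
      have "(integral\<^sup>L lborel (e (g + h)) - integral\<^sup>L lborel (e g)) / h - D =
        (integral\<^sup>L lborel (e (g + h)) - integral\<^sup>L lborel (e g) - D * h) / h"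
        using h by (simp add: field_simps)
      also have "norm \<dots> \<le> B * norm h ^ 2 / norm h"
        unfolding norm_divide using *[OF h(2)] by (rule divide_right_mono) simp
      finally show "norm ((integral\<^sup>L lborel (e (g + h)) - integral\<^sup>L lborel (e g)) / h - D) \<le> B * norm h"
        using h by (simp add: power2_eq_square)
    qed (use r in auto)
    show "((\<lambda>h::complex. B * norm h) \<longlongrightarrow> 0) (at 0)"
      by (intro tendsto_eq_intros | simp)+
  qed
  then have "((\<lambda>g. integral\<^sup>L lborel (e g)) has_field_derivative D) (at g)"
    by (simp add: DERIV_def)
  then show "(\<lambda>g. LINT x|lborel. exp (- (g * (of_real x)\<^sup>2) + \<i> * of_real (y * x)))
     field_differentiable at g within {g. Re g > 0}"
    unfolding e_def[abs_def] field_differentiable_def by (blast intro: has_field_derivative_at_within)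
qed

lemma gaussian_fourier:
  fixes g :: complex and y :: real
  assumes "Re g > 0"
  shows "(LINT x|lborel. exp (- (g * (of_real x)\<^sup>2) + \<i> * of_real (y * x))) =
    csqrt (of_real pi / g) * exp (- (of_real y)\<^sup>2 / (4 * g))" (is "?L g = ?R g")
proof -
  let ?S = "{g. Re g > 0}"
  have R: "of_real pi / g \<notin> \<real>\<^sub>\<le>\<^sub>0" if "Re g > 0" for g
  proof -
    have "Re (of_real pi / g) > 0"
      using that by (simp add: Re_divide divide_pos_pos pos_add_strict add_pos_nonneg)
    then show ?thesis
      using complex_nonpos_Reals_iff by auto
  qed
  have "?L g - ?R g = 0"
  proof (rule analytic_continuation[where f="\<lambda>g. ?L g - ?R g" and S="?S" and U="of_real ` {0<..}" and \<xi>=1])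
    show "(\<lambda>g. ?L g - ?R g) holomorphic_on ?S"
      by (intro holomorphic_intros holomorphic_gaussian_integral) (use R in auto)
    show "open ?S"
      by (simp add: open_halfspace_Re_gt)
    show "connected ?S"
      by (simp add: convex_connected convex_halfspace_Re_gt)
    show "1 islimpt (complex_of_real ` {0<..})"
      unfolding islimpt_approachable
    proof (intro allI impI)
      fix e :: real assume "e > 0"
      then show "\<exists>x'\<in>complex_of_real ` {0<..}. x' \<noteq> 1 \<and> dist x' 1 < e"
        by (intro bexI[of _ "of_real (1 + e / 2)"] imageI) (auto simp: dist_norm)
    qed
    fix z assume "z \<in> complex_of_real ` {0<..}"
    then obtain a where a: "a > 0" "z = of_real a" by auto
    then show "?L z - ?R z = 0"
      using gaussian_fourier_real[of a y] by simp
  qed (use assms in auto)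
  then show ?thesis by simp
qed

definition gauss :: "complex \<Rightarrow> 'a::euclidean_space \<Rightarrow> complex" where
  "gauss g x = exp (- (g * of_real ((norm x)\<^sup>2)))"

lemma borel_measurable_gauss [measurable]: "gauss g \<in> borel_measurable borel"
  unfolding gauss_def[abs_def] by measurable

lemma norm_gauss: "norm (gauss g x) = exp (- (Re g * (norm x)\<^sup>2))"
  by (simp add: gauss_def norm_exp_eq_Re)

lemma
  fixes y :: "'a::euclidean_space"
  assumes g: "Re g > 0"
  shows integrable_gauss_fourier: "integrable lborel (\<lambda>x. exp (\<i> * of_real (y \<bullet> x)) * gauss g x)"
    and integral_gauss_fourier: "(LINT x|lborel. exp (\<i> * of_real (y \<bullet> x)) * gauss g x) =
      csqrt (of_real pi / g) ^ DIM('a) * gauss (1 / (4 * g)) y"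
proof -
  interpret product_sigma_finite "\<lambda>_. lborel :: real measure"
    by standard
  define e where "e b t = exp (- (g * (of_real t)\<^sup>2) + \<i> * of_real ((y \<bullet> b) * t))" for b :: 'a and t :: real
  have [measurable]: "e b \<in> borel_measurable borel" for b
    unfolding e_def by measurable
  have int: "integrable lborel (e b)" for b
  proof (rule Bochner_Integration.integrable_bound[OF integrable_gaussian_moment[OF g, of 0]])
    show "AE x in lborel. norm (e b x) \<le> norm (x ^ 0 * exp (- (Re g * x\<^sup>2)))"
      by (simp add: e_def norm_exp_eq_Re power2_eq_square)
  qed simp
  have E: "exp (\<i> * of_real (y \<bullet> x)) * gauss g x = (\<Prod>b\<in>Basis. e b (x \<bullet> b))" for x
  proof -
    have "(norm x)\<^sup>2 = (\<Sum>b\<in>Basis. (x \<bullet> b)\<^sup>2)"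
      by (subst power2_norm_eq_inner, subst euclidean_inner) (simp add: power2_eq_square)
    moreover have "y \<bullet> x = (\<Sum>b\<in>Basis. (y \<bullet> b) * (x \<bullet> b))"
      by (rule euclidean_inner)
    ultimately show ?thesis
      by (simp add: e_def gauss_def exp_sum[symmetric] exp_add[symmetric] sum_subtractf sum_negf
           sum_distrib_left algebra_simps)
  qed
  have P: "(\<Prod>b\<in>Basis. e b ((\<Sum>b\<in>Basis. f b *\<^sub>R b) \<bullet> b)) = (\<Prod>b\<in>Basis. e b (f b))" for f :: "'a \<Rightarrow> real"
    by (intro prod.cong) (auto simp: inner_sum_left_Basis)
  have [measurable]: "(\<lambda>x::'a. \<Prod>b\<in>Basis. e b (x \<bullet> b)) \<in> borel_measurable borel"
    by measurable
  show "integrable lborel (\<lambda>x. exp (\<i> * of_real (y \<bullet> x)) * gauss g x)"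
    unfolding E
    by (subst lborel_eq, subst integrable_distr_eq) (auto simp: P intro!: product_integrable_prod int)
  have "(LINT x|lborel. exp (\<i> * of_real (y \<bullet> x)) * gauss g x) = (\<Prod>b\<in>Basis. integral\<^sup>L lborel (e b))"
    unfolding E
    by (subst lborel_eq, subst integral_distr) (auto simp: P intro!: product_integral_prod int)
  also have "\<dots> = (\<Prod>b\<in>Basis. csqrt (of_real pi / g) * exp (- (of_real (y \<bullet> b))\<^sup>2 / (4 * g)))"
    unfolding e_def[abs_def] gaussian_fourier[OF g] ..
  also have "\<dots> = csqrt (of_real pi / g) ^ DIM('a) * gauss (1 / (4 * g)) y"
  proof -
    have "(norm y)\<^sup>2 = (\<Sum>b\<in>Basis. (y \<bullet> b)\<^sup>2)"
      by (subst power2_norm_eq_inner, subst euclidean_inner) (simp add: power2_eq_square)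
    then show ?thesis
      by (simp add: prod.distrib gauss_def exp_sum[symmetric] sum_negf sum_divide_distrib)
  qed
  finally show "(LINT x|lborel. exp (\<i> * of_real (y \<bullet> x)) * gauss g x) =
      csqrt (of_real pi / g) ^ DIM('a) * gauss (1 / (4 * g)) y" .
qed

lemma integrable_gauss: "Re g > 0 \<Longrightarrow> integrable lborel (gauss g :: 'a::euclidean_space \<Rightarrow> complex)"
  using integrable_gauss_fourier[of g "0::'a"] by simp

lemma integral_gauss:
  "Re g > 0 \<Longrightarrow> (LINT x|lborel. gauss g (x::'a::euclidean_space)) = csqrt (of_real pi / g) ^ DIM('a)"
  using integral_gauss_fourier[of g "0::'a"] by (simp add: gauss_def)

section \<open>Fresnel integrals\<close>

definition fresnel :: "real \<Rightarrow> complex" where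
  "fresnel t = of_real (fresnelC t) + \<i> * of_real (fresnelS t)"

lemma has_vector_derivative_LBINT_from_0:
  fixes f :: "real \<Rightarrow> real"
  assumes "continuous_on UNIV f"
  shows "((\<lambda>u. LBINT y=0..ereal u. f y) has_vector_derivative f x) (at x)"
proof -
  have "((\<lambda>u. LBINT y=ereal 0..ereal u. f y) has_vector_derivative f x) (at x within {min 0 x - 1..max 0 x + 1})"
    by (rule interval_integral_FTC2) (auto intro: continuous_on_subset[OF assms])
  then show ?thesis
    by (simp add: zero_ereal_def at_within_Icc_at)
qed

lemma has_vector_derivative_fresnel:
  "(fresnel has_vector_derivative cis (pi / 2 * t\<^sup>2)) (at t within S)"
proof -
  have cis_eq: "of_real (cos u) + \<i> * of_real (sin u) = cis u" for u
    by (simp add: complex_eq_iff)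
  have C: "(fresnelC has_vector_derivative cos (pi / 2 * t\<^sup>2)) (at t)"
    unfolding fresnelC_def[abs_def]
    by (rule has_vector_derivative_LBINT_from_0) (intro continuous_intros)
  have S: "(fresnelS has_vector_derivative sin (pi / 2 * t\<^sup>2)) (at t)"
    unfolding fresnelS_def[abs_def]
    by (rule has_vector_derivative_LBINT_from_0) (intro continuous_intros)
  have "((\<lambda>t. of_real (fresnelC t) + \<i> * of_real (fresnelS t)) has_vector_derivative
      (of_real (cos (pi / 2 * t\<^sup>2)) + \<i> * of_real (sin (pi / 2 * t\<^sup>2)))) (at t)"
    by (intro has_vector_derivative_add has_vector_derivative_mult_right
        bounded_linear.has_vector_derivative[OF bounded_linear_of_real] C S)
  then have "(fresnel has_vector_derivative cis (pi / 2 * t\<^sup>2)) (at t)"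
    unfolding fresnel_def[abs_def] by (simp add: cis_eq)
  then show ?thesis
    by (rule has_vector_derivative_at_within)
qed

lemma fresnel_0: "fresnel 0 = 0"
  by (simp add: fresnel_def fresnelC_def fresnelS_def zero_ereal_def)

lemma continuous_on_fresnel: "continuous_on S fresnel"
  by (meson continuous_on_eq_continuous_within has_vector_derivative_continuous has_vector_derivative_fresnel)

lemma fresnel_minus: "fresnel (- t) = - fresnel t"
proof -
  have "((\<lambda>t. fresnel (- t) + fresnel t) has_vector_derivative 0) (at t within UNIV)" for t
  proof -
    have "(fresnel \<circ> uminus has_vector_derivative (-1) *\<^sub>R cis (pi / 2 * (- t)\<^sup>2)) (at t)"
      by (rule vector_diff_chain_at[OF _ has_vector_derivative_fresnel]) (auto intro!: derivative_eq_intros)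
    then have "((\<lambda>t. fresnel (- t) + fresnel t) has_vector_derivative ((-1) *\<^sub>R cis (pi / 2 * (- t)\<^sup>2) + cis (pi / 2 * t\<^sup>2))) (at t)"
      by (intro has_vector_derivative_add has_vector_derivative_fresnel) (simp add: o_def)
    then show ?thesis by simp
  qed
  then obtain c where "\<And>t. fresnel (- t) + fresnel t = c"
    using has_vector_derivative_zero_constant[OF convex_UNIV, of "\<lambda>t. fresnel (- t) + fresnel t"] by auto
  from this[of 0] this[of t] show ?thesis
    by (simp add: fresnel_0 eq_neg_iff_add_eq_0)
qed

lemma theta_tilde_eq_fresnel: "theta_tilde y = 1/2 + (1 - \<i>) / 2 * fresnel (y / sqrt pi)"
proof -
  have "theta_tilde y = 1/2 - (1 - \<i>) / 2 * fresnel (- (y / sqrt pi))"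
    by (simp add: theta_tilde_def fresnel_def)
  then show ?thesis
    unfolding fresnel_minus by simp
qed

lemma sym_theta_tilde: "sym theta_tilde x = sqrt (1/4 + (norm (fresnel (x / sqrt pi)))\<^sup>2 / 2)"
proof -
  define w where "w = (1 - \<i>) / 2 * fresnel (x / sqrt pi)"
  have n: "(norm w)\<^sup>2 = (norm (fresnel (x / sqrt pi)))\<^sup>2 / 2"
    by (simp add: w_def norm_mult power_mult_distrib norm_divide power_divide) (simp add: cmod_power2)
  have "(norm (theta_tilde x))\<^sup>2 + (norm (theta_tilde (- x)))\<^sup>2 = (norm (1/2 + w))\<^sup>2 + (norm (1/2 - w))\<^sup>2"
    by (simp add: theta_tilde_eq_fresnel fresnel_minus w_def)
  also have "\<dots> = 2 * (1/4 + (norm w)\<^sup>2)"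
    unfolding cmod_power2 by (simp add: power2_eq_square algebra_simps)
  finally have "sym theta_tilde x = 2 powr (-1/2) * sqrt (2 * (1/4 + (norm w)\<^sup>2))"
    by (simp add: sym_def)
  also have "\<dots> = (2 powr (-1/2) * sqrt 2) * sqrt (1/4 + (norm w)\<^sup>2)"
    by (simp add: real_sqrt_mult[symmetric])
  also have "2 powr (-1/2) * sqrt 2 = (1::real)"
    by (simp add: powr_half_sqrt[symmetric] powr_add[symmetric])
  finally show ?thesis
    by (simp add: n)
qed

text \<open>Two integrations by parts applied to the tail of the Fresnel integral.\<close>

definition fresnel_asymp :: "real \<Rightarrow> complex" where
  "fresnel_asymp t = fresnel t + (\<i> / of_real (pi * t) + 1 / of_real (pi\<^sup>2 * t ^ 3)) * cis (pi / 2 * t\<^sup>2)"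

lemma has_vector_derivative_fresnel_asymp:
  assumes "t > 0"
  shows "(fresnel_asymp has_vector_derivative - (3 / of_real (pi\<^sup>2 * t ^ 4)) * cis (pi / 2 * t\<^sup>2)) (at t within S)"
proof -
  have e: "((\<lambda>t. cis (pi / 2 * t\<^sup>2)) has_vector_derivative (\<i> * of_real (pi * t)) * cis (pi / 2 * t\<^sup>2)) (at t)"
  proof -
    have "((\<lambda>z. exp (\<i> * (of_real pi / 2 * z\<^sup>2))) has_field_derivative
      (\<i> * of_real (pi * t)) * exp (\<i> * (of_real pi / 2 * (of_real t)\<^sup>2))) (at (complex_of_real t))"
      by (auto intro!: derivative_eq_intros)
    then have "((\<lambda>t. exp (\<i> * (of_real pi / 2 * (of_real t)\<^sup>2))) has_vector_derivative
      (\<i> * of_real (pi * t)) * exp (\<i> * (of_real pi / 2 * (of_real t)\<^sup>2))) (at t)"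
      by (rule has_vector_derivative_real_field)
    then show ?thesis
      by (simp add: cis_conv_exp)
  qed
  have c: "((\<lambda>t. \<i> / of_real (pi * t) + 1 / of_real (pi\<^sup>2 * t ^ 3)) has_vector_derivative
     - \<i> / of_real (pi * t\<^sup>2) - 3 / of_real (pi\<^sup>2 * t ^ 4)) (at t)"
  proof -
    have "((\<lambda>z. \<i> / (of_real pi * z) + 1 / (of_real pi ^ 2 * z ^ 3)) has_field_derivative
      - \<i> / (of_real (pi * t\<^sup>2)) - 3 / (of_real (pi ^ 2 * t ^ 4))) (at (complex_of_real t))"
      using assms by (auto intro!: derivative_eq_intros simp: field_simps eval_nat_numeral)
    then have "((\<lambda>t. \<i> / (of_real pi * of_real t) + 1 / (of_real pi ^ 2 * of_real t ^ 3)) has_vector_derivative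
      - \<i> / (of_real (pi * t\<^sup>2)) - 3 / (of_real (pi ^ 2 * t ^ 4))) (at t)"
      by (rule has_vector_derivative_real_field)
    then show ?thesis by simp
  qed
  have "(fresnel_asymp has_vector_derivative cis (pi / 2 * t\<^sup>2) +
     ((\<i> / of_real (pi * t) + 1 / of_real (pi\<^sup>2 * t ^ 3)) * ((\<i> * of_real (pi * t)) * cis (pi / 2 * t\<^sup>2)) +
      (- \<i> / of_real (pi * t\<^sup>2) - 3 / of_real (pi\<^sup>2 * t ^ 4)) * cis (pi / 2 * t\<^sup>2))) (at t)"
    unfolding fresnel_asymp_def[abs_def]
    by (intro has_vector_derivative_add has_vector_derivative_mult has_vector_derivative_fresnel e c)
  moreover have "cis (pi / 2 * t\<^sup>2) +
     ((\<i> / of_real (pi * t) + 1 / of_real (pi\<^sup>2 * t ^ 3)) * ((\<i> * of_real (pi * t)) * cis (pi / 2 * t\<^sup>2)) +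
      (- \<i> / of_real (pi * t\<^sup>2) - 3 / of_real (pi\<^sup>2 * t ^ 4)) * cis (pi / 2 * t\<^sup>2)) =
      - (3 / of_real (pi\<^sup>2 * t ^ 4)) * cis (pi / 2 * t\<^sup>2)"
    using assms by (simp add: field_simps eval_nat_numeral)
  ultimately have "(fresnel_asymp has_vector_derivative - (3 / of_real (pi\<^sup>2 * t ^ 4)) * cis (pi / 2 * t\<^sup>2)) (at t)"
    by simp
  then show ?thesis
    by (rule has_vector_derivative_at_within)
qed

lemma fresnel_asymp_diff:
  assumes "0 < s" "s \<le> t"
  shows "norm (fresnel_asymp t - fresnel_asymp s) \<le> 1 / (pi\<^sup>2 * s ^ 3) - 1 / (pi\<^sup>2 * t ^ 3)"
proof (cases "s = t")
  case False
  have "norm (fresnel_asymp t - fresnel_asymp s) \<le> (- 1 / (pi\<^sup>2 * t ^ 3)) - (- 1 / (pi\<^sup>2 * s ^ 3))"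
  proof (rule differentiable_bound_general[where f=fresnel_asymp and \<phi>="\<lambda>t. - 1 / (pi\<^sup>2 * t ^ 3)"
        and f' = "\<lambda>t. - (3 / of_real (pi\<^sup>2 * t ^ 4)) * cis (pi / 2 * t\<^sup>2)" and \<phi>'="\<lambda>t. 3 / (pi\<^sup>2 * t ^ 4)"])
    show "s < t" using assms False by simp
    show "continuous_on {s..t} fresnel_asymp"
      using assms by (meson atLeastAtMost_iff continuous_on_eq_continuous_within has_vector_derivative_continuous
          has_vector_derivative_fresnel_asymp less_le_trans)
    show "continuous_on {s..t} (\<lambda>t. - 1 / (pi\<^sup>2 * t ^ 3))"
      using assms by (intro continuous_intros) auto
    fix x assume "s < x" "x < t"
    then have x: "x > 0" using assms by simp
    show "(fresnel_asymp has_vector_derivative - (3 / of_real (pi\<^sup>2 * x ^ 4)) * cis (pi / 2 * x\<^sup>2)) (at x)"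
      by (rule has_vector_derivative_fresnel_asymp[OF x])
    have "((\<lambda>t. - 1 / (pi\<^sup>2 * t ^ 3)) has_real_derivative 3 / (pi\<^sup>2 * x ^ 4)) (at x)"
      using x by (auto intro!: derivative_eq_intros simp: field_simps eval_nat_numeral)
    then show "((\<lambda>t. - 1 / (pi\<^sup>2 * t ^ 3)) has_vector_derivative 3 / (pi\<^sup>2 * x ^ 4)) (at x)"
      by (simp add: has_real_derivative_iff_has_vector_derivative)
    show "norm (- (3 / of_real (pi\<^sup>2 * x ^ 4)) * cis (pi / 2 * x\<^sup>2)) \<le> 3 / (pi\<^sup>2 * x ^ 4)"
      by (simp add: norm_mult norm_divide norm_power)
  qed
  then show ?thesis by simp
qed simp

lemma ex_fresnel_limit:
  "\<exists>L. \<forall>t>0. norm (fresnel t - L) \<le> 1 / (pi * t) + 2 / (pi\<^sup>2 * t ^ 3)"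
proof -
  have "Cauchy (\<lambda>n. fresnel_asymp (real (Suc n)))"
  proof (rule metric_CauchyI)
    fix e :: real assume "e > 0"
    have "(\<lambda>n. 1 / (pi\<^sup>2 * (real (Suc n)) ^ 3)) \<longlonglongrightarrow> 0"
      by real_asymp
    then obtain M where M: "\<And>n. n \<ge> M \<Longrightarrow> 1 / (pi\<^sup>2 * (real (Suc n)) ^ 3) < e"
      using \<open>e > 0\<close> by (metis (no_types, lifting) eventually_sequentially order_tendstoD(2))
    have *: "dist (fresnel_asymp (real (Suc n))) (fresnel_asymp (real (Suc m))) < e" if "M \<le> m" "m \<le> n" for m n
    proof -
      have "norm (fresnel_asymp (real (Suc n)) - fresnel_asymp (real (Suc m))) \<le>
        1 / (pi\<^sup>2 * (real (Suc m)) ^ 3) - 1 / (pi\<^sup>2 * (real (Suc n)) ^ 3)"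
        using that by (intro fresnel_asymp_diff) auto
      also have "\<dots> \<le> 1 / (pi\<^sup>2 * (real (Suc m)) ^ 3)"
        by simp
      also have "\<dots> < e" using M that by simp
      finally show ?thesis by (simp add: dist_norm)
    qed
    then show "\<exists>M. \<forall>m\<ge>M. \<forall>n\<ge>M. dist (fresnel_asymp (real (Suc m))) (fresnel_asymp (real (Suc n))) < e"
      by (metis dist_commute linorder_le_cases)
  qed
  then obtain L where L: "(\<lambda>n. fresnel_asymp (real (Suc n))) \<longlonglongrightarrow> L"
    using Cauchy_convergent convergent_def by blast
  have "norm (fresnel t - L) \<le> 1 / (pi * t) + 2 / (pi\<^sup>2 * t ^ 3)" if t: "t > 0" for t
  proof -
    have "norm (L - fresnel_asymp t) \<le> 1 / (pi\<^sup>2 * t ^ 3)"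
    proof (rule Lim_bounded[where f="\<lambda>n. norm (fresnel_asymp (real (Suc n)) - fresnel_asymp t)" and M="nat \<lceil>t\<rceil>"])
      show "(\<lambda>n. norm (fresnel_asymp (real (Suc n)) - fresnel_asymp t)) \<longlonglongrightarrow> norm (L - fresnel_asymp t)"
        by (intro tendsto_intros L)
      show "\<forall>n\<ge>nat \<lceil>t\<rceil>. norm (fresnel_asymp (real (Suc n)) - fresnel_asymp t) \<le> 1 / (pi\<^sup>2 * t ^ 3)"
      proof (intro allI impI)
        fix n assume "nat \<lceil>t\<rceil> \<le> n"
        then have "t \<le> real (Suc n)" by linarith
        then have "norm (fresnel_asymp (real (Suc n)) - fresnel_asymp t) \<le> 1 / (pi\<^sup>2 * t ^ 3) - 1 / (pi\<^sup>2 * (real (Suc n)) ^ 3)"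
          by (intro fresnel_asymp_diff t)
        also have "\<dots> \<le> 1 / (pi\<^sup>2 * t ^ 3)" by simp
        finally show "norm (fresnel_asymp (real (Suc n)) - fresnel_asymp t) \<le> 1 / (pi\<^sup>2 * t ^ 3)" .
      qed
    qed
    moreover have "norm (fresnel_asymp t - fresnel t) \<le> 1 / (pi * t) + 1 / (pi\<^sup>2 * t ^ 3)"
    proof -
      have "norm (fresnel_asymp t - fresnel t) = norm (\<i> / of_real (pi * t) + 1 / of_real (pi\<^sup>2 * t ^ 3))"
        by (simp add: fresnel_asymp_def norm_mult)
      also have "\<dots> \<le> norm (\<i> / complex_of_real (pi * t)) + norm (1 / complex_of_real (pi\<^sup>2 * t ^ 3))"
        by (rule norm_triangle_ineq)
      also have "\<dots> = 1 / (pi * t) + 1 / (pi\<^sup>2 * t ^ 3)"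
        using t by (simp add: norm_divide norm_mult norm_power)
      finally show ?thesis .
    qed
    moreover have "norm (fresnel t - L) \<le> norm (fresnel_asymp t - fresnel t) + norm (L - fresnel_asymp t)"
      using norm_triangle_ineq[of "fresnel_asymp t - fresnel t" "L - fresnel_asymp t"]
      by (simp add: norm_minus_commute)
    ultimately show ?thesis
      by simp
  qed
  then show ?thesis by blast
qed

section \<open>Bounds for the Fresnel integrals\<close>

lemma cos_le_Taylor8:
  fixes y :: real
  shows "cos y \<le> (\<Sum>j\<le>4. (-1) ^ j / fact (2 * j) * y ^ (2 * j))"
proof -
  obtain t where t: "cos y = (\<Sum>m<8. cos_coeff m * y ^ m) + (cos (t + 1/2 * real 8 * pi) / fact 8) * y ^ 8"
    using Maclaurin_cos_expansion[of y 8] by auto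
  have "(\<Sum>m<8. cos_coeff m * y ^ m) + 1 / fact 8 * y ^ 8 = (\<Sum>j\<le>4. (-1) ^ j / fact (2 * j) * y ^ (2 * j))"
    by (simp add: lessThan_nat_numeral atMost_nat_numeral cos_coeff_def)
  moreover have "cos (t + 1/2 * real 8 * pi) / fact 8 * y ^ 8 \<le> 1 / fact 8 * y ^ 8"
    by (intro mult_right_mono divide_right_mono) auto
  ultimately show ?thesis
    using t by linarith
qed

lemma deriv_le_imp_le:
  fixes f g :: "real \<Rightarrow> real"
  assumes "\<And>x. (f has_real_derivative f' x) (at x)" "\<And>x. (g has_real_derivative g' x) (at x)"
    and "\<And>x. f' x \<le> g' x" "f a \<le> g a" "a \<le> b"
  shows "f b \<le> g b"
proof -
  have "f b - g b \<le> f a - g a"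
  proof (rule DERIV_nonpos_imp_nonincreasing[OF \<open>a \<le> b\<close>])
    fix x
    show "\<exists>y. ((\<lambda>x. f x - g x) has_real_derivative y) (at x) \<and> y \<le> 0"
      using assms(1-3)[of x] by (intro exI[of _ "f' x - g' x"]) (auto intro: DERIV_diff)
  qed
  with assms(4) show ?thesis by simp
qed


text \<open>\<open>(norm (fresnel t))\<^sup>2\<close> is the double integral of \<open>cos (pi / 2 * (s\<^sup>2 - r\<^sup>2))\<close> over
  \<open>{0..t} \<times> {0..t}\<close>. Replacing the cosine by a Taylor polynomial and comparing derivatives, first in
  \<open>s\<close> and then in \<open>r\<close>, bounds it by a polynomial in \<open>t\<close>.\<close>

definition diffsq_prim :: "nat \<Rightarrow> real \<Rightarrow> real \<Rightarrow> real" where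
  "diffsq_prim n r s = (\<Sum>i\<le>n. real (n choose i) * (- (r\<^sup>2)) ^ i * (s ^ (2 * (n - i) + 1) / real (2 * (n - i) + 1)))"

definition diffsq_prim2 :: "nat \<Rightarrow> real \<Rightarrow> real \<Rightarrow> real" where
  "diffsq_prim2 n s r = (\<Sum>i\<le>n. real (n choose i) * ((-1) ^ i * (r ^ (2 * i + 1) / real (2 * i + 1))) * (s ^ (2 * (n - i) + 1) / real (2 * (n - i) + 1)))"

definition diffsq_moment :: "nat \<Rightarrow> real" where
  "diffsq_moment n = (\<Sum>i\<le>n. real (n choose i) * (-1) ^ i / (real (2 * i + 1) * real (2 * (n - i) + 1)))"

lemma DERIV_monomial_prim: "((\<lambda>x. x ^ (2 * n + 1) / real (2 * n + 1)) has_real_derivative x ^ (2 * n)) (at x)"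
proof -
  have "((\<lambda>x. x ^ (2 * n + 1) / real (2 * n + 1)) has_real_derivative (real (2 * n + 1) * x ^ (2 * n)) / real (2 * n + 1)) (at x)"
    by (intro DERIV_cdivide) (use DERIV_pow[of "2 * n + 1" x] in simp)
  then show ?thesis by simp
qed

lemma DERIV_diffsq_prim: "(diffsq_prim n r has_real_derivative (s\<^sup>2 - r\<^sup>2) ^ n) (at s)"
proof -
  have "(diffsq_prim n r has_real_derivative (\<Sum>i\<le>n. real (n choose i) * (- (r\<^sup>2)) ^ i * s ^ (2 * (n - i)))) (at s)"
    unfolding diffsq_prim_def[abs_def] by (intro DERIV_sum DERIV_cmult DERIV_monomial_prim)
  also have "(\<Sum>i\<le>n. real (n choose i) * (- (r\<^sup>2)) ^ i * s ^ (2 * (n - i))) = (s\<^sup>2 - r\<^sup>2) ^ n"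
    using binomial_ring[of "- (r\<^sup>2)" "s\<^sup>2" n] by (simp add: power_mult)
  finally show ?thesis .
qed

lemma DERIV_diffsq_prim2: "(diffsq_prim2 n s has_real_derivative diffsq_prim n r s) (at r)"
proof -
  have "(diffsq_prim2 n s has_real_derivative
    (\<Sum>i\<le>n. real (n choose i) * ((-1) ^ i * r ^ (2 * i)) * (s ^ (2 * (n - i) + 1) / real (2 * (n - i) + 1)))) (at r)"
    unfolding diffsq_prim2_def[abs_def]
    by (intro DERIV_sum DERIV_cmult DERIV_cmult_right DERIV_monomial_prim)
  also have "(\<Sum>i\<le>n. real (n choose i) * ((-1) ^ i * r ^ (2 * i)) * (s ^ (2 * (n - i) + 1) / real (2 * (n - i) + 1))) = diffsq_prim n r s"
    unfolding diffsq_prim_def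
    by (intro sum.cong refl) (simp add: power_mult power_minus[of "r\<^sup>2"])
  finally show ?thesis .
qed

lemma diffsq_prim2_diagonal: "diffsq_prim2 n t t = t ^ (2 * n + 2) * diffsq_moment n"
  unfolding diffsq_prim2_def diffsq_moment_def sum_distrib_left
proof (intro sum.cong refl)
  fix i assume "i \<in> {..n}"
  then have "2 * n + 2 = (2 * i + 1) + (2 * (n - i) + 1)" by auto
  then have "t ^ (2 * n + 2) = t ^ (2 * i + 1) * t ^ (2 * (n - i) + 1)"
    by (metis power_add)
  then show "real (n choose i) * ((-1) ^ i * (t ^ (2 * i + 1) / real (2 * i + 1))) * (t ^ (2 * (n - i) + 1) / real (2 * (n - i) + 1)) =
    t ^ (2 * n + 2) * (real (n choose i) * (-1) ^ i / (real (2 * i + 1) * real (2 * (n - i) + 1)))"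
    unfolding \<open>t ^ (2 * n + 2) = _\<close> by (simp only: times_divide_eq_left times_divide_eq_right divide_divide_eq_left mult_ac)
qed

lemma diffsq_moments:
  "diffsq_moment 0 = 1" "diffsq_moment 2 = 8/45" "diffsq_moment 4 = 128/1575"
  "diffsq_moment 6 = 1024/21021" "diffsq_moment 8 = 32768/984555"
  unfolding diffsq_moment_def
  by (simp_all add: atMost_nat_numeral binomial_eq_0 numeral_eq_Suc)

lemma fresnel_inner_bound:
  fixes r s :: real
  assumes "s \<ge> 0"
  shows "Re (cis (- (pi / 2 * r\<^sup>2)) * fresnel s) \<le>
    (\<Sum>j\<le>4. (-1) ^ j * (pi / 2) ^ (2 * j) / fact (2 * j) * diffsq_prim (2 * j) r s)"
proof (rule deriv_le_imp_le[where a=0 and b=s and f' = "\<lambda>s. cos (pi / 2 * (s\<^sup>2 - r\<^sup>2))" and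
    g' = "\<lambda>s. (\<Sum>j\<le>4. (-1) ^ j * (pi / 2) ^ (2 * j) / fact (2 * j) * (s\<^sup>2 - r\<^sup>2) ^ (2 * j))"])
  fix s :: real
  have "((\<lambda>s. cis (- (pi / 2 * r\<^sup>2)) * fresnel s) has_vector_derivative cis (- (pi / 2 * r\<^sup>2)) * cis (pi / 2 * s\<^sup>2)) (at s)"
    by (intro has_vector_derivative_mult_right has_vector_derivative_fresnel)
  then have "((\<lambda>s. Re (cis (- (pi / 2 * r\<^sup>2)) * fresnel s)) has_vector_derivative Re (cis (- (pi / 2 * r\<^sup>2)) * cis (pi / 2 * s\<^sup>2))) (at s)"
    by (rule bounded_linear.has_vector_derivative[OF bounded_linear_Re])
  moreover have "cis (- (pi / 2 * r\<^sup>2)) * cis (pi / 2 * s\<^sup>2) = cis (pi / 2 * (s\<^sup>2 - r\<^sup>2))"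
    unfolding cis_mult by (rule arg_cong[where f=cis]) (simp add: field_simps)
  ultimately show "((\<lambda>s. Re (cis (- (pi / 2 * r\<^sup>2)) * fresnel s)) has_real_derivative cos (pi / 2 * (s\<^sup>2 - r\<^sup>2))) (at s)"
    by (simp only: has_real_derivative_iff_has_vector_derivative cis.sel)
  show "((\<lambda>s. (\<Sum>j\<le>4. (-1) ^ j * (pi / 2) ^ (2 * j) / fact (2 * j) * diffsq_prim (2 * j) r s)) has_real_derivative
     (\<Sum>j\<le>4. (-1) ^ j * (pi / 2) ^ (2 * j) / fact (2 * j) * (s\<^sup>2 - r\<^sup>2) ^ (2 * j))) (at s)"
    by (intro DERIV_sum DERIV_cmult DERIV_diffsq_prim)
  have "(\<Sum>j\<le>4. (-1) ^ j * (pi / 2) ^ (2 * j) / fact (2 * j) * (s\<^sup>2 - r\<^sup>2) ^ (2 * j)) =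
    (\<Sum>j\<le>4. (-1) ^ j / fact (2 * j) * (pi / 2 * (s\<^sup>2 - r\<^sup>2)) ^ (2 * j))"
    by (simp add: power_mult_distrib power_divide mult_ac)
  then show "cos (pi / 2 * (s\<^sup>2 - r\<^sup>2)) \<le> (\<Sum>j\<le>4. (-1) ^ j * (pi / 2) ^ (2 * j) / fact (2 * j) * (s\<^sup>2 - r\<^sup>2) ^ (2 * j))"
    using cos_le_Taylor8 by simp
qed (use assms in \<open>auto simp: fresnel_0 diffsq_prim_def\<close>)

lemma fresnel_norm_sq_bound:
  fixes t :: real
  assumes "t \<ge> 0"
  defines "x \<equiv> pi / 2 * t\<^sup>2"
  shows "pi / 2 * (norm (fresnel t))\<^sup>2 \<le> x - 4/45 * x^3 + 16/4725 * x^5 - 64/945945 * x^7 + 256/310134825 * x^9"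
proof -
  have "Re (cnj (fresnel t) * fresnel t) \<le> (\<Sum>j\<le>4. (-1) ^ j * (pi / 2) ^ (2 * j) / fact (2 * j) * diffsq_prim2 (2 * j) t t)"
  proof (rule deriv_le_imp_le[where a=0 and b=t and f = "\<lambda>r. Re (cnj (fresnel r) * fresnel t)" and
      f' = "\<lambda>r. Re (cis (- (pi / 2 * r\<^sup>2)) * fresnel t)" and
      g = "\<lambda>r. (\<Sum>j\<le>4. (-1) ^ j * (pi / 2) ^ (2 * j) / fact (2 * j) * diffsq_prim2 (2 * j) t r)" and
      g' = "\<lambda>r. (\<Sum>j\<le>4. (-1) ^ j * (pi / 2) ^ (2 * j) / fact (2 * j) * diffsq_prim (2 * j) r t)"])
    fix r :: real
    have "((\<lambda>r. cnj (fresnel r) * fresnel t) has_vector_derivative cnj (cis (pi / 2 * r\<^sup>2)) * fresnel t) (at r)"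
      by (intro has_vector_derivative_mult_left has_vector_derivative_fresnel
           bounded_linear.has_vector_derivative[OF bounded_linear_cnj])
    then have "((\<lambda>r. Re (cnj (fresnel r) * fresnel t)) has_vector_derivative Re (cnj (cis (pi / 2 * r\<^sup>2)) * fresnel t)) (at r)"
      by (rule bounded_linear.has_vector_derivative[OF bounded_linear_Re])
    then show "((\<lambda>r. Re (cnj (fresnel r) * fresnel t)) has_real_derivative Re (cis (- (pi / 2 * r\<^sup>2)) * fresnel t)) (at r)"
      by (simp add: has_real_derivative_iff_has_vector_derivative cis_cnj)
    show "((\<lambda>r. (\<Sum>j\<le>4. (-1) ^ j * (pi / 2) ^ (2 * j) / fact (2 * j) * diffsq_prim2 (2 * j) t r)) has_real_derivative
      (\<Sum>j\<le>4. (-1) ^ j * (pi / 2) ^ (2 * j) / fact (2 * j) * diffsq_prim (2 * j) r t)) (at r)"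
      by (intro DERIV_sum DERIV_cmult DERIV_diffsq_prim2)
    show "Re (cis (- (pi / 2 * r\<^sup>2)) * fresnel t) \<le>
      (\<Sum>j\<le>4. (-1) ^ j * (pi / 2) ^ (2 * j) / fact (2 * j) * diffsq_prim (2 * j) r t)"
      by (rule fresnel_inner_bound[OF assms(1)])
  qed (use assms in \<open>auto simp: fresnel_0 diffsq_prim2_def\<close>)
  moreover have "Re (cnj (fresnel t) * fresnel t) = (norm (fresnel t))\<^sup>2"
    by (simp add: cmod_power2) (simp add: power2_eq_square)
  ultimately have "pi / 2 * (norm (fresnel t))\<^sup>2 \<le>
      pi / 2 * (\<Sum>j\<le>4. (-1) ^ j * (pi / 2) ^ (2 * j) / fact (2 * j) * diffsq_prim2 (2 * j) t t)"
    by simp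
  also have "\<dots> = (\<Sum>j\<le>4. (-1) ^ j / fact (2 * j) * diffsq_moment (2 * j) * x ^ (2 * j + 1))"
    unfolding sum_distrib_left x_def diffsq_prim2_diagonal
  proof (intro sum.cong refl)
    fix j :: nat
    have "t ^ (2 * (2 * j) + 2) = (t\<^sup>2) ^ (2 * j + 1)"
      unfolding power_mult[symmetric] by (rule arg_cong[where f="power t"]) simp
    then show "pi / 2 * ((-1) ^ j * (pi / 2) ^ (2 * j) / fact (2 * j) * (t ^ (2 * (2 * j) + 2) * diffsq_moment (2 * j))) =
      (-1) ^ j / fact (2 * j) * diffsq_moment (2 * j) * (pi / 2 * t\<^sup>2) ^ (2 * j + 1)"
      by (simp add: power_mult_distrib power_divide mult_ac)
  qed
  also have "\<dots> = x - 4/45 * x^3 + 16/4725 * x^5 - 64/945945 * x^7 + 256/310134825 * x^9"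
    by (simp add: atMost_nat_numeral diffsq_moments fact_numeral power_numeral_reduce)
  finally show ?thesis .
qed

lemma fresnel_poly_bound:
  fixes x :: real
  assumes "0 \<le> x" "x \<le> 5"
  shows "x - 4/45 * x^3 + 16/4725 * x^5 - 64/945945 * x^7 + 256/310134825 * x^9 \<le> 2830925027/2000000000"
proof -
  \<comment> \<open>The maximum over the interval is attained near \<open>23/10\<close>; the coefficients below are those of the
    Taylor expansion at this point.\<close>
  define h where "h = x - 23/10"
  have h: "-23/10 \<le> h" "h \<le> 27/10" and x: "x = h + 23/10"
    using assms by (auto simp: h_def)
  define T where "T = 26259616/21537140625 * h + 3174368/12922284375 * h^2 + (-3776/42170625) * h^3 + (-2944/172297125) * h^4 + (-256/310134825) * h^5"
  have T: "T \<ge> - 1/200"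
  proof (cases "h \<ge> 0")
    case True
    have "T = h * (26259616/21537140625 + 3174368/12922284375 * h + (-3776/42170625) * h^2 + (-2944/172297125) * h^3 + (-256/310134825) * h^4)" 
      by (simp add: T_def eval_nat_numeral algebra_simps)
    moreover have *: "(26259616/21537140625 + 3174368/12922284375 * h + (-3776/42170625) * h^2 + (-2944/172297125) * h^3 + (-256/310134825) * h^4) \<ge> 0"
    proof -
      have "h^2 \<le> 27/10 * h"
        using mult_right_mono[OF h(2) True] by (simp add: power2_eq_square)
      moreover have "h^3 \<le> (27/10)^3" "h^4 \<le> (27/10)^4"
        using True h by (auto simp del: power_divide intro!: power_mono)
      then have "h^3 \<le> 19683/1000" "h^4 \<le> 531441/10000"
        by (simp_all add: power_divide)
      ultimately show ?thesis
        using True h by linarith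
    qed
    ultimately have "T \<ge> 0"
      using mult_nonneg_nonneg[OF True *] by simp
    then show ?thesis by simp
  next
    case False
    then have "h^3 \<le> 0" "h^5 \<le> 0" "h^2 \<ge> 0"
      by (auto simp: power_le_zero_eq)
    moreover have "(-h)^4 \<le> (23/10)^4"
      using False h by (intro power_mono) auto
    then have "h^4 \<le> 279841/10000"
      by (simp add: power_divide)
    ultimately show ?thesis
      using False h unfolding T_def by linarith
  qed
  have h2: "h^2 \<le> 729/100"
  proof -
    have "\<bar>h\<bar>^2 \<le> (27/10)^2" using h by (intro power_mono) auto
    then show ?thesis by (simp add: power_numeral_reduce)
  qed
  define Q where "Q = 760958159924/2692142578125 + (-55309674568/1615285546875) * h + (-1811760416/107685703125) * h^2 + h^2 * T"
  have "Q \<ge> 2/100"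
  proof -
    have "h^2 * T \<ge> - (729/100) / 200"
    proof -
      have "h^2 * T \<ge> h^2 * (- 1/200)"
        using T by (intro mult_left_mono) auto
      with h2 show ?thesis by linarith
    qed
    moreover have "h^2 \<le> 4/10 * h + 621/100"
    proof -
      have "(h + 23/10) * (27/10 - h) \<ge> 0"
        using h by (intro mult_nonneg_nonneg) auto
      then show ?thesis by (simp add: power2_eq_square algebra_simps)
    qed
    ultimately show ?thesis
      using h unfolding Q_def by linarith
  qed
  then have "h^2 * (2/100) \<le> h^2 * Q"
    by (intro mult_left_mono) auto
  moreover have "0 \<le> 2486719669905533/4341887550000000000 + 2218944317/1922958984375 * h + h^2 * (2/100)"
  proof -
    have "0 \<le> (h + 2218944317/76918359375)^2" by simp
    then have "h^2 \<ge> - 2 * (2218944317/76918359375) * h - (2218944317/76918359375)^2"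
      by (simp add: power2_eq_square algebra_simps)
    then show ?thesis by (simp add: power2_eq_square[of "2218944317/76918359375"])
  qed
  moreover have "2830925027/2000000000 - (x - 4/45 * x^3 + 16/4725 * x^5 - 64/945945 * x^7 + 256/310134825 * x^9) = 2486719669905533/4341887550000000000 + 2218944317/1922958984375 * h + h^2 * Q"
    unfolding Q_def T_def x by (simp add: power_numeral_reduce algebra_simps add_divide_distrib)
  ultimately show ?thesis by linarith
qed

lemma norm_fresnel_sq_le_small:
  assumes "0 \<le> t" "t \<le> 7/4"
  shows "(norm (fresnel t))\<^sup>2 \<le> 901138/1000000"
proof -
  have pi: "31415/10000 < pi" "pi < 31416/10000"
    using pi_approx by simp_all
  have "t\<^sup>2 \<le> (7/4)\<^sup>2"
    using assms by (intro power_mono)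
  then have "pi / 2 * t\<^sup>2 \<le> (31416/10000) / 2 * (7/4)\<^sup>2"
    using pi by (intro mult_mono) auto
  then have x: "0 \<le> pi / 2 * t\<^sup>2" "pi / 2 * t\<^sup>2 \<le> 5"
    by (auto simp: power_divide)
  have "pi / 2 * (norm (fresnel t))\<^sup>2 \<le> 2830925027/2000000000"
    using fresnel_norm_sq_bound[OF assms(1)] fresnel_poly_bound[OF x] by linarith
  also have "\<dots> \<le> pi / 2 * (901138/1000000)"
    using pi by simp
  finally show ?thesis
    by simp
qed

lemma norm_fresnel_1_gt: "(norm (fresnel 1))\<^sup>2 > 1/2"
proof -
  have "Re (fresnel 1) \<ge> 1 - pi\<^sup>2 / 40"
  proof -
    have "1 - (pi / 2)\<^sup>2 / 2 * (1 ^ 5 / 5) \<le> Re (fresnel 1)"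
    proof (rule deriv_le_imp_le[where a=0 and b=1 and f="\<lambda>t. t - (pi / 2)\<^sup>2 / 2 * (t ^ 5 / 5)"
          and f'="\<lambda>t. 1 - (pi / 2 * t\<^sup>2)\<^sup>2 / 2" and g' = "\<lambda>t. cos (pi / 2 * t\<^sup>2)"])
      fix t :: real
      show "((\<lambda>t. t - (pi / 2)\<^sup>2 / 2 * (t ^ 5 / 5)) has_real_derivative 1 - (pi / 2 * t\<^sup>2)\<^sup>2 / 2) (at t)"
        by (auto intro!: derivative_eq_intros simp: power_mult_distrib power_divide power_mult[symmetric])
      show "((\<lambda>t. Re (fresnel t)) has_real_derivative cos (pi / 2 * t\<^sup>2)) (at t)"
        using bounded_linear.has_vector_derivative[OF bounded_linear_Re has_vector_derivative_fresnel[of t UNIV]]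
        by (simp only: has_real_derivative_iff_has_vector_derivative cis.sel)
      have "cos (pi / 2 * t\<^sup>2) \<ge> 1 - (pi / 2 * t\<^sup>2)\<^sup>2 / 2"
      proof -
        have "(sin (pi / 2 * t\<^sup>2 / 2))\<^sup>2 \<le> (pi / 2 * t\<^sup>2 / 2)\<^sup>2"
          using abs_sin_x_le_abs_x by (simp only: abs_le_square_iff[symmetric])
        then show ?thesis
          using cos_double_sin[of "pi / 2 * t\<^sup>2 / 2"] by (simp add: power_divide)
      qed
      then show "1 - (pi / 2 * t\<^sup>2)\<^sup>2 / 2 \<le> cos (pi / 2 * t\<^sup>2)" .
    qed (auto simp: fresnel_0)
    then show ?thesis by (simp add: power_divide)
  qed
  moreover have "pi\<^sup>2 \<le> (32/10)\<^sup>2"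
    using pi_approx by (intro power_mono) auto
  ultimately have "Re (fresnel 1) \<ge> 744/1000"
    by (simp add: power_divide)
  then have "(744/1000)\<^sup>2 \<le> (Re (fresnel 1))\<^sup>2"
    by (intro power_mono) auto
  also have "\<dots> \<le> (norm (fresnel 1))\<^sup>2"
    by (simp add: cmod_power2)
  finally show ?thesis by (simp add: power_divide)
qed

section \<open>Gaussian Abel means\<close>

lemma LINT_Ioi_FTC:
  fixes G g :: "real \<Rightarrow> complex"
  assumes "\<And>s. (G has_vector_derivative g s) (at s)" "continuous_on UNIV g"
    and int: "integrable lborel (\<lambda>s. indicator {0<..} s *\<^sub>R g s)" and lim: "(G \<longlongrightarrow> 0) at_top"
  shows "(LINT s|lborel. indicator {0<..} s *\<^sub>R g s) = - G 0"
proof -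
  have "(LBINT s=ereal 0..\<infinity>. g s) = 0 - G 0"
  proof (rule interval_integral_FTC_integrable)
    show "set_integrable lborel (einterval (ereal 0) \<infinity>) g"
      using int by (simp add: set_integrable_def)
    have "(G \<longlongrightarrow> G 0) (at 0)"
      using has_vector_derivative_continuous[OF assms(1)[of 0]] by (simp add: isCont_def)
    then show "((G \<circ> real_of_ereal) \<longlongrightarrow> G 0) (at_right (ereal 0))"
      unfolding ereal_tendsto_simps1 by (simp add: filterlim_at_split)
    show "((G \<circ> real_of_ereal) \<longlongrightarrow> 0) (at_left \<infinity>)"
      unfolding ereal_tendsto_simps1 by (rule lim)
  qed (use assms in \<open>auto simp: continuous_on_eq_continuous_at\<close>)
  then show ?thesis
    by (simp add: interval_lebesgue_integral_def set_lebesgue_integral_def)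
qed

definition rayleigh :: "real \<Rightarrow> real \<Rightarrow> real" where
  "rayleigh \<epsilon> s = indicator {0<..} s * (2 * \<epsilon> * s * exp (- (\<epsilon> * s\<^sup>2)))"

lemma rayleigh_nonneg: "\<epsilon> \<ge> 0 \<Longrightarrow> rayleigh \<epsilon> s \<ge> 0"
  by (auto simp: rayleigh_def indicator_def)

lemma integrable_rayleigh: "\<epsilon> > 0 \<Longrightarrow> integrable lborel (rayleigh \<epsilon>)"
proof -
  assume "\<epsilon> > 0"
  then have "integrable lborel (\<lambda>s. indicator {0<..} s *\<^sub>R (2 * \<epsilon> * (s ^ 1 * exp (- (\<epsilon> * s\<^sup>2)))))"
    by (intro integrable_mult_indicator integrable_mult_right integrable_gaussian_moment) auto
  then show ?thesis
    by (simp add: rayleigh_def[abs_def] mult_ac)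
qed

lemma integral_rayleigh: "(LINT s|lborel. rayleigh 1 s) = 1"
proof -
  have d: "((\<lambda>s. - of_real (exp (- (s\<^sup>2)))) has_vector_derivative complex_of_real (2 * s * exp (- (s\<^sup>2)))) (at s)" for s
  proof -
    have "((\<lambda>s. - exp (- (s\<^sup>2))) has_real_derivative 2 * s * exp (- (s\<^sup>2))) (at s)"
      by (auto intro!: derivative_eq_intros)
    then have "((\<lambda>s. of_real (- exp (- (s\<^sup>2)))) has_vector_derivative complex_of_real (2 * s * exp (- (s\<^sup>2)))) (at s)"
      by (intro bounded_linear.has_vector_derivative[OF bounded_linear_of_real])
         (simp add: has_real_derivative_iff_has_vector_derivative)
    then show ?thesis by simp
  qed
  have i: "integrable lborel (\<lambda>s. complex_of_real (rayleigh 1 s))"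
    using integrable_rayleigh[of 1] by simp
  have e: "complex_of_real (rayleigh 1 s) = indicator {0<..} s *\<^sub>R complex_of_real (2 * s * exp (- (s\<^sup>2)))" for s
    by (simp add: rayleigh_def indicator_def)
  have "complex_of_real (LINT s|lborel. rayleigh 1 s) = (LINT s|lborel. complex_of_real (rayleigh 1 s))"
    by simp
  also have "\<dots> = - (- of_real (exp (- (0\<^sup>2))))"
    unfolding e
  proof (rule LINT_Ioi_FTC[OF d])
    show "continuous_on UNIV (\<lambda>s. complex_of_real (2 * s * exp (- (s\<^sup>2))))"
      by (intro continuous_intros)
    show "integrable lborel (\<lambda>s. indicator {0<..} s *\<^sub>R complex_of_real (2 * s * exp (- (s\<^sup>2))))"
      using i unfolding e .
    have "((\<lambda>s::real. - exp (- (s\<^sup>2))) \<longlongrightarrow> 0) at_top"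
      by real_asymp
    from tendsto_of_real[OF this, where 'a=complex]
    show "((\<lambda>s. - complex_of_real (exp (- (s\<^sup>2)))) \<longlongrightarrow> 0) at_top" by simp
  qed
  finally show ?thesis
    by (simp only: power_zero_numeral minus_zero exp_zero of_real_1 minus_minus of_real_eq_1_iff)
qed

text \<open>Abel summation with the weight \<open>exp (- \<epsilon> s\<^sup>2)\<close>: the damped integral is an average of the
  truncated integrals \<open>\<Psi>\<close>, so it inherits their bound and their limit.\<close>

lemma gaussian_Abel_average:
  fixes \<Psi> \<psi> :: "real \<Rightarrow> complex"
  assumes der: "\<And>s. (\<Psi> has_vector_derivative \<psi> s) (at s)" and cont: "continuous_on UNIV \<psi>"
    and b\<psi>: "\<And>s. norm (\<psi> s) \<le> 1" and b: "\<And>s. norm (\<Psi> s) \<le> B" and "\<Psi> 0 = 0" and \<epsilon>: "\<epsilon> > 0"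
  shows "(LINT s|lborel. indicator {0<..} s *\<^sub>R (exp (- (\<epsilon> * s\<^sup>2)) *\<^sub>R \<psi> s)) =
    (LINT s|lborel. rayleigh 1 s *\<^sub>R \<Psi> (s / sqrt \<epsilon>))"
proof -
  have c\<Psi>: "continuous_on UNIV \<Psi>"
    by (rule continuous_at_imp_continuous_on) (blast intro: has_vector_derivative_continuous der)
  have [measurable]: "\<Psi> \<in> borel_measurable borel" "\<psi> \<in> borel_measurable borel"
    using c\<Psi> cont by (auto intro: borel_measurable_continuous_onI)
  have i1: "integrable lborel (\<lambda>s. indicator {0<..} s *\<^sub>R (exp (- (\<epsilon> * s\<^sup>2)) *\<^sub>R \<psi> s))"
    using integrable_gaussian_moment[OF \<epsilon>, of 0]
    by (rule Bochner_Integration.integrable_bound) (auto simp: indicator_def b\<psi> mult_left_le)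
  have i2: "integrable lborel (\<lambda>s. rayleigh \<epsilon> s *\<^sub>R \<Psi> s)"
  proof (rule Bochner_Integration.integrable_bound[OF integrable_mult_right[OF integrable_rayleigh[OF \<epsilon>], of B]])
    show "(\<lambda>s. rayleigh \<epsilon> s *\<^sub>R \<Psi> s) \<in> borel_measurable lborel"
      by (simp add: rayleigh_def)
    have "B \<ge> 0" using b norm_ge_zero order_trans by blast
    then show "AE s in lborel. norm (rayleigh \<epsilon> s *\<^sub>R \<Psi> s) \<le> norm (B * rayleigh \<epsilon> s)"
      using b by (auto simp: abs_mult mult.commute intro!: mult_right_mono)
  qed
  have i: "integrable lborel (\<lambda>s. indicator {0<..} s *\<^sub>R (exp (- (\<epsilon> * s\<^sup>2)) *\<^sub>R \<psi> s - (2 * \<epsilon> * s * exp (- (\<epsilon> * s\<^sup>2))) *\<^sub>R \<Psi> s))"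
    using Bochner_Integration.integrable_diff[OF i1 i2] by (simp add: rayleigh_def scaleR_diff_right)
  have "(LINT s|lborel. indicator {0<..} s *\<^sub>R (exp (- (\<epsilon> * s\<^sup>2)) *\<^sub>R \<psi> s - (2 * \<epsilon> * s * exp (- (\<epsilon> * s\<^sup>2))) *\<^sub>R \<Psi> s)) = - (exp (- (\<epsilon> * 0\<^sup>2)) *\<^sub>R \<Psi> 0)"
  proof (rule LINT_Ioi_FTC[where G = "\<lambda>s. exp (- (\<epsilon> * s\<^sup>2)) *\<^sub>R \<Psi> s"])
    fix s
    have "((\<lambda>s. exp (- (\<epsilon> * s\<^sup>2))) has_field_derivative - (2 * \<epsilon> * s * exp (- (\<epsilon> * s\<^sup>2)))) (at s)"
      by (auto intro!: derivative_eq_intros)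
    from has_vector_derivative_scaleR[OF this der[of s]]
    show "((\<lambda>s. exp (- (\<epsilon> * s\<^sup>2)) *\<^sub>R \<Psi> s) has_vector_derivative
        exp (- (\<epsilon> * s\<^sup>2)) *\<^sub>R \<psi> s - (2 * \<epsilon> * s * exp (- (\<epsilon> * s\<^sup>2))) *\<^sub>R \<Psi> s) (at s)"
      by simp
  next
    show "continuous_on UNIV (\<lambda>s. exp (- (\<epsilon> * s\<^sup>2)) *\<^sub>R \<psi> s - (2 * \<epsilon> * s * exp (- (\<epsilon> * s\<^sup>2))) *\<^sub>R \<Psi> s)"
      by (intro continuous_intros cont c\<Psi>)
    have "((\<lambda>s. exp (- (\<epsilon> * s\<^sup>2)) * B) \<longlongrightarrow> 0) at_top"
      using \<epsilon> by real_asymp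
    then show "((\<lambda>s. exp (- (\<epsilon> * s\<^sup>2)) *\<^sub>R \<Psi> s) \<longlongrightarrow> 0) at_top"
      by (rule Lim_null_comparison[rotated]) (auto simp: b)
  qed (rule i)
  then have "(LINT s|lborel. indicator {0<..} s *\<^sub>R (exp (- (\<epsilon> * s\<^sup>2)) *\<^sub>R \<psi> s)) = (LINT s|lborel. rayleigh \<epsilon> s *\<^sub>R \<Psi> s)"
    using Bochner_Integration.integral_diff[OF i1 i2] \<open>\<Psi> 0 = 0\<close> by (simp add: rayleigh_def scaleR_diff_right)
  also have "\<dots> = (LINT s|lborel. rayleigh 1 s *\<^sub>R \<Psi> (s / sqrt \<epsilon>))"
  proof -
    have "(LINT s|lborel. rayleigh \<epsilon> s *\<^sub>R \<Psi> s) =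
      \<bar>1 / sqrt \<epsilon>\<bar> *\<^sub>R (LINT s|lborel. rayleigh \<epsilon> (0 + 1 / sqrt \<epsilon> * s) *\<^sub>R \<Psi> (0 + 1 / sqrt \<epsilon> * s))"
      using \<epsilon> by (intro lborel_integral_real_affine) auto
    also have "\<dots> = (LINT s|lborel. (1 / sqrt \<epsilon>) *\<^sub>R (rayleigh \<epsilon> (0 + 1 / sqrt \<epsilon> * s) *\<^sub>R \<Psi> (0 + 1 / sqrt \<epsilon> * s)))"
      using \<epsilon> by (simp del: scaleR_scaleR)
    also have "\<dots> = (LINT s|lborel. rayleigh 1 s *\<^sub>R \<Psi> (s / sqrt \<epsilon>))"
    proof (rule Bochner_Integration.integral_cong[OF refl])
      fix s
      have "(1 / sqrt \<epsilon>) * rayleigh \<epsilon> (s / sqrt \<epsilon>) = rayleigh 1 s"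
        using \<epsilon> by (simp add: rayleigh_def indicator_def power_divide zero_less_divide_iff)
      then show "(1 / sqrt \<epsilon>) *\<^sub>R (rayleigh \<epsilon> (0 + 1 / sqrt \<epsilon> * s) *\<^sub>R \<Psi> (0 + 1 / sqrt \<epsilon> * s)) = rayleigh 1 s *\<^sub>R \<Psi> (s / sqrt \<epsilon>)"
        by simp
    qed
    finally show ?thesis .
  qed
  finally show ?thesis .
qed

lemma rayleigh_average_bound:
  assumes [measurable]: "\<Psi> \<in> borel_measurable borel" and b: "\<And>s. norm (\<Psi> s :: complex) \<le> B"
  shows "norm (LINT s|lborel. rayleigh 1 s *\<^sub>R \<Psi> (s / r)) \<le> B"
proof -
  have "norm (LINT s|lborel. rayleigh 1 s *\<^sub>R \<Psi> (s / r)) \<le> (LINT s|lborel. rayleigh 1 s * B)"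
  proof (rule Bochner_Integration.integral_norm_bound_integral)
    show i: "integrable lborel (\<lambda>s. rayleigh 1 s * B)"
      by (intro integrable_mult_left integrable_rayleigh) simp
    show n: "norm (rayleigh 1 s *\<^sub>R \<Psi> (s / r)) \<le> rayleigh 1 s * B" for s
      using b by (simp add: rayleigh_nonneg mult_left_mono)
    show "integrable lborel (\<lambda>s. rayleigh 1 s *\<^sub>R \<Psi> (s / r))"
      using i by (rule Bochner_Integration.integrable_bound)
        (use n in \<open>auto simp: rayleigh_def intro: order_trans[OF _ abs_ge_self]\<close>)
  qed
  also have "\<dots> = B"
    by (simp add: integral_rayleigh)
  finally show ?thesis .
qed

lemma rayleigh_average_limit:
  fixes \<epsilon> :: "nat \<Rightarrow> real"
  assumes [measurable]: "\<Psi> \<in> borel_measurable borel" and b: "\<And>s. norm (\<Psi> s :: complex) \<le> B"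
    and lim: "(\<Psi> \<longlongrightarrow> L) at_top" and \<epsilon>: "\<And>k. \<epsilon> k > 0" "\<epsilon> \<longlonglongrightarrow> 0"
  shows "(\<lambda>k. LINT s|lborel. rayleigh 1 s *\<^sub>R \<Psi> (s / sqrt (\<epsilon> k))) \<longlonglongrightarrow> L"
proof -
  have "(\<lambda>k. LINT s|lborel. rayleigh 1 s *\<^sub>R \<Psi> (s / sqrt (\<epsilon> k))) \<longlonglongrightarrow> (LINT s|lborel. rayleigh 1 s *\<^sub>R L)"
  proof (rule integral_dominated_convergence[where w="\<lambda>s. rayleigh 1 s * B"])
    show "AE s in lborel. (\<lambda>k. rayleigh 1 s *\<^sub>R \<Psi> (s / sqrt (\<epsilon> k))) \<longlonglongrightarrow> rayleigh 1 s *\<^sub>R L"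
    proof (intro AE_I2)
      fix s :: real
      show "(\<lambda>k. rayleigh 1 s *\<^sub>R \<Psi> (s / sqrt (\<epsilon> k))) \<longlonglongrightarrow> rayleigh 1 s *\<^sub>R L"
      proof (cases "s > 0")
        case True
        have "filterlim (\<lambda>k. sqrt (\<epsilon> k)) (at_right 0) sequentially"
          using \<epsilon> tendsto_real_sqrt[OF \<epsilon>(2)] by (intro tendsto_imp_filterlim_at_right) auto
        then have "filterlim (\<lambda>k. inverse (sqrt (\<epsilon> k))) at_top sequentially"
          by (rule filterlim_compose[OF filterlim_inverse_at_top_right])
        then have "filterlim (\<lambda>k. s * inverse (sqrt (\<epsilon> k))) at_top sequentially"
          using True by (intro filterlim_tendsto_pos_mult_at_top[OF tendsto_const])
        then have "(\<lambda>k. \<Psi> (s / sqrt (\<epsilon> k))) \<longlonglongrightarrow> L"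
          unfolding divide_inverse by (rule filterlim_compose[OF lim])
        then show ?thesis by (intro tendsto_intros)
      qed (simp add: rayleigh_def)
    qed
    show "AE s in lborel. norm (rayleigh 1 s *\<^sub>R \<Psi> (s / sqrt (\<epsilon> k))) \<le> rayleigh 1 s * B" for k
      using b by (auto simp: rayleigh_nonneg mult_left_mono)
    show "integrable lborel (\<lambda>s. rayleigh 1 s * B)"
      by (intro integrable_mult_left integrable_rayleigh) simp
  qed (auto simp: rayleigh_def)
  also have "(LINT s|lborel. rayleigh 1 s *\<^sub>R L) = L"
    using integrable_rayleigh[of 1] by (simp add: integral_rayleigh)
  finally show ?thesis .
qed

lemma integral_even_half:
  fixes f :: "real \<Rightarrow> complex"
  assumes "integrable lborel f" "\<And>x. f (- x) = f x"
  shows "(LINT s|lborel. indicator {0<..} s *\<^sub>R f s) = (LINT s|lborel. f s) / 2"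
proof -
  have i: "integrable lborel (\<lambda>s. indicator {0<..} s *\<^sub>R f s)" "integrable lborel (\<lambda>s. indicator {..<0} s *\<^sub>R f s)"
    using assms(1) by (auto intro: integrable_mult_indicator)
  have "(LINT s|lborel. f s) = (LINT s|lborel. indicator {0<..} s *\<^sub>R f s + indicator {..<0} s *\<^sub>R f s)"
  proof (rule integral_cong_AE)
    show "AE s in lborel. f s = indicator {0<..} s *\<^sub>R f s + indicator {..<0} s *\<^sub>R f s"
      using AE_lborel_singleton[of 0] by eventually_elim (auto simp: indicator_def)
  qed (use assms(1) in auto)
  also have "\<dots> = (LINT s|lborel. indicator {0<..} s *\<^sub>R f s) + (LINT s|lborel. indicator {..<0} s *\<^sub>R f s)"
    using i by simp
  also have "(LINT s|lborel. indicator {..<0} s *\<^sub>R f s) = (LINT s|lborel. indicator {0<..} s *\<^sub>R f s)"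
    by (subst lborel_integral_real_affine[where c="-1" and t=0]) (auto simp: assms(2) indicator_def intro!: Bochner_Integration.integral_cong)
  finally show ?thesis by simp
qed

lemma csqrt_2i: "csqrt (2 * \<i>) = 1 + \<i>"
  by (rule csqrt_unique) (auto simp: power2_eq_square algebra_simps complex_eq_iff)

lemma fresnel_bounded:
  obtains B where "\<And>t. norm (fresnel t) \<le> B"
proof -
  obtain L where L: "\<And>t. t > 0 \<Longrightarrow> norm (fresnel t - L) \<le> 1 / (pi * t) + 2 / (pi\<^sup>2 * t ^ 3)"
    using ex_fresnel_limit by blast
  have "norm (fresnel t) \<le> 1 + (norm L + 1 / pi + 2 / pi\<^sup>2)" if "t \<ge> 0" for t
  proof (cases "t \<le> 7/4")
    case True
    with norm_fresnel_sq_le_small[of t] that have "(norm (fresnel t))\<^sup>2 \<le> 1\<^sup>2" by simp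
    then have "norm (fresnel t) \<le> 1"
      by (rule power2_le_imp_le) simp
    moreover have "0 \<le> norm L + 1 / pi + 2 / pi\<^sup>2" by simp
    ultimately show ?thesis by linarith
  next
    case False
    then have "1 / (pi * t) \<le> 1 / pi" "2 / (pi\<^sup>2 * t ^ 3) \<le> 2 / pi\<^sup>2"
      by (auto simp: divide_simps)
    then show ?thesis
      using L[of t] False norm_triangle_sub[of "fresnel t" L] by simp
  qed
  then have "norm (fresnel t) \<le> 1 + (norm L + 1 / pi + 2 / pi\<^sup>2)" for t
    by (metis fresnel_minus linorder_le_cases neg_0_le_iff_le norm_minus_cancel)
  then show thesis using that by blast
qed

section \<open>The Fourier integral\<close>

lemma lborel_integral_affine:
  fixes f :: "'a::euclidean_space \<Rightarrow> 'b::{banach, second_countable_topology}"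
  assumes [measurable]: "f \<in> borel_measurable borel" and "c \<noteq> 0"
  shows "(LINT x|lborel. f x) = (\<bar>c\<bar> ^ DIM('a)) *\<^sub>R (LINT x|lborel. f (t + c *\<^sub>R x))"
  by (subst lborel_affine[OF \<open>c \<noteq> 0\<close>, of t])
     (simp add: integral_density integral_distr)

lemma lborel_integrable_affine:
  fixes f :: "'a::euclidean_space \<Rightarrow> 'b::{banach, second_countable_topology}"
  assumes f: "integrable lborel f" and "c \<noteq> 0"
  shows "integrable lborel (\<lambda>x. f (t + c *\<^sub>R x))"
proof -
  have [measurable]: "f \<in> borel_measurable borel"
    using f by (simp add: borel_measurable_integrable[of lborel, simplified])
  have "integrable (density (distr lborel borel (\<lambda>x. t + c *\<^sub>R x)) (\<lambda>_. ennreal (\<bar>c\<bar> ^ DIM('a)))) f"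
    using f by (subst lborel_affine[OF \<open>c \<noteq> 0\<close>, of t, symmetric]) 
  then have "integrable lborel (\<lambda>x. (\<bar>c\<bar> ^ DIM('a)) *\<^sub>R f (t + c *\<^sub>R x))"
    by (simp add: integrable_density integrable_distr_eq)
  then have "integrable lborel (\<lambda>x. (1 / \<bar>c\<bar> ^ DIM('a)) *\<^sub>R ((\<bar>c\<bar> ^ DIM('a)) *\<^sub>R f (t + c *\<^sub>R x)))"
    by (rule integrable_scaleR_right)
  then show ?thesis
    using \<open>c \<noteq> 0\<close> by simp
qed

lemma integrable_pair_mult:
  fixes f :: "'a::euclidean_space \<Rightarrow> complex" and g :: "'b::euclidean_space \<Rightarrow> complex"
  assumes "integrable lborel f" "integrable lborel g"
  shows "integrable (lborel \<Otimes>\<^sub>M lborel) (\<lambda>(x, y). f x * g y)"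
proof -
  have [measurable]: "f \<in> borel_measurable borel" "g \<in> borel_measurable borel"
    using assms by (simp_all add: borel_measurable_integrable[of lborel, simplified])
  show ?thesis
    using assms by (intro lborel_pair.Fubini_integrable) (auto simp: norm_mult)
qed

lemma integral_sq_Fatou:
  fixes u :: "nat \<Rightarrow> 'a \<Rightarrow> complex"
  assumes [measurable]: "\<And>k. u k \<in> borel_measurable M" "v \<in> borel_measurable M"
    and lim: "AE x in M. (\<lambda>k. u k x) \<longlonglongrightarrow> v x"
    and int: "\<And>k. integrable M (\<lambda>x. (norm (u k x))\<^sup>2)" and le: "\<And>k. (LINT x|M. (norm (u k x))\<^sup>2) \<le> b k"
    and b: "b \<longlonglongrightarrow> B"
  shows "integrable M (\<lambda>x. (norm (v x))\<^sup>2)" "(LINT x|M. (norm (v x))\<^sup>2) \<le> B"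
proof -
  have b0: "0 \<le> b k" for k
    by (rule order_trans[OF _ le]) simp
  then have B: "B \<ge> 0"
    using b by (intro LIMSEQ_le_const) auto
  have "(\<integral>\<^sup>+x. ennreal ((norm (v x))\<^sup>2) \<partial>M) = (\<integral>\<^sup>+x. liminf (\<lambda>k. ennreal ((norm (u k x))\<^sup>2)) \<partial>M)"
  proof (rule nn_integral_cong_AE, use lim in eventually_elim)
    fix x assume "(\<lambda>k. u k x) \<longlonglongrightarrow> v x"
    then have "(\<lambda>k. ennreal ((norm (u k x))\<^sup>2)) \<longlonglongrightarrow> ennreal ((norm (v x))\<^sup>2)"
      by (intro tendsto_intros)
    then show "ennreal ((norm (v x))\<^sup>2) = liminf (\<lambda>k. ennreal ((norm (u k x))\<^sup>2))"
      by (rule lim_imp_Liminf[OF sequentially_bot, symmetric])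
  qed
  also have "\<dots> \<le> liminf (\<lambda>k. \<integral>\<^sup>+x. ennreal ((norm (u k x))\<^sup>2) \<partial>M)"
    by (rule nn_integral_liminf) simp
  also have "\<dots> \<le> liminf (\<lambda>k. ennreal (b k))"
    by (intro Liminf_mono always_eventually allI) (simp add: nn_integral_eq_integral int le ennreal_leI)
  also have "\<dots> = ennreal B"
    using b by (intro lim_imp_Liminf) auto
  finally have *: "(\<integral>\<^sup>+x. ennreal ((norm (v x))\<^sup>2) \<partial>M) \<le> ennreal B" .
  show "integrable M (\<lambda>x. (norm (v x))\<^sup>2)"
    using * by (intro integrableI_bounded) (auto simp: ennreal_less_top intro: order.strict_trans1)
  then show "(LINT x|M. (norm (v x))\<^sup>2) \<le> B"
    using * B by (simp add: nn_integral_eq_integral)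
qed

abbreviation fourier_const :: "'a::euclidean_space itself \<Rightarrow> real" where
  "fourier_const _ \<equiv> (2 * pi) powr (- real DIM('a) / 2)"

lemma fourier_const_sq: "(fourier_const TYPE('a::euclidean_space))\<^sup>2 = 1 / (2 * pi) ^ DIM('a)"
proof -
  have "(fourier_const TYPE('a))\<^sup>2 = (2 * pi) powr (- real DIM('a) / 2 + - real DIM('a) / 2)"
    by (simp only: power2_eq_square powr_add)
  also have "\<dots> = 1 / (2 * pi) ^ DIM('a)"
    by (simp add: powr_minus_divide powr_realpow)
  finally show ?thesis .
qed

lemma fourier_int_lborel:
  fixes f :: "'a::euclidean_space \<Rightarrow> complex"
  assumes [measurable]: "f \<in> borel_measurable borel"
  shows "fourier_int s f \<xi> = of_real (fourier_const TYPE('a)) *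
    (LINT x|lborel. exp (of_real s * \<i> * of_real (\<xi> \<bullet> x)) * f x)"
  unfolding fourier_int_def by (subst integral_completion) auto

lemma norm_exp_fourier [simp]: "norm (exp (of_real s * \<i> * of_real t)) = 1"
  by (simp add: norm_exp_eq_Re)

lemma borel_measurable_fourier_int [measurable]:
  fixes f :: "'a::euclidean_space \<Rightarrow> complex"
  assumes [measurable]: "f \<in> borel_measurable borel"
  shows "fourier_int s f \<in> borel_measurable borel"
proof -
  have "(\<lambda>\<xi>. LINT x|lborel. exp (of_real s * \<i> * of_real (\<xi> \<bullet> x)) * f x) \<in> borel_measurable borel"
    by (rule lborel.borel_measurable_lebesgue_integral) measurable
  then show ?thesis
    by (simp add: fourier_int_lborel[OF assms, abs_def])
qed

lemma norm_fourier_int_le: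
  fixes f :: "'a::euclidean_space \<Rightarrow> complex"
  assumes "integrable lborel f"
  shows "norm (fourier_int s f \<xi>) \<le> fourier_const TYPE('a) * (LINT x|lborel. norm (f x))"
proof -
  have [measurable]: "f \<in> borel_measurable borel"
    using assms by (simp add: borel_measurable_integrable[of lborel, simplified])
  have "norm (LINT x|lborel. exp (of_real s * \<i> * of_real (\<xi> \<bullet> x)) * f x) \<le>
     (LINT x|lborel. norm (exp (of_real s * \<i> * of_real (\<xi> \<bullet> x)) * f x))"
    by (rule integral_norm_bound)
  then show ?thesis
    by (simp add: fourier_int_lborel norm_mult mult_left_mono)
qed

definition gauss_kernel :: "complex \<Rightarrow> 'a::euclidean_space \<Rightarrow> complex" where
  "gauss_kernel g z = (csqrt (of_real pi / g) / of_real (2 * pi)) ^ DIM('a) * gauss (1 / (4 * g)) z"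

lemma borel_measurable_gauss_kernel [measurable]: "gauss_kernel g \<in> borel_measurable borel"
  unfolding gauss_kernel_def[abs_def] by measurable

lemma gauss_scaleR_sign: "s = 1 \<or> s = -1 \<Longrightarrow> gauss g (s *\<^sub>R (x - y)) = gauss g (y - x)"
  by (auto simp: gauss_def norm_minus_commute)

lemma integrable_gauss_mult_bounded:
  fixes h :: "'a::euclidean_space \<Rightarrow> complex"
  assumes [measurable]: "h \<in> borel_measurable borel" and "\<And>x. norm (h x) \<le> B" and "Re g > 0"
  shows "integrable lborel (\<lambda>x. gauss g x * h x)"
proof (rule Bochner_Integration.integrable_bound[OF integrable_mult_right[OF integrable_gauss[OF \<open>Re g > 0\<close>], of "of_real B"]])
  have "B \<ge> 0" using assms(2) norm_ge_zero order_trans by blast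
  then show "AE x in lborel. norm (gauss g x * h x) \<le> norm (of_real B * gauss g x)"
    using assms(2) by (auto simp: norm_mult mult.commute intro!: mult_right_mono)
qed simp

lemma fourier_gauss_multiplier:
  fixes f :: "'a::euclidean_space \<Rightarrow> complex"
  assumes f: "integrable lborel f" and g: "Re g > 0" and s: "s = 1 \<or> s = -1"
  shows "fourier_int (- s) (\<lambda>\<xi>. gauss g \<xi> * fourier_int s f \<xi>) x = (LINT y|lborel. gauss_kernel g (x - y) * f y)"
proof -
  have [measurable]: "f \<in> borel_measurable borel"
    using f by (simp add: borel_measurable_integrable[of lborel, simplified])
  define c where "c = complex_of_real (fourier_const TYPE('a))"
  have c2: "c * c = 1 / of_real (2 * pi) ^ DIM('a)"
    using arg_cong[OF fourier_const_sq[where 'a='a], of complex_of_real] by (simp add: c_def power2_eq_square)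
  define E where "E \<xi> y = exp (\<i> * of_real ((s *\<^sub>R (y - x)) \<bullet> \<xi>)) * gauss g \<xi> * f y" for \<xi> y
  have E: "exp (of_real (- s) * \<i> * of_real (x \<bullet> \<xi>)) * (gauss g \<xi> * (exp (of_real s * \<i> * of_real (\<xi> \<bullet> y)) * f y)) = E \<xi> y" for \<xi> y
  proof -
    have "exp (of_real (- s) * \<i> * of_real (x \<bullet> \<xi>)) * exp (of_real s * \<i> * of_real (\<xi> \<bullet> y)) =
      exp (\<i> * of_real ((s *\<^sub>R (y - x)) \<bullet> \<xi>))"
      unfolding exp_add[symmetric] by (simp add: inner_diff_left inner_commute algebra_simps)
    then show ?thesis by (simp add: E_def)
  qed
  have intE: "integrable (lborel \<Otimes>\<^sub>M lborel) (\<lambda>(\<xi>, y). E \<xi> y)"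
    by (rule Bochner_Integration.integrable_bound[OF integrable_pair_mult[OF integrable_gauss[OF g] f]])
       (auto simp: E_def norm_mult)
  have "fourier_int (- s) (\<lambda>\<xi>. gauss g \<xi> * fourier_int s f \<xi>) x =
    c * (LINT \<xi>|lborel. exp (of_real (- s) * \<i> * of_real (x \<bullet> \<xi>)) * (gauss g \<xi> * (c * (LINT y|lborel. exp (of_real s * \<i> * of_real (\<xi> \<bullet> y)) * f y))))"
    by (subst fourier_int_lborel) (simp_all add: fourier_int_lborel c_def)
  also have "\<dots> = c * (LINT \<xi>|lborel. c * (LINT y|lborel. E \<xi> y))"
  proof -
    have "(LINT y|lborel. E \<xi> y) = exp (of_real (- s) * \<i> * of_real (x \<bullet> \<xi>)) *
      (gauss g \<xi> * (LINT y|lborel. exp (of_real s * \<i> * of_real (\<xi> \<bullet> y)) * f y))" for \<xi>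
      unfolding E[symmetric] by (simp only: integral_mult_right_zero)
    then show ?thesis
      by (simp only: mult_ac)
  qed
  also have "\<dots> = (c * c) * (LINT \<xi>|lborel. (LINT y|lborel. E \<xi> y))"
    by simp
  also have "(LINT \<xi>|lborel. (LINT y|lborel. E \<xi> y)) = (LINT y|lborel. (LINT \<xi>|lborel. E \<xi> y))"
    by (rule lborel_pair.Fubini_integral[OF intE, symmetric])
  also have "\<dots> = (LINT y|lborel. (csqrt (of_real pi / g) ^ DIM('a) * gauss (1 / (4 * g)) (x - y)) * f y)"
  proof (rule Bochner_Integration.integral_cong[OF refl])
    fix y
    show "(LINT \<xi>|lborel. E \<xi> y) = (csqrt (of_real pi / g) ^ DIM('a) * gauss (1 / (4 * g)) (x - y)) * f y"
      unfolding E_def using integral_gauss_fourier[OF g, of "s *\<^sub>R (y - x)"]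
      by (simp add: gauss_scaleR_sign[OF s])
  qed
  also have "c * c * \<dots> = (LINT y|lborel. (c * c) * ((csqrt (of_real pi / g) ^ DIM('a) * gauss (1 / (4 * g)) (x - y)) * f y))"
    by simp
  also have "\<dots> = (LINT y|lborel. gauss_kernel g (x - y) * f y)"
    unfolding c2 by (simp add: gauss_kernel_def power_divide)
  finally show ?thesis .
qed

lemma gauss_kernel_real:
  fixes z :: "'a::euclidean_space"
  assumes "\<delta> > 0"
  shows "gauss_kernel (of_real \<delta>) z = of_real (norm (gauss_kernel (of_real \<delta>) z))"
    and "integrable lborel (\<lambda>z::'a. norm (gauss_kernel (of_real \<delta>) z))"
    and "(LINT z|lborel. norm (gauss_kernel (of_real \<delta>) (z::'a))) = 1"
proof -
  define r where "r = (sqrt (pi / \<delta>) / (2 * pi)) ^ DIM('a)"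
  have "csqrt (of_real pi / of_real \<delta>) = of_real (sqrt (pi / \<delta>))"
    using assms csqrt_of_real_nonneg[of "pi / \<delta>"] by simp
  then have k: "gauss_kernel (of_real \<delta>) z = of_real (r * exp (- (1 / (4 * \<delta>) * (norm z)\<^sup>2)))" for z :: 'a
    by (simp add: gauss_kernel_def gauss_def r_def exp_of_real[symmetric])
  have r: "r \<ge> 0" using assms by (simp add: r_def)
  show eq: "gauss_kernel (of_real \<delta>) z = of_real (norm (gauss_kernel (of_real \<delta>) z))" for z :: 'a
    unfolding k norm_of_real using r by simp
  have int: "integrable lborel (\<lambda>z::'a. gauss_kernel (of_real \<delta>) z)"
    unfolding gauss_kernel_def using assms by (intro integrable_mult_right integrable_gauss) simp
  then show "integrable lborel (\<lambda>z::'a. norm (gauss_kernel (of_real \<delta>) z))"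
    by (rule integrable_norm)
  have "complex_of_real (LINT z|lborel. norm (gauss_kernel (of_real \<delta>) (z::'a))) = (LINT z|lborel. gauss_kernel (of_real \<delta>) (z::'a))"
    by (subst integral_complex_of_real[symmetric]) (simp add: eq[symmetric])
  also have "\<dots> = (csqrt (of_real pi / of_real \<delta>) / of_real (2 * pi)) ^ DIM('a) * csqrt (of_real pi / (1 / (4 * of_real \<delta>))) ^ DIM('a)"
    unfolding gauss_kernel_def using assms by (simp add: integral_gauss)
  also have "\<dots> = (of_real (sqrt (pi / \<delta>)) / of_real (2 * pi) * of_real (sqrt (4 * pi * \<delta>))) ^ DIM('a)"
  proof -
    have "csqrt (of_real pi / (1 / (4 * of_real \<delta>))) = of_real (sqrt (4 * pi * \<delta>))"
      using assms csqrt_of_real_nonneg[of "4 * pi * \<delta>"] by (simp add: mult_ac)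
    then show ?thesis
      using \<open>csqrt (of_real pi / of_real \<delta>) = of_real (sqrt (pi / \<delta>))\<close> by (simp only: power_mult_distrib)
  qed
  also have "of_real (sqrt (pi / \<delta>)) / of_real (2 * pi) * of_real (sqrt (4 * pi * \<delta>)) = (1 :: complex)"
  proof -
    have "sqrt (pi / \<delta>) * sqrt (4 * pi * \<delta>) = sqrt ((2 * pi)\<^sup>2)"
      unfolding real_sqrt_mult[symmetric] using assms by (simp add: power2_eq_square)
    then have "sqrt (pi / \<delta>) * sqrt (4 * pi * \<delta>) = 2 * pi"
      unfolding real_sqrt_abs by simp
    then have "sqrt (pi / \<delta>) / (2 * pi) * sqrt (4 * pi * \<delta>) = 1"
      unfolding times_divide_eq_left by simp
    then show ?thesis
      by (metis of_real_1 of_real_divide of_real_mult)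
  qed
  finally show "(LINT z|lborel. norm (gauss_kernel (of_real \<delta>) (z::'a))) = 1"
    by (simp only: power_one of_real_eq_1_iff)
qed

lemma integrable_norm_conv:
  fixes k f :: "'a::euclidean_space \<Rightarrow> complex"
  assumes k: "integrable lborel k" and f: "integrable lborel f"
  shows "integrable (lborel \<Otimes>\<^sub>M lborel) (\<lambda>(x, y). k (x - y) * f y)"
proof -
  have [measurable]: "f \<in> borel_measurable borel" "k \<in> borel_measurable borel"
    using f k by (simp_all add: borel_measurable_integrable[of lborel, simplified])
  have tr: "integrable lborel (\<lambda>x. k (x - y))" "(LINT x|lborel. norm (k (x - y))) = (LINT x|lborel. norm (k x))" for y
    using lborel_integrable_affine[OF k, of 1 "-y"] lborel_integral_affine[of "\<lambda>x. norm (k x)" 1 "-y"] by simp_all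
  have "integrable (lborel \<Otimes>\<^sub>M lborel) (\<lambda>(y, x). k (x - y) * f y)"
    using k f tr by (intro lborel_pair.Fubini_integrable) (auto simp: norm_mult)
  then show ?thesis
    using lborel_pair.integrable_product_swap[of "\<lambda>(y, x). k (x - y) * f y"] by simp
qed

lemma fourier_int_conv:
  fixes k f :: "'a::euclidean_space \<Rightarrow> complex"
  assumes k: "integrable lborel k" and f: "integrable lborel f"
  shows "fourier_int s (\<lambda>x. LINT y|lborel. k (x - y) * f y) \<xi> =
    (LINT x|lborel. exp (of_real s * \<i> * of_real (\<xi> \<bullet> x)) * k x) * fourier_int s f \<xi>"
proof -
  have [measurable]: "f \<in> borel_measurable borel" "k \<in> borel_measurable borel"
    using f k by (simp_all add: borel_measurable_integrable[of lborel, simplified])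
  define e where "e x = exp (of_real s * \<i> * of_real (\<xi> \<bullet> x))" for x
  have [measurable]: "e \<in> borel_measurable borel"
    unfolding e_def[abs_def] by measurable
  have ne: "norm (e x) = 1" for x
    by (simp add: e_def)
  have ea: "e x = e (x - y) * e y" for x y
    unfolding e_def exp_add[symmetric] by (simp add: inner_diff_right algebra_simps)
  have int: "integrable (lborel \<Otimes>\<^sub>M lborel) (\<lambda>(x, y). e x * (k (x - y) * f y))"
    by (rule Bochner_Integration.integrable_bound[OF integrable_norm_conv[OF k f]]) (auto simp: norm_mult ne)
  have [measurable]: "(\<lambda>x. LINT y|lborel. k (x - y) * f y) \<in> borel_measurable borel"
    by (rule lborel.borel_measurable_lebesgue_integral[of _ borel]) simp
  have "(LINT x|lborel. e x * (LINT y|lborel. k (x - y) * f y)) = (LINT x|lborel. LINT y|lborel. e x * (k (x - y) * f y))"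
    by simp
  also have "\<dots> = (LINT y|lborel. LINT x|lborel. e x * (k (x - y) * f y))"
    by (rule lborel_pair.Fubini_integral[OF int, symmetric])
  also have "\<dots> = (LINT y|lborel. (LINT x|lborel. e x * k x) * (e y * f y))"
  proof (rule Bochner_Integration.integral_cong[OF refl])
    fix y
    have "(LINT x|lborel. e x * (k (x - y) * f y)) = (LINT x|lborel. (e (x - y) * k (x - y)) * (e y * f y))"
      by (subst ea[of _ y]) (simp add: mult_ac)
    also have "\<dots> = (LINT x|lborel. e (x - y) * k (x - y)) * (e y * f y)"
      by simp
    also have "(LINT x|lborel. e (x - y) * k (x - y)) = (LINT x|lborel. e x * k x)"
      using lborel_integral_affine[of "\<lambda>x. e x * k x" 1 "-y"] by simp
    finally show "(LINT x|lborel. e x * (k (x - y) * f y)) = (LINT x|lborel. e x * k x) * (e y * f y)" .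
  qed
  also have "\<dots> = (LINT x|lborel. e x * k x) * (LINT y|lborel. e y * f y)"
    by simp
  finally show ?thesis
    by (simp add: fourier_int_lborel e_def)
qed

lemma borel_measurable_cnj_comp [measurable]:
  assumes [measurable]: "f \<in> borel_measurable M"
  shows "(\<lambda>x. cnj (f x)) \<in> borel_measurable M"
  by (rule measurable_compose[OF assms]) (intro borel_measurable_continuous_onI continuous_intros)

theorem fourier_Bessel:
  fixes f :: "'a::euclidean_space \<Rightarrow> complex"
  assumes f: "integrable lborel f" and f2: "integrable lborel (\<lambda>x. (norm (f x))\<^sup>2)" and s: "s = 1 \<or> s = -1"
  shows "integrable lborel (\<lambda>\<xi>. (norm (fourier_int s f \<xi>))\<^sup>2)"
    and "(LINT \<xi>|lborel. (norm (fourier_int s f \<xi>))\<^sup>2) \<le> (LINT x|lborel. (norm (f x))\<^sup>2)"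
proof -
  have [measurable]: "f \<in> borel_measurable borel"
    using f by (simp add: borel_measurable_integrable[of lborel, simplified])
  define F where "F = fourier_int s f"
  define B where "B = fourier_const TYPE('a) * (LINT x|lborel. norm (f x))"
  have FB: "norm (F \<xi>) \<le> B" for \<xi>
    using norm_fourier_int_le[OF f] by (simp add: F_def B_def)
  have [measurable]: "F \<in> borel_measurable borel"
    by (simp add: F_def)
  define c where "c = complex_of_real (fourier_const TYPE('a))"
  have damped: "integrable lborel (\<lambda>\<xi>. (norm (gauss (of_real (\<delta> / 2)) \<xi> * F \<xi>))\<^sup>2)"
     "(LINT \<xi>|lborel. (norm (gauss (of_real (\<delta> / 2)) \<xi> * F \<xi>))\<^sup>2) \<le> (LINT x|lborel. (norm (f x))\<^sup>2)" if \<delta>: "\<delta> > 0" for \<delta>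
  proof -
    define G :: "'a \<Rightarrow> complex" where "G = gauss_kernel (of_real \<delta>)"
    note G = gauss_kernel_real[OF \<delta>, where 'a='a, folded G_def]
    have [measurable]: "G \<in> borel_measurable borel"
      by (simp add: G_def)
    have sq: "of_real ((norm (gauss (of_real (\<delta> / 2)) \<xi> * F \<xi>))\<^sup>2) = gauss (of_real \<delta>) \<xi> * F \<xi> * cnj (F \<xi>)" for \<xi>
    proof -
      have "of_real ((norm (gauss (of_real (\<delta> / 2)) \<xi>))\<^sup>2) = gauss (of_real \<delta>) \<xi>"
        by (simp add: norm_gauss gauss_def exp_of_real[symmetric] exp_double[symmetric])
      then show ?thesis
        by (simp only: norm_mult power_mult_distrib of_real_mult complex_norm_square[of "F \<xi>"] mult.assoc)
    qed
    have intD: "integrable lborel (\<lambda>\<xi>. gauss (of_real \<delta>) \<xi> * F \<xi>)"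
      using \<delta> FB by (intro integrable_gauss_mult_bounded) auto
    have "integrable lborel (\<lambda>\<xi>. gauss (of_real \<delta>) \<xi> * (F \<xi> * cnj (F \<xi>)))"
    proof (rule integrable_gauss_mult_bounded)
      show "norm (F \<xi> * cnj (F \<xi>)) \<le> B * B" for \<xi>
        using FB[of \<xi>] by (auto simp: norm_mult intro!: mult_mono order_trans[OF norm_ge_zero FB])
    qed (use \<delta> in auto)
    then have "integrable lborel (\<lambda>\<xi>. complex_of_real ((norm (gauss (of_real (\<delta> / 2)) \<xi> * F \<xi>))\<^sup>2))"
      unfolding sq by (simp add: mult_ac)
    then show i: "integrable lborel (\<lambda>\<xi>. (norm (gauss (of_real (\<delta> / 2)) \<xi> * F \<xi>))\<^sup>2)"
      by (simp only: complex_of_real_integrable_eq)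
    define E where "E \<xi> y = exp (of_real (- s) * \<i> * of_real (y \<bullet> \<xi>)) * (gauss (of_real \<delta>) \<xi> * F \<xi>) * cnj (f y)" for \<xi> y
    have intE: "integrable (lborel \<Otimes>\<^sub>M lborel) (\<lambda>(\<xi>, y). E \<xi> y)"
    proof (rule Bochner_Integration.integrable_bound[OF integrable_pair_mult[OF intD f]])
      show "AE x in lborel \<Otimes>\<^sub>M lborel. norm (case x of (\<xi>, y) \<Rightarrow> E \<xi> y) \<le> norm (case x of (x, y) \<Rightarrow> gauss (of_real \<delta>) x * F x * f y)"
        by (auto simp: E_def norm_mult simp del: of_real_minus)
    qed (simp add: E_def)
    have cF: "cnj (F \<xi>) = c * (LINT y|lborel. exp (of_real (- s) * \<i> * of_real (y \<bullet> \<xi>)) * cnj (f y))" for \<xi>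
    proof -
      have "cnj (LINT y|lborel. exp (of_real s * \<i> * of_real (\<xi> \<bullet> y)) * f y) =
        (LINT y|lborel. cnj (exp (of_real s * \<i> * of_real (\<xi> \<bullet> y)) * f y))"
        by (rule Bochner_Integration.integral_cnj[symmetric])
      also have "\<dots> = (LINT y|lborel. exp (of_real (- s) * \<i> * of_real (y \<bullet> \<xi>)) * cnj (f y))"
        by (simp add: exp_cnj inner_commute)
      finally show ?thesis
        by (simp add: F_def fourier_int_lborel c_def)
    qed
    have "of_real (LINT \<xi>|lborel. (norm (gauss (of_real (\<delta> / 2)) \<xi> * F \<xi>))\<^sup>2) =
      (LINT \<xi>|lborel. gauss (of_real \<delta>) \<xi> * F \<xi> * cnj (F \<xi>))"
      unfolding sq[symmetric] by (rule integral_complex_of_real[symmetric])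
    also have "\<dots> = (LINT \<xi>|lborel. c * (LINT y|lborel. E \<xi> y))"
    proof (rule Bochner_Integration.integral_cong[OF refl])
      fix \<xi>
      have "(LINT y|lborel. E \<xi> y) = (LINT y|lborel. (gauss (of_real \<delta>) \<xi> * F \<xi>) * (exp (of_real (- s) * \<i> * of_real (y \<bullet> \<xi>)) * cnj (f y)))"
        by (simp add: E_def mult_ac)
      then show "gauss (of_real \<delta>) \<xi> * F \<xi> * cnj (F \<xi>) = c * (LINT y|lborel. E \<xi> y)"
        unfolding cF by simp
    qed
    also have "\<dots> = c * (LINT \<xi>|lborel. (LINT y|lborel. E \<xi> y))"
      by simp
    also have "(LINT \<xi>|lborel. (LINT y|lborel. E \<xi> y)) = (LINT y|lborel. (LINT \<xi>|lborel. E \<xi> y))"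
      by (rule lborel_pair.Fubini_integral[OF intE, symmetric])
    also have "c * \<dots> = (LINT y|lborel. c * (LINT \<xi>|lborel. E \<xi> y))"
      by simp
    also have "\<dots> = (LINT y|lborel. cnj (f y) * (LINT z|lborel. G (y - z) * f z))"
    proof (rule Bochner_Integration.integral_cong[OF refl])
      fix y
      have "c * (LINT \<xi>|lborel. E \<xi> y) = fourier_int (- s) (\<lambda>\<xi>. gauss (of_real \<delta>) \<xi> * F \<xi>) y * cnj (f y)"
        by (subst fourier_int_lborel) (simp_all add: E_def c_def)
      also have "fourier_int (- s) (\<lambda>\<xi>. gauss (of_real \<delta>) \<xi> * F \<xi>) y = (LINT z|lborel. G (y - z) * f z)"
        unfolding F_def G_def using \<delta> by (intro fourier_gauss_multiplier f s) simp
      finally show "c * (LINT \<xi>|lborel. E \<xi> y) = cnj (f y) * (LINT z|lborel. G (y - z) * f z)"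
        by (simp add: mult.commute)
    qed
    finally have eq: "complex_of_real (LINT \<xi>|lborel. (norm (gauss (of_real (\<delta> / 2)) \<xi> * F \<xi>))\<^sup>2) =
      (LINT y|lborel. cnj (f y) * (LINT z|lborel. G (y - z) * f z))" .
    have "(LINT \<xi>|lborel. (norm (gauss (of_real (\<delta> / 2)) \<xi> * F \<xi>))\<^sup>2) =
      Re (LINT y|lborel. cnj (f y) * (LINT z|lborel. G (y - z) * f z))"
      unfolding eq[symmetric] by (rule Re_complex_of_real[symmetric])
    also have "\<dots> \<le> norm (LINT y|lborel. cnj (f y) * (LINT z|lborel. G (y - z) * f z))"
      by (rule complex_Re_le_cmod)
    also have "\<dots> \<le> (LINT x|lborel. (norm (f x))\<^sup>2)"
    proof -
      let ?n = "\<lambda>y z. norm (G (y - z)) * ((norm (f y))\<^sup>2 / 2) + norm (G (y - z)) * ((norm (f z))\<^sup>2 / 2)"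
      have tr: "integrable lborel (\<lambda>y. norm (G (y - z)))" "(LINT y|lborel. norm (G (y - z))) = 1"
        "integrable lborel (\<lambda>y. norm (G (z - y)))" "(LINT y|lborel. norm (G (z - y))) = 1" for z
        using lborel_integrable_affine[OF G(2), of 1 "-z"] lborel_integral_affine[of "\<lambda>x. norm (G x)" 1 "-z"]
          lborel_integrable_affine[OF G(2), of "-1" z] lborel_integral_affine[of "\<lambda>x. norm (G x)" "-1" z] G(3) by simp_all
      have i1: "integrable (lborel \<Otimes>\<^sub>M lborel) (\<lambda>(y, z). norm (G (y - z)) * ((norm (f y))\<^sup>2 / 2))"
        using tr f2 by (intro lborel_pair.Fubini_integrable) auto
      have i2': "integrable (lborel \<Otimes>\<^sub>M lborel) (\<lambda>(z, y). norm (G (y - z)) * ((norm (f z))\<^sup>2 / 2))"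
        using tr f2 by (intro lborel_pair.Fubini_integrable) auto
      have i2: "integrable (lborel \<Otimes>\<^sub>M lborel) (\<lambda>(y, z). norm (G (y - z)) * ((norm (f z))\<^sup>2 / 2))"
        using lborel_pair.integrable_product_swap[OF i2'] by simp
      have bd: "norm (cnj (f y) * (G (y - z) * f z)) \<le> ?n y z" for y z
      proof -
        have "norm (f y) * norm (f z) \<le> (norm (f y))\<^sup>2 / 2 + (norm (f z))\<^sup>2 / 2"
          using sum_squares_bound[of "norm (f y)" "norm (f z)"] by simp
        from mult_left_mono[OF this, of "norm (G (y - z))"] show ?thesis
          by (simp add: norm_mult algebra_simps)
      qed
      have i: "integrable (lborel \<Otimes>\<^sub>M lborel) (\<lambda>(y, z). ?n y z)"
        using Bochner_Integration.integrable_add[OF i1 i2] by (simp add: split_beta')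
      have i3: "integrable (lborel \<Otimes>\<^sub>M lborel) (\<lambda>(y, z). cnj (f y) * (G (y - z) * f z))"
        using i by (rule Bochner_Integration.integrable_bound) (use bd in \<open>auto intro!: AE_I2 order_trans[OF _ abs_ge_self]\<close>)
      have "norm (LINT y|lborel. cnj (f y) * (LINT z|lborel. G (y - z) * f z)) =
        norm (LINT p|(lborel \<Otimes>\<^sub>M lborel). (case p of (y, z) \<Rightarrow> cnj (f y) * (G (y - z) * f z)))"
        using lborel_pair.integral_fst'[OF i3] by simp
      also have "\<dots> \<le> (LINT p|(lborel \<Otimes>\<^sub>M lborel). (case p of (y, z) \<Rightarrow> ?n y z))"
        by (rule Bochner_Integration.integral_norm_bound_integral[OF i3 i]) (use bd in auto)
      also have "\<dots> = (LINT p|(lborel \<Otimes>\<^sub>M lborel). (case p of (y, z) \<Rightarrow> norm (G (y - z)) * ((norm (f y))\<^sup>2 / 2))) +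
          (LINT p|(lborel \<Otimes>\<^sub>M lborel). (case p of (y, z) \<Rightarrow> norm (G (y - z)) * ((norm (f z))\<^sup>2 / 2)))"
        using Bochner_Integration.integral_add[OF i1 i2] by (simp add: split_beta')
      also have "(LINT p|(lborel \<Otimes>\<^sub>M lborel). (case p of (y, z) \<Rightarrow> norm (G (y - z)) * ((norm (f y))\<^sup>2 / 2))) = (LINT y|lborel. (norm (f y))\<^sup>2 / 2)"
        using lborel_pair.integral_fst'[OF i1] by (simp add: tr)
      also have "(LINT p|(lborel \<Otimes>\<^sub>M lborel). (case p of (y, z) \<Rightarrow> norm (G (y - z)) * ((norm (f z))\<^sup>2 / 2))) = (LINT z|lborel. (norm (f z))\<^sup>2 / 2)"
        using lborel_pair.integral_snd[OF i2] by (simp add: tr)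
      finally show ?thesis by simp
    qed
    finally show "(LINT \<xi>|lborel. (norm (gauss (of_real (\<delta> / 2)) \<xi> * F \<xi>))\<^sup>2) \<le> (LINT x|lborel. (norm (f x))\<^sup>2)" .
  qed
  define d where "d k = 1 / real (Suc k)" for k
  have d: "d k > 0" "d \<longlonglongrightarrow> 0" for k
    using LIMSEQ_inverse_real_of_nat by (auto simp: d_def[abs_def] inverse_eq_divide)
  have lim: "(\<lambda>k. gauss (of_real (d k / 2)) \<xi> * F \<xi>) \<longlonglongrightarrow> F \<xi>" for \<xi>
  proof -
    have "(\<lambda>k. gauss (of_real (d k / 2)) \<xi> * F \<xi>) \<longlonglongrightarrow> exp (- (of_real (0 / 2) * of_real ((norm \<xi>)\<^sup>2))) * F \<xi>"
      unfolding gauss_def by (intro tendsto_intros d(2)) auto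
    then show ?thesis by simp
  qed
  show "integrable lborel (\<lambda>\<xi>. (norm (fourier_int s f \<xi>))\<^sup>2)"
    and "(LINT \<xi>|lborel. (norm (fourier_int s f \<xi>))\<^sup>2) \<le> (LINT x|lborel. (norm (f x))\<^sup>2)"
    unfolding F_def[symmetric]
    by (rule integral_sq_Fatou[OF _ _ AE_I2[OF lim] damped(1)[OF d(1)] damped(2)[OF d(1)] tendsto_const]; simp)+
qed

theorem fourier_reverse_Bessel:
  fixes u :: "'a::euclidean_space \<Rightarrow> complex"
  assumes u: "integrable lborel u" and cont: "continuous_on UNIV u" and bd: "\<And>x. norm (u x) \<le> B" and s: "s = 1 \<or> s = -1"
    and F2: "integrable lborel (\<lambda>\<xi>. (norm (fourier_int s u \<xi>))\<^sup>2)"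
  shows "(LINT x|lborel. (norm (u x))\<^sup>2) \<le> (LINT \<xi>|lborel. (norm (fourier_int s u \<xi>))\<^sup>2)"
proof -
  have [measurable]: "u \<in> borel_measurable borel"
    using u by (simp add: borel_measurable_integrable[of lborel, simplified])
  define F where "F = fourier_int s u"
  have [measurable]: "F \<in> borel_measurable borel"
    by (simp add: F_def)
  define d where "d k = (1 / real (Suc k)) ^ 2" for k
  have d: "d k > 0" "(\<lambda>k. sqrt (d k)) \<longlonglongrightarrow> 0" for k
    using LIMSEQ_inverse_real_of_nat by (auto simp: d_def[abs_def] inverse_eq_divide)
  define v where "v k = fourier_int (- s) (\<lambda>\<xi>. gauss (of_real (d k)) \<xi> * F \<xi>)" for k
  have [measurable]: "v k \<in> borel_measurable borel" for k
    unfolding v_def by measurable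
  have g1: "norm (gauss (of_real (d k)) \<xi>) \<le> 1" for k and \<xi> :: 'a
    using d(1)[of k] by (simp add: norm_gauss)
  have le: "(norm (gauss (of_real (d k)) \<xi> * F \<xi>))\<^sup>2 \<le> (norm (F \<xi>))\<^sup>2" for k \<xi>
    using g1[of k \<xi>] by (auto simp: norm_mult mult_left_le_one_le intro!: power_mono)
  have i1: "integrable lborel (\<lambda>\<xi>. gauss (of_real (d k)) \<xi> * F \<xi>)" for k
    using d(1) norm_fourier_int_le[OF u] by (intro integrable_gauss_mult_bounded) (auto simp: F_def)
  have i2: "integrable lborel (\<lambda>\<xi>. (norm (gauss (of_real (d k)) \<xi> * F \<xi>))\<^sup>2)" for k
    using F2 unfolding F_def[symmetric]
    by (rule Bochner_Integration.integrable_bound) (use le in auto)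
  have s': "- s = 1 \<or> - s = -1" using s by auto
  have "(LINT x|lborel. (norm (v k x))\<^sup>2) \<le> (LINT \<xi>|lborel. (norm (F \<xi>))\<^sup>2)" for k
  proof -
    have "(LINT x|lborel. (norm (v k x))\<^sup>2) \<le> (LINT \<xi>|lborel. (norm (gauss (of_real (d k)) \<xi> * F \<xi>))\<^sup>2)"
      unfolding v_def by (rule fourier_Bessel[OF i1 i2 s'])
    also have "\<dots> \<le> (LINT \<xi>|lborel. (norm (F \<xi>))\<^sup>2)"
      by (rule integral_mono[OF i2]) (use F2 le in \<open>auto simp: F_def\<close>)
    finally show ?thesis .
  qed
  moreover have "integrable lborel (\<lambda>x. (norm (v k x))\<^sup>2)" for k
    unfolding v_def by (rule fourier_Bessel[OF i1 i2 s'])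
  moreover have "(\<lambda>k. v k x) \<longlonglongrightarrow> u x" for x
  proof -
    define G :: "'a \<Rightarrow> complex" where "G = gauss_kernel 1"
    note G = gauss_kernel_real[of 1, where 'a='a, simplified, folded G_def]
    have [measurable]: "G \<in> borel_measurable borel"
      by (simp add: G_def)
    have iG: "integrable lborel G" "(LINT z|lborel. G z) = 1"
    proof -
      have "integrable lborel (\<lambda>z. of_real (norm (G z)) :: complex)"
        using G(2) by simp
      then show "integrable lborel G" by (simp add: G(1)[symmetric])
      have "(LINT z|lborel. of_real (norm (G z)) :: complex) = 1"
        using G(3) by simp
      then show "(LINT z|lborel. G z) = 1" by (simp add: G(1)[symmetric])
    qed
    have vk: "v k x = (LINT z|lborel. G z * u (x - sqrt (d k) *\<^sub>R z))" for k
    proof -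
      define r where "r = sqrt (d k)"
      have r: "r > 0" "r\<^sup>2 = d k" using d(1)[of k] by (auto simp: r_def)
      have "v k x = (LINT y|lborel. gauss_kernel (of_real (d k)) (x - y) * u y)"
        unfolding v_def F_def using d(1) by (intro fourier_gauss_multiplier u s) simp
      also have "\<dots> = (\<bar>- r\<bar> ^ DIM('a)) *\<^sub>R (LINT z|lborel. gauss_kernel (of_real (d k)) (x - (x + (- r) *\<^sub>R z)) * u (x + (- r) *\<^sub>R z))"
        using r by (intro lborel_integral_affine) auto
      also have "\<dots> = (LINT z|lborel. (r ^ DIM('a)) *\<^sub>R (gauss_kernel (of_real (d k)) (r *\<^sub>R z) * u (x - r *\<^sub>R z)))"
        using r by simp
      also have "\<dots> = (LINT z|lborel. G z * u (x - r *\<^sub>R z))"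
      proof -
        have "csqrt (of_real pi / of_real (d k)) = of_real (sqrt (pi / d k))"
          using d(1)[of k] csqrt_of_real_nonneg[of "pi / d k"] by simp
        also have "sqrt (pi / d k) = sqrt pi / r"
          by (simp add: r_def real_sqrt_divide)
        finally have "of_real r * (csqrt (of_real pi / of_real (d k)) / of_real (2 * pi)) = csqrt (of_real pi) / of_real (2 * pi)"
          using r csqrt_of_real_nonneg[of pi] by simp
        moreover have "gauss (1 / (4 * of_real (d k))) (r *\<^sub>R z) = gauss (1 / (4 * 1)) z" for z :: 'a
          using r d(1)[of k] by (simp add: gauss_def power_mult_distrib)
        ultimately have "of_real (r ^ DIM('a)) * gauss_kernel (of_real (d k)) (r *\<^sub>R z) = G z" for z :: 'a
          by (simp add: G_def gauss_kernel_def power_mult_distrib[symmetric] mult.assoc[symmetric])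
        then show ?thesis
          by (simp add: scaleR_conv_of_real mult.assoc[symmetric])
      qed
      finally show ?thesis by (simp add: r_def)
    qed
    have "(\<lambda>k. LINT z|lborel. G z * u (x - sqrt (d k) *\<^sub>R z)) \<longlonglongrightarrow> (LINT z|lborel. G z * u x)"
    proof (rule integral_dominated_convergence[where w="\<lambda>z. norm (G z) * B"])
      show "integrable lborel (\<lambda>z. norm (G z) * B)"
        using G(2) by simp
      show "AE z in lborel. (\<lambda>k. G z * u (x - sqrt (d k) *\<^sub>R z)) \<longlonglongrightarrow> G z * u x"
      proof (intro AE_I2 tendsto_mult tendsto_const)
        fix z
        have "(\<lambda>k. x - sqrt (d k) *\<^sub>R z) \<longlonglongrightarrow> x - 0 *\<^sub>R z"
          by (intro tendsto_intros d(2))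
        then show "(\<lambda>k. u (x - sqrt (d k) *\<^sub>R z)) \<longlonglongrightarrow> u x"
          using cont by (intro continuous_on_tendsto_compose[OF cont]) auto
      qed
      show "AE z in lborel. norm (G z * u (x - sqrt (d k) *\<^sub>R z)) \<le> norm (G z) * B" for k
        using bd by (auto simp: norm_mult intro!: mult_left_mono)
    qed auto
    then show ?thesis
      unfolding vk using iG by simp
  qed
  ultimately show ?thesis
    unfolding F_def[symmetric]
    using integral_sq_Fatou(2)[of v lborel u "\<lambda>_. LINT \<xi>|lborel. (norm (F \<xi>))\<^sup>2" "LINT \<xi>|lborel. (norm (F \<xi>))\<^sup>2"]
    by auto
qed

section \<open>The limit of the Fresnel integrals and the half-line Gaussian\<close>

lemma fresnel_limit_value:
  assumes L: "\<And>t. t > 0 \<Longrightarrow> norm (fresnel t - L) \<le> 1 / (pi * t) + 2 / (pi\<^sup>2 * t ^ 3)"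
  shows "L = (1 + \<i>) / 2"
proof -
  define \<epsilon> where "\<epsilon> k = 1 / real (Suc k)" for k
  have \<epsilon>: "\<epsilon> k > 0" "\<epsilon> \<longlonglongrightarrow> 0" for k
    using LIMSEQ_inverse_real_of_nat by (auto simp: \<epsilon>_def[abs_def] inverse_eq_divide)
  have "(fresnel \<longlongrightarrow> L) at_top"
  proof (rule LIM_zero_cancel, rule Lim_null_comparison)
    show "\<forall>\<^sub>F t in at_top. norm (fresnel t - L) \<le> 1 / (pi * t) + 2 / (pi\<^sup>2 * t ^ 3)"
      using eventually_gt_at_top[of 0] by eventually_elim (rule L)
    show "((\<lambda>t. 1 / (pi * t) + 2 / (pi\<^sup>2 * t ^ 3)) \<longlongrightarrow> 0) at_top"
      by real_asymp
  qed
  moreover obtain B where B: "\<And>t. norm (fresnel t) \<le> B"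
    using fresnel_bounded by blast
  moreover have [measurable]: "fresnel \<in> borel_measurable borel"
    using continuous_on_fresnel by (rule borel_measurable_continuous_onI)
  ultimately have "(\<lambda>k. LINT s|lborel. rayleigh 1 s *\<^sub>R fresnel (s / sqrt (\<epsilon> k))) \<longlonglongrightarrow> L"
    using \<epsilon> by (intro rayleigh_average_limit)
  also have "(\<lambda>k. LINT s|lborel. rayleigh 1 s *\<^sub>R fresnel (s / sqrt (\<epsilon> k))) =
    (\<lambda>k. csqrt (of_real pi / (of_real (\<epsilon> k) - \<i> * of_real pi / 2)) / 2)"
  proof
    fix k
    define g where "g = of_real (\<epsilon> k) - \<i> * of_real pi / 2"
    define e where "e s = exp (- (g * (of_real s)\<^sup>2) + \<i> * of_real (0 * s))" for s :: real
    have g: "Re g > 0" using \<epsilon>(1) by (simp add: g_def)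
    have e: "exp (- (\<epsilon> k * s\<^sup>2)) *\<^sub>R cis (pi / 2 * s\<^sup>2) = e s" for s
      by (simp add: e_def g_def cis_conv_exp scaleR_conv_of_real exp_of_real[symmetric] exp_add[symmetric] algebra_simps)
    have inte: "integrable lborel e"
      using integrable_gauss[OF g, where 'a=real] by (simp add: e_def[abs_def] gauss_def[abs_def])
    have "(LINT s|lborel. rayleigh 1 s *\<^sub>R fresnel (s / sqrt (\<epsilon> k))) = (LINT s|lborel. indicator {0<..} s *\<^sub>R (exp (- (\<epsilon> k * s\<^sup>2)) *\<^sub>R cis (pi / 2 * s\<^sup>2)))"
      by (rule gaussian_Abel_average[OF has_vector_derivative_fresnel _ _ B _ \<epsilon>(1), symmetric])
         (auto intro!: continuous_intros simp: fresnel_0)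
    also have "\<dots> = (LINT s|lborel. e s) / 2"
      unfolding e by (rule integral_even_half[OF inte]) (simp add: e_def)
    also have "(LINT s|lborel. e s) = csqrt (of_real pi / g)"
      unfolding e_def gaussian_fourier[OF g] by simp
    finally show "(LINT s|lborel. rayleigh 1 s *\<^sub>R fresnel (s / sqrt (\<epsilon> k))) =
      csqrt (of_real pi / (of_real (\<epsilon> k) - \<i> * of_real pi / 2)) / 2"
      by (simp add: g_def)
  qed
  finally have 1: "(\<lambda>k. csqrt (of_real pi / (of_real (\<epsilon> k) - \<i> * of_real pi / 2)) / 2) \<longlonglongrightarrow> L" .
  have eq: "of_real pi / (of_real 0 - \<i> * of_real pi / 2) = 2 * \<i>"
    by (simp add: field_simps)
  have "(\<lambda>k. of_real pi / (of_real (\<epsilon> k) - \<i> * of_real pi / 2)) \<longlonglongrightarrow> of_real pi / (of_real 0 - \<i> * of_real pi / 2)"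
    by (intro tendsto_divide tendsto_diff tendsto_of_real tendsto_const \<epsilon>) auto
  then have "(\<lambda>k. of_real pi / (of_real (\<epsilon> k) - \<i> * of_real pi / 2)) \<longlonglongrightarrow> 2 * \<i>"
    unfolding eq .
  moreover have "isCont csqrt (2 * \<i>)"
    by (rule continuous_at_csqrt) (simp add: complex_nonpos_Reals_iff)
  ultimately have "(\<lambda>k. csqrt (of_real pi / (of_real (\<epsilon> k) - \<i> * of_real pi / 2))) \<longlonglongrightarrow> csqrt (2 * \<i>)"
    by (rule isCont_tendsto_compose[rotated])
  then have "(\<lambda>k. csqrt (of_real pi / (of_real (\<epsilon> k) - \<i> * of_real pi / 2)) / 2) \<longlonglongrightarrow> (1 + \<i>) / 2"
    unfolding csqrt_2i by (rule tendsto_divide) auto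
  with 1 show ?thesis
    by (rule LIMSEQ_unique)
qed

lemma norm_fresnel_diff_limit:
  "t > 0 \<Longrightarrow> norm (fresnel t - (1 + \<i>) / 2) \<le> 1 / (pi * t) + 2 / (pi\<^sup>2 * t ^ 3)"
proof -
  obtain L where L: "\<And>t. t > 0 \<Longrightarrow> norm (fresnel t - L) \<le> 1 / (pi * t) + 2 / (pi\<^sup>2 * t ^ 3)"
    using ex_fresnel_limit by blast
  then show "t > 0 \<Longrightarrow> norm (fresnel t - (1 + \<i>) / 2) \<le> 1 / (pi * t) + 2 / (pi\<^sup>2 * t ^ 3)"
    using fresnel_limit_value[OF L] by simp
qed

lemma tendsto_fresnel_at_top: "(fresnel \<longlongrightarrow> (1 + \<i>) / 2) at_top"
proof (rule LIM_zero_cancel, rule Lim_null_comparison)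
  show "\<forall>\<^sub>F t in at_top. norm (fresnel t - (1 + \<i>) / 2) \<le> 1 / (pi * t) + 2 / (pi\<^sup>2 * t ^ 3)"
    using eventually_gt_at_top[of 0] by eventually_elim (rule norm_fresnel_diff_limit)
  show "((\<lambda>t. 1 / (pi * t) + 2 / (pi\<^sup>2 * t ^ 3)) \<longlongrightarrow> 0) at_top"
    by real_asymp
qed

lemma norm_fresnel_limit_sq: "(norm ((1 + \<i>) / 2))\<^sup>2 = 1/2"
  by (simp add: norm_divide power_divide) (simp add: cmod_power2)

lemma norm_fresnel_sq_le: "(norm (fresnel t))\<^sup>2 \<le> 901138/1000000"
proof -
  have *: "(norm (fresnel t))\<^sup>2 \<le> 901138/1000000" if "t \<ge> 0" for t
  proof (cases "t \<le> 7/4")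
    case False
    then have t: "t > 7/4" by simp
    have n: "norm ((1 + \<i>) / 2) \<le> 708/1000"
    proof (rule power2_le_imp_le)
      show "(norm ((1 + \<i>) / 2))\<^sup>2 \<le> (708/1000)\<^sup>2"
        unfolding norm_fresnel_limit_sq by (simp add: power_divide)
    qed simp
    have pt: "pi * t \<ge> 3 * (7/4)"
      using t pi_gt3 by (intro mult_mono) auto
    have "pi\<^sup>2 \<ge> 3\<^sup>2"
      using pi_gt3 by (intro power_mono) auto
    moreover have "t ^ 3 \<ge> (7/4) ^ 3"
      using t by (intro power_mono) auto
    ultimately have p2: "pi\<^sup>2 * t ^ 3 \<ge> 9 * (343/64)"
      by (intro mult_mono) (auto simp: power_divide)
    have "norm (fresnel t) \<le> norm ((1 + \<i>) / 2) + norm (fresnel t - (1 + \<i>) / 2)"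
      by (rule norm_triangle_sub)
    also have "\<dots> \<le> 708/1000 + (1 / (3 * (7/4)) + 2 / (9 * (343/64)))"
    proof (intro add_mono n order_trans[OF norm_fresnel_diff_limit])
      show "1 / (pi * t) \<le> 1 / (3 * (7/4))"
        using pt by (intro divide_left_mono) auto
      show "2 / (pi\<^sup>2 * t ^ 3) \<le> 2 / (9 * (343/64))"
        using p2 by (intro divide_left_mono) auto
    qed (use t in auto)
    also have "\<dots> \<le> 94/100" by simp
    finally have "(norm (fresnel t))\<^sup>2 \<le> (94/100)\<^sup>2"
      by (intro power_mono) auto
    then show ?thesis by (simp add: power_divide)
  qed (use that norm_fresnel_sq_le_small in auto)
  show ?thesis
  proof (cases "t \<ge> 0")
    case False
    then show ?thesis using *[of "- t"] by (simp add: fresnel_minus)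
  qed (rule *)
qed

lemma norm_fresnel_le_1: "norm (fresnel t) \<le> 1"
proof (rule power2_le_imp_le)
  show "(norm (fresnel t))\<^sup>2 \<le> 1\<^sup>2"
    using norm_fresnel_sq_le[of t] by simp
qed simp

lemma fresnel_norm_attains_max: "\<exists>t0. \<forall>t. norm (fresnel t) \<le> norm (fresnel t0)"
proof -
  have "((\<lambda>t. (norm (fresnel t))\<^sup>2) \<longlongrightarrow> 1/2) at_top"
    using tendsto_power[OF tendsto_norm[OF tendsto_fresnel_at_top], of 2] unfolding norm_fresnel_limit_sq .
  then have "\<forall>\<^sub>F t in at_top. (norm (fresnel t))\<^sup>2 < (norm (fresnel 1))\<^sup>2"
    using norm_fresnel_1_gt by (rule order_tendstoD)
  then obtain T where T: "\<And>t. t \<ge> T \<Longrightarrow> (norm (fresnel t))\<^sup>2 < (norm (fresnel 1))\<^sup>2"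
    unfolding eventually_at_top_linorder by blast
  define R where "R = max 1 T"
  have "\<exists>t0\<in>{0..R}. \<forall>t\<in>{0..R}. norm (fresnel t) \<le> norm (fresnel t0)"
    by (intro continuous_attains_sup continuous_on_norm continuous_on_fresnel) (auto simp: R_def)
  then obtain t0 where t0: "\<And>t. t \<in> {0..R} \<Longrightarrow> norm (fresnel t) \<le> norm (fresnel t0)"
    by blast
  have pos: "norm (fresnel t) \<le> norm (fresnel t0)" if "t \<ge> 0" for t
  proof (cases "t \<le> R")
    case False
    then have "(norm (fresnel t))\<^sup>2 < (norm (fresnel 1))\<^sup>2"
      by (intro T) (auto simp: R_def)
    then have "norm (fresnel t) \<le> norm (fresnel 1)"
      using power2_less_imp_less[of "norm (fresnel t)" "norm (fresnel 1)"] by simp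
    also have "\<dots> \<le> norm (fresnel t0)"
      by (rule t0) (auto simp: R_def)
    finally show ?thesis .
  qed (use that t0 in auto)
  have "norm (fresnel t) \<le> norm (fresnel t0)" for t
    using pos[of t] pos[of "- t"] by (cases "t \<ge> 0") (auto simp: fresnel_minus)
  then show ?thesis by blast
qed

lemma sym_theta_tilde_attains_max:
  "\<exists>x0. (\<forall>x. sym theta_tilde x \<le> sym theta_tilde x0) \<and> sym theta_tilde x0 \<le> 0.837"
proof -
  obtain t0 where t0: "\<And>t. norm (fresnel t) \<le> norm (fresnel t0)"
    using fresnel_norm_attains_max by blast
  have "sym theta_tilde x \<le> sym theta_tilde (t0 * sqrt pi)" for x
    unfolding sym_theta_tilde using t0[of "x / sqrt pi"]
    by (auto intro!: real_sqrt_le_mono divide_right_mono power_mono)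
  moreover have "sym theta_tilde (t0 * sqrt pi) \<le> 0.837"
  proof -
    have "sym theta_tilde (t0 * sqrt pi) \<le> sqrt (0.837\<^sup>2)"
      unfolding sym_theta_tilde using norm_fresnel_sq_le[of "t0 * sqrt pi / sqrt pi"]
      by (intro real_sqrt_le_mono) (simp add: power2_eq_square)
    then show ?thesis by simp
  qed
  ultimately show ?thesis by blast
qed

definition half_gauss :: "complex \<Rightarrow> real \<Rightarrow> complex" where
  "half_gauss g \<eta> = (LINT s|lborel. indicator {0<..} s *\<^sub>R exp (- (g * (of_real s)\<^sup>2) + \<i> * of_real (\<eta> * s)))"

lemma half_gauss_eq_average:
  fixes f \<epsilon> \<eta> :: real
  assumes f: "f > 0" and \<epsilon>: "\<epsilon> > 0"
  defines "\<Psi> \<equiv> \<lambda>s. (of_real (sqrt (pi / f)) * cis (- (\<eta>\<^sup>2 / (2 * f)))) *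
      (fresnel (sqrt (f / pi) * (\<eta> / f + s)) - fresnel (sqrt (f / pi) * (\<eta> / f)))"
  shows "half_gauss (of_real \<epsilon> - \<i> * of_real f / 2) \<eta> = (LINT s|lborel. rayleigh 1 s *\<^sub>R \<Psi> (s / sqrt \<epsilon>))"
    and "norm (\<Psi> s) \<le> 2 * sqrt (pi / f)" and "\<Psi> \<in> borel_measurable borel"
    and "(\<Psi> \<longlongrightarrow> (of_real (sqrt (pi / f)) * cis (- (\<eta>\<^sup>2 / (2 * f)))) * ((1 + \<i>) / 2 - fresnel (sqrt (f / pi) * (\<eta> / f)))) at_top"
proof -
  have b: "norm (\<Psi> s) \<le> 2 * sqrt (pi / f)" for s
  proof -
    have "norm (\<Psi> s) \<le> sqrt (pi / f) * (norm (fresnel (sqrt (f / pi) * (\<eta> / f + s))) + norm (fresnel (sqrt (f / pi) * (\<eta> / f))))"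
      unfolding \<Psi>_def norm_mult using f by (simp add: mult_left_mono norm_triangle_ineq4)
    also have "\<dots> \<le> sqrt (pi / f) * (1 + 1)"
      using f by (intro mult_left_mono add_mono norm_fresnel_le_1) auto
    finally show ?thesis by simp
  qed
  then show "norm (\<Psi> s) \<le> 2 * sqrt (pi / f)" .
  have d: "(\<Psi> has_vector_derivative cis (f / 2 * s\<^sup>2 + \<eta> * s)) (at s)" for s
  proof -
    define r where "r = sqrt (f / pi)"
    have r: "r > 0" "r\<^sup>2 = f / pi"
      using f by (auto simp: r_def)
    have r': "sqrt (pi / f) = 1 / r"
      by (simp add: r_def real_sqrt_divide)
    have "((fresnel \<circ> (\<lambda>s. r * (\<eta> / f + s))) has_vector_derivative r *\<^sub>R cis (pi / 2 * (r * (\<eta> / f + s))\<^sup>2)) (at s)"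
      by (rule vector_diff_chain_at[OF _ has_vector_derivative_fresnel])
         (auto intro!: derivative_eq_intros simp: has_real_derivative_iff_has_vector_derivative[symmetric])
    then have "((\<lambda>s. fresnel (r * (\<eta> / f + s)) - fresnel (r * (\<eta> / f))) has_vector_derivative r *\<^sub>R cis (pi / 2 * (r * (\<eta> / f + s))\<^sup>2)) (at s)"
      by (auto intro!: derivative_eq_intros simp: o_def)
    then have "(\<Psi> has_vector_derivative (of_real (sqrt (pi / f)) * cis (- (\<eta>\<^sup>2 / (2 * f)))) * (r *\<^sub>R cis (pi / 2 * (r * (\<eta> / f + s))\<^sup>2))) (at s)"
      unfolding \<Psi>_def r_def by (rule has_vector_derivative_mult_right)
    also have "(of_real (sqrt (pi / f)) * cis (- (\<eta>\<^sup>2 / (2 * f)))) * (r *\<^sub>R cis (pi / 2 * (r * (\<eta> / f + s))\<^sup>2)) =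
       cis (- (\<eta>\<^sup>2 / (2 * f))) * cis (pi / 2 * (r * (\<eta> / f + s))\<^sup>2)"
      using r by (simp add: r' scaleR_conv_of_real)
    also have "\<dots> = cis (f / 2 * s\<^sup>2 + \<eta> * s)"
    proof -
      have "pi / 2 * (r * (\<eta> / f + s))\<^sup>2 = f / 2 * (\<eta> / f + s)\<^sup>2"
        by (simp add: power_mult_distrib r)
      then have "- (\<eta>\<^sup>2 / (2 * f)) + pi / 2 * (r * (\<eta> / f + s))\<^sup>2 = f / 2 * s\<^sup>2 + \<eta> * s"
        using f by (simp add: power2_eq_square field_simps)
      then show ?thesis by (simp add: cis_mult)
    qed
    finally show ?thesis .
  qed
  have "continuous_on UNIV \<Psi>"
    unfolding \<Psi>_def by (intro continuous_intros continuous_on_compose2[OF continuous_on_fresnel[of UNIV]]) auto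
  then show "\<Psi> \<in> borel_measurable borel"
    by (rule borel_measurable_continuous_onI)
  have e: "exp (- ((of_real \<epsilon> - \<i> * of_real f / 2) * (of_real s)\<^sup>2) + \<i> * of_real (\<eta> * s)) =
    exp (- (\<epsilon> * s\<^sup>2)) *\<^sub>R cis (f / 2 * s\<^sup>2 + \<eta> * s)" for s
    by (simp add: cis_conv_exp scaleR_conv_of_real exp_of_real[symmetric] exp_add[symmetric] algebra_simps)
  show "half_gauss (of_real \<epsilon> - \<i> * of_real f / 2) \<eta> = (LINT s|lborel. rayleigh 1 s *\<^sub>R \<Psi> (s / sqrt \<epsilon>))"
    unfolding half_gauss_def e
    by (rule gaussian_Abel_average[OF d _ _ b _ \<epsilon>]) (auto intro!: continuous_intros simp: \<Psi>_def)
  show "(\<Psi> \<longlongrightarrow> (of_real (sqrt (pi / f)) * cis (- (\<eta>\<^sup>2 / (2 * f)))) * ((1 + \<i>) / 2 - fresnel (sqrt (f / pi) * (\<eta> / f)))) at_top"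
    unfolding \<Psi>_def
  proof (intro tendsto_intros filterlim_compose[OF tendsto_fresnel_at_top])
    show "filterlim (\<lambda>s. sqrt (f / pi) * (\<eta> / f + s)) at_top at_top"
      using f by (intro filterlim_tendsto_pos_mult_at_top[OF tendsto_const] filterlim_tendsto_add_at_top[OF tendsto_const] filterlim_ident) auto
  qed
qed

lemma norm_half_gauss_le:
  assumes "f > 0" "\<epsilon> > 0"
  shows "norm (half_gauss (of_real \<epsilon> - \<i> * of_real f / 2) \<eta>) \<le> 2 * sqrt (pi / f)"
  unfolding half_gauss_eq_average(1)[OF assms]
  by (rule rayleigh_average_bound) (rule half_gauss_eq_average[OF assms])+

lemma half_gauss_limit:
  fixes \<epsilon> :: "nat \<Rightarrow> real"
  assumes f: "f > 0" and \<epsilon>: "\<And>k. \<epsilon> k > 0" "\<epsilon> \<longlonglongrightarrow> 0"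
  shows "(\<lambda>k. norm (half_gauss (of_real (\<epsilon> k) - \<i> * of_real f / 2) \<eta>) * sqrt (norm (of_real (\<epsilon> k) - \<i> * of_real f / 2) / pi))
    \<longlonglongrightarrow> norm (theta_tilde (- (\<eta> / sqrt f)))"
proof -
  have "(\<lambda>k. half_gauss (of_real (\<epsilon> k) - \<i> * of_real f / 2) \<eta>) \<longlonglongrightarrow>
    (of_real (sqrt (pi / f)) * cis (- (\<eta>\<^sup>2 / (2 * f)))) * ((1 + \<i>) / 2 - fresnel (sqrt (f / pi) * (\<eta> / f)))"
    unfolding half_gauss_eq_average(1)[OF f \<epsilon>(1)]
    by (rule rayleigh_average_limit[OF _ _ _ \<epsilon>]) (rule half_gauss_eq_average[OF f \<epsilon>(1)])+
  then have "(\<lambda>k. norm (half_gauss (of_real (\<epsilon> k) - \<i> * of_real f / 2) \<eta>) * sqrt (norm (of_real (\<epsilon> k) - \<i> * of_real f / 2) / pi)) \<longlonglongrightarrow>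
    norm ((of_real (sqrt (pi / f)) * cis (- (\<eta>\<^sup>2 / (2 * f)))) * ((1 + \<i>) / 2 - fresnel (sqrt (f / pi) * (\<eta> / f)))) *
     sqrt (norm (of_real 0 - \<i> * of_real f / 2) / pi)"
    by (intro tendsto_intros \<epsilon>) auto
  also have "norm ((of_real (sqrt (pi / f)) * cis (- (\<eta>\<^sup>2 / (2 * f)))) * ((1 + \<i>) / 2 - fresnel (sqrt (f / pi) * (\<eta> / f)))) *
     sqrt (norm (of_real 0 - \<i> * of_real f / 2) / pi) = norm (theta_tilde (- (\<eta> / sqrt f)))"
  proof -
    have a: "sqrt (f / pi) * (\<eta> / f) = \<eta> / sqrt f / sqrt pi"
      using f by (simp add: real_sqrt_divide real_div_sqrt field_simps)
    have "theta_tilde (- (\<eta> / sqrt f)) = (1 - \<i>) / 2 * ((1 + \<i>) / 2 - fresnel (\<eta> / sqrt f / sqrt pi))"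
      unfolding theta_tilde_eq_fresnel minus_divide_left[symmetric] fresnel_minus
      by (simp add: algebra_simps)
    then have nt: "norm (theta_tilde (- (\<eta> / sqrt f))) = norm ((1 - \<i>) / 2) * norm ((1 + \<i>) / 2 - fresnel (\<eta> / sqrt f / sqrt pi))"
      by (simp only: norm_mult)
    have xy: "sqrt (pi / f) * sqrt (norm (of_real 0 - \<i> * of_real f / 2) / pi) = norm ((1 - \<i>) / 2)"
    proof -
      have "sqrt (pi / f) * sqrt (norm (of_real 0 - \<i> * of_real f / 2) / pi) = sqrt (1/2)"
        unfolding real_sqrt_mult[symmetric] using f by (simp add: norm_mult norm_divide)
      also have "\<dots> = norm ((1 - \<i>) / 2)"
        by (rule real_sqrt_unique) (auto simp: norm_divide power_divide cmod_power2)
      finally show ?thesis .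
    qed
    have nz: "norm ((of_real (sqrt (pi / f)) * cis (- (\<eta>\<^sup>2 / (2 * f)))) * z) = sqrt (pi / f) * norm z" for z
      using f by (simp add: norm_mult)
    show ?thesis
      unfolding a nz nt xy[symmetric] by (simp only: mult_ac)
  qed
  finally show ?thesis .
qed

section \<open>Fourier transform of a Gaussian on a half-space\<close>

text \<open>Integrating first along the lines parallel to \<open>n\<close>; the Gaussian weight in \<open>n \<bullet> x\<close> replaces
  the choice of a complementary hyperplane.\<close>

lemma integral_along_direction:
  fixes f :: "'a::euclidean_space \<Rightarrow> complex" and n :: 'a
  assumes f: "integrable lborel f" and n: "norm n = 1"
  shows "of_real (sqrt pi) * (LINT x|lborel. f x) =
    (LINT x|lborel. gauss 1 (n \<bullet> x) * (LINT t|lborel. f (x - t *\<^sub>R n)))"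
proof -
  have [measurable]: "f \<in> borel_measurable borel"
    using f by (simp add: borel_measurable_integrable[of lborel, simplified])
  let ?w = "gauss 1 :: real \<Rightarrow> complex"
  have nn: "n \<bullet> n = 1"
    using n by (simp add: dot_square_norm)
  have w: "integrable lborel ?w" "(LINT t|lborel. ?w t) = of_real (sqrt pi)"
    using integrable_gauss[of 1, where 'a=real] integral_gauss[of 1, where 'a=real] csqrt_of_real_nonneg[of pi] by simp_all
  have wt: "integrable lborel (\<lambda>t. ?w (t + c))" "(LINT t|lborel. ?w (t + c)) = of_real (sqrt pi)" for c
    using lborel_integrable_affine[OF w(1), of 1 c] lborel_integral_affine[of ?w 1 c] w(2)
    by (simp_all add: add.commute)
  have w1: "norm (?w t) \<le> 1" for t
    by (simp add: norm_gauss)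
  have i1: "integrable (lborel \<Otimes>\<^sub>M lborel) (\<lambda>(x, t). ?w (t + n \<bullet> x) * f x)"
  proof (rule lborel_pair.Fubini_integrable)
    have "(LINT t|lborel. norm (?w (t + c))) = (LINT t|lborel. norm (?w t))" for c
      using lborel_integral_affine[of "\<lambda>t. norm (?w t)" 1 c] by (simp add: add.commute)
    then show "integrable lborel (\<lambda>x. LINT t|lborel. norm (case (x, t) of (x, t) \<Rightarrow> ?w (t + n \<bullet> x) * f x))"
      using f by (simp add: norm_mult)
    show "AE x in lborel. integrable lborel (\<lambda>t. case (x, t) of (x, t) \<Rightarrow> ?w (t + n \<bullet> x) * f x)"
      using wt by simp
  qed measurable
  have sh: "(LINT x|lborel. h (n \<bullet> x) (x - t *\<^sub>R n)) = (LINT x|lborel. h (t + n \<bullet> x) x)"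
    if [measurable]: "(\<lambda>x. h (n \<bullet> x) (x - t *\<^sub>R n)) \<in> borel_measurable borel" for h :: "real \<Rightarrow> 'a \<Rightarrow> 'b::{banach, second_countable_topology}" and t
    using lborel_integral_affine[of "\<lambda>x. h (n \<bullet> x) (x - t *\<^sub>R n)" 1 "t *\<^sub>R n"]
    by (simp add: inner_add_right nn)
  have i2: "integrable (lborel \<Otimes>\<^sub>M lborel) (\<lambda>(t, x). ?w (n \<bullet> x) * f (x - t *\<^sub>R n))"
  proof (rule lborel_pair.Fubini_integrable)
    have "(LINT x|lborel. norm (?w (n \<bullet> x) * f (x - t *\<^sub>R n))) = (LINT x|lborel. norm (?w (t + n \<bullet> x) * f x))" for t
      by (rule sh[of "\<lambda>a x. norm (?w a * f x)"]) measurable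
    moreover have "integrable lborel (\<lambda>t. LINT x|lborel. norm (?w (t + n \<bullet> x) * f x))"
      using lborel_pair.integrable_snd[of "\<lambda>x t. norm (?w (t + n \<bullet> x) * f x)"] integrable_norm[OF i1]
      by (simp add: split_beta')
    ultimately show "integrable lborel (\<lambda>t. LINT x|lborel. norm (case (t, x) of (t, x) \<Rightarrow> ?w (n \<bullet> x) * f (x - t *\<^sub>R n)))"
      by simp
    have "integrable lborel (\<lambda>x. ?w (n \<bullet> x) * f (x - t *\<^sub>R n))" for t
    proof (rule Bochner_Integration.integrable_bound)
      show "integrable lborel (\<lambda>x. f (x - t *\<^sub>R n))"
        using lborel_integrable_affine[OF f, of 1 "- t *\<^sub>R n"] by simp
    qed (use w1 in \<open>auto simp: norm_mult mult_left_le_one_le\<close>)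
    then show "AE t in lborel. integrable lborel (\<lambda>x. case (t, x) of (t, x) \<Rightarrow> ?w (n \<bullet> x) * f (x - t *\<^sub>R n))"
      by simp
  qed measurable
  have "of_real (sqrt pi) * (LINT x|lborel. f x) = (LINT x|lborel. LINT t|lborel. ?w (t + n \<bullet> x) * f x)"
    by (simp add: wt)
  also have "\<dots> = (LINT t|lborel. LINT x|lborel. ?w (t + n \<bullet> x) * f x)"
    by (rule lborel_pair.Fubini_integral[OF i1, symmetric])
  also have "\<dots> = (LINT t|lborel. LINT x|lborel. ?w (n \<bullet> x) * f (x - t *\<^sub>R n))"
    by (intro Bochner_Integration.integral_cong refl sh[of "\<lambda>a x. ?w a * f x", symmetric]) measurable
  also have "\<dots> = (LINT x|lborel. LINT t|lborel. ?w (n \<bullet> x) * f (x - t *\<^sub>R n))"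
    by (rule lborel_pair.Fubini_integral[OF i2, symmetric])
  finally show ?thesis by simp
qed

lemma half_space_gauss_fourier:
  fixes n \<xi> :: "'a::euclidean_space"
  assumes n: "norm n = 1" and g: "Re g > 0"
  shows "norm (LINT x|lborel. exp (of_real (-1) * \<i> * of_real (\<xi> \<bullet> x)) * (indicator {x. n \<bullet> x < 0} x * gauss g x)) \<le>
    norm (csqrt (of_real pi / g)) ^ (DIM('a) - 1) * norm (half_gauss g (n \<bullet> \<xi>))"
proof -
  have nn: "n \<bullet> n = 1"
    using n by (simp add: dot_square_norm)
  have g0: "g \<noteq> 0" using g by auto
  define \<eta> where "\<eta> = n \<bullet> \<xi>"
  define p where "p x = x - (n \<bullet> x) *\<^sub>R n" for x
  define e where "e x = exp (of_real (-1) * \<i> * of_real (\<xi> \<bullet> x))" for x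
  have [measurable]: "e \<in> borel_measurable borel"
    unfolding e_def[abs_def] by measurable
  define fJ where "fJ J x = e x * (indicator J (- (n \<bullet> x)) * gauss g x)" for J :: "real set" and x
  define H where "H J = (LINT s|lborel. indicator J s *\<^sub>R exp (- (g * (of_real s)\<^sup>2) + \<i> * of_real (\<eta> * s)))" for J :: "real set"
  define A where "A = (LINT x|lborel. gauss 1 (n \<bullet> x) * (e (p x) * gauss g (p x)))"
  have key: "of_real (sqrt pi) * (LINT x|lborel. fJ J x) = A * H J" if [measurable]: "J \<in> sets borel" for J
  proof -
    have "integrable lborel (fJ J)"
      by (rule Bochner_Integration.integrable_bound[OF integrable_gauss[OF g, where 'a='a]])
         (auto simp: fJ_def[abs_def] e_def norm_mult indicator_def)
    then have "of_real (sqrt pi) * (LINT x|lborel. fJ J x) = (LINT x|lborel. gauss 1 (n \<bullet> x) * (LINT t|lborel. fJ J (x - t *\<^sub>R n)))"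
      by (rule integral_along_direction[OF _ n])
    also have "\<dots> = (LINT x|lborel. gauss 1 (n \<bullet> x) * ((e (p x) * gauss g (p x)) * H J))"
    proof (intro Bochner_Integration.integral_cong refl arg_cong2[where f=times])
      fix x
      have "(LINT t|lborel. fJ J (x - t *\<^sub>R n)) = (LINT s|lborel. fJ J (x - (n \<bullet> x + 1 * s) *\<^sub>R n))"
        using lborel_integral_real_affine[of 1 "\<lambda>t. fJ J (x - t *\<^sub>R n)" "n \<bullet> x"] by simp
      also have "\<dots> = (LINT s|lborel. (e (p x) * gauss g (p x)) * (indicator J s *\<^sub>R exp (- (g * (of_real s)\<^sup>2) + \<i> * of_real (\<eta> * s))))"
      proof (intro Bochner_Integration.integral_cong refl)
        fix s
        have y: "x - (n \<bullet> x + 1 * s) *\<^sub>R n = p x - s *\<^sub>R n"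
          by (simp add: p_def scaleR_add_left)
        have np: "n \<bullet> p x = 0"
          by (simp add: p_def inner_diff_right nn)
        have "(norm (p x - s *\<^sub>R n))\<^sup>2 = (norm (p x))\<^sup>2 + s\<^sup>2"
          unfolding power2_norm_eq_inner
          using np by (simp add: inner_diff_left inner_diff_right nn inner_commute[of "p x" n] power2_eq_square)
        then have "gauss g (p x - s *\<^sub>R n) = gauss g (p x) * exp (- (g * (of_real s)\<^sup>2))"
          unfolding gauss_def exp_add[symmetric] by (simp add: distrib_left)
        moreover have "e (p x - s *\<^sub>R n) = e (p x) * exp (\<i> * of_real (\<eta> * s))"
          unfolding e_def exp_add[symmetric] \<eta>_def
          by (simp add: inner_diff_right inner_commute[of n \<xi>] algebra_simps)
        moreover have "- (n \<bullet> (p x - s *\<^sub>R n)) = s"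
          by (simp add: inner_diff_right np nn)
        ultimately show "fJ J (x - (n \<bullet> x + 1 * s) *\<^sub>R n) =
            (e (p x) * gauss g (p x)) * (indicator J s *\<^sub>R exp (- (g * (of_real s)\<^sup>2) + \<i> * of_real (\<eta> * s)))"
          unfolding y fJ_def exp_add by (simp add: scaleR_conv_of_real mult_ac of_real_indicator)
      qed
      also have "\<dots> = (e (p x) * gauss g (p x)) * H J"
        unfolding H_def by (rule integral_mult_right_zero)
      finally show "(LINT t|lborel. fJ J (x - t *\<^sub>R n)) = (e (p x) * gauss g (p x)) * H J" .
    qed
    also have "\<dots> = A * H J"
      unfolding A_def mult.assoc[symmetric] by (rule integral_mult_left_zero)
    finally show ?thesis .
  qed
  define Q where "Q = (LINT x|lborel. fJ {0<..} x)"
  have full: "(LINT x|lborel. fJ UNIV x) = csqrt (of_real pi / g) ^ DIM('a) * gauss (1 / (4 * g)) \<xi>"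
  proof -
    have "fJ UNIV x = exp (\<i> * of_real ((- \<xi>) \<bullet> x)) * gauss g x" for x
      by (simp add: fJ_def e_def)
    then show ?thesis
      using integral_gauss_fourier[OF g, of "- \<xi>"] by (simp add: gauss_def)
  qed
  have HU: "H UNIV = csqrt (of_real pi / g) * exp (- (of_real \<eta>)\<^sup>2 / (4 * g))"
    unfolding H_def using gaussian_fourier[OF g, of \<eta>] by simp
  have "of_real (sqrt pi) * (Q * H UNIV) = of_real (sqrt pi) * (H {0<..} * (LINT x|lborel. fJ UNIV x))"
    using key[of "{0<..}"] key[of UNIV] unfolding Q_def by (simp add: mult_ac)
  then have "Q * H UNIV = H {0<..} * (LINT x|lborel. fJ UNIV x)"
    by simp
  then have eq: "norm Q * norm (H UNIV) = norm (H {0<..}) * norm (LINT x|lborel. fJ UNIV x)"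
    by (metis norm_mult)
  have "norm (LINT x|lborel. fJ UNIV x) \<le> norm (csqrt (of_real pi / g)) ^ (DIM('a) - 1) * norm (H UNIV)"
  proof -
    define \<gamma> where "\<gamma> = Re (1 / (4 * g))"
    have \<gamma>: "\<gamma> \<ge> 0"
      using g by (simp add: \<gamma>_def Re_divide)
    have "\<bar>\<eta>\<bar> \<le> norm \<xi>"
      using Cauchy_Schwarz_ineq2[of n \<xi>] n by (simp add: \<eta>_def)
    then have "\<eta>\<^sup>2 \<le> (norm \<xi>)\<^sup>2"
      by (metis abs_le_square_iff abs_norm_cancel)
    then have "exp (- (\<gamma> * (norm \<xi>)\<^sup>2)) \<le> exp (- (\<gamma> * \<eta>\<^sup>2))"
      using \<gamma> by (simp add: mult_left_mono)
    moreover have "norm (exp (- (of_real \<eta>)\<^sup>2 / (4 * g))) = exp (- (\<gamma> * \<eta>\<^sup>2))"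
    proof -
      have "- (of_real \<eta>)\<^sup>2 / (4 * g) = - ((1 / (4 * g)) * of_real (\<eta>\<^sup>2))"
        by simp
      moreover have "Re (a * of_real r) = Re a * r" for a r
        by simp
      ultimately show ?thesis
        unfolding norm_exp_eq_Re \<gamma>_def by (simp only: uminus_complex.sel)
    qed
    moreover have "norm (csqrt (of_real pi / g)) ^ DIM('a) = norm (csqrt (of_real pi / g)) ^ (DIM('a) - 1) * norm (csqrt (of_real pi / g))"
      by (metis DIM_positive Suc_diff_1 mult.commute power_Suc)
    ultimately show ?thesis
      unfolding full HU norm_mult norm_power norm_gauss \<gamma>_def[symmetric]
      by (simp add: mult.assoc mult_left_mono)
  qed
  from mult_left_mono[OF this norm_ge_zero, of "H {0<..}"]
  have "norm Q * norm (H UNIV) \<le> (norm (csqrt (of_real pi / g)) ^ (DIM('a) - 1) * norm (H {0<..})) * norm (H UNIV)"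
    unfolding eq by (simp only: mult_ac)
  moreover have "norm (H UNIV) > 0"
    unfolding HU using g0 by simp
  ultimately have "norm Q \<le> norm (csqrt (of_real pi / g)) ^ (DIM('a) - 1) * norm (H {0<..})"
    by (simp add: mult_le_cancel_right)
  moreover have "Q = (LINT x|lborel. exp (of_real (-1) * \<i> * of_real (\<xi> \<bullet> x)) * (indicator {x. n \<bullet> x < 0} x * gauss g x))"
    unfolding Q_def fJ_def e_def by (intro Bochner_Integration.integral_cong) (auto simp: indicator_def)
  moreover have "H {0<..} = half_gauss g (n \<bullet> \<xi>)"
    by (simp add: H_def half_gauss_def \<eta>_def)
  ultimately show ?thesis by simp
qed

section \<open>Convolution with a half-space kernel\<close>

lemma borel_measurable_half_gauss [measurable]: "half_gauss g \<in> borel_measurable borel"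
  unfolding half_gauss_def[abs_def]
  by (rule lborel.borel_measurable_lebesgue_integral[of _ borel]) measurable

lemma Re_inverse_4_pos: "Re b > 0 \<Longrightarrow> Re (1 / (4 * b)) > 0"
  by (simp add: Re_divide divide_pos_pos add_pos_nonneg)

lemma AE_lborel_not_hyperplane:
  fixes n :: "'a::euclidean_space"
  assumes "n \<noteq> 0"
  shows "AE y in lborel. n \<bullet> y \<noteq> c"
proof -
  have "negligible {y. n \<bullet> y = c}"
    using assms by (intro negligible_hyperplane) auto
  then have "{y. n \<bullet> y = c} \<in> null_sets lebesgue"
    by (simp add: negligible_iff_null_sets)
  then have "AE y in lebesgue. y \<notin> {y. n \<bullet> y = c}"
    by (rule AE_not_in)
  then show ?thesis
    by (simp add: AE_completion_iff)
qed

text \<open>For \<open>n \<bullet> x < a\<close> and \<open>y\<close> in the support of \<open>\<phi>\<close> one has \<open>n \<bullet> (x - y) < 0\<close>, so on this half-space the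
  kernel may be cut off to \<open>{z. n \<bullet> z < 0}\<close>, which replaces the multiplier by a half-line Gaussian.\<close>

lemma half_space_conv_estimate:
  fixes \<phi> :: "'a::euclidean_space \<Rightarrow> complex" and n :: 'a
  assumes n: "norm n = 1" and b: "Re b > 0" and \<phi>: "integrable lborel \<phi>"
    and \<phi>2: "integrable lborel (\<lambda>x. (norm (\<phi> x))\<^sup>2)" and supp: "AE y in lborel. n \<bullet> y < a \<longrightarrow> \<phi> y = 0"
    and M: "\<And>\<eta>. norm (half_gauss b \<eta>) * sqrt (norm b / pi) \<le> M"
  defines "v \<equiv> fourier_int 1 (\<lambda>\<xi>. gauss (1 / (4 * b)) \<xi> * fourier_int (-1) \<phi> \<xi>)"
  shows "(LINT x|lborel. (norm (indicator {x. n \<bullet> x < a} x * v x))\<^sup>2) \<le>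
    (LINT \<xi>|lborel. (norm (half_gauss b (n \<bullet> \<xi>)) * sqrt (norm b / pi))\<^sup>2 * (norm (fourier_int (-1) \<phi> \<xi>))\<^sup>2)"
proof -
  have [measurable]: "\<phi> \<in> borel_measurable borel"
    using \<phi> by (simp add: borel_measurable_integrable[of lborel, simplified])
  have b0: "b \<noteq> 0" using b by auto
  define \<kappa> where "\<kappa> = csqrt (of_real pi / (1 / (4 * b))) / of_real (2 * pi)"
  have n\<kappa>: "norm \<kappa> = sqrt (norm b / pi)"
  proof -
    have "norm \<kappa> = sqrt (pi * 4 * norm b) / (2 * pi)"
      by (simp add: \<kappa>_def norm_divide norm_mult mult_ac)
    also have "\<dots> = sqrt (pi * 4 * norm b / (2 * pi)\<^sup>2)"
    proof -
      have "sqrt ((2 * pi)\<^sup>2) = 2 * pi"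
        by (rule real_sqrt_unique) auto
      then show ?thesis
        by (simp only: real_sqrt_divide)
    qed
    also have "pi * 4 * norm b / (2 * pi)\<^sup>2 = norm b / pi"
      by (simp add: power2_eq_square)
    finally show ?thesis .
  qed
  have ker: "gauss_kernel (1 / (4 * b)) z = \<kappa> ^ DIM('a) * gauss b z" for z :: 'a
    using b0 by (simp add: gauss_kernel_def \<kappa>_def)
  define q where "q z = \<kappa> ^ DIM('a) * (indicator {z. n \<bullet> z < 0} z * gauss b z)" for z :: 'a
  have [measurable]: "q \<in> borel_measurable borel"
    unfolding q_def[abs_def] by measurable
  have ind: "norm (indicator S z * gauss b z) \<le> norm (gauss b z)" for S and z :: 'a
    by (auto simp: indicator_def)
  have qb: "norm (q z) \<le> norm \<kappa> ^ DIM('a)" for z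
  proof -
    have "norm (indicator {z. n \<bullet> z < 0} z * gauss b z) \<le> 1"
      using b by (intro order_trans[OF ind]) (simp add: norm_gauss)
    then show ?thesis
      by (simp add: q_def norm_mult[of "\<kappa> ^ _"] norm_power mult_left_le)
  qed
  have intq: "integrable lborel q"
    unfolding q_def[abs_def]
    by (intro integrable_mult_right Bochner_Integration.integrable_bound[OF integrable_gauss[OF b, where 'a='a]])
       (use ind in auto)
  define u where "u x = (LINT y|lborel. q (x - y) * \<phi> y)" for x
  have [measurable]: "u \<in> borel_measurable borel"
    unfolding u_def[abs_def] by (rule lborel.borel_measurable_lebesgue_integral[of _ borel]) measurable
  have vu: "indicator {x. n \<bullet> x < a} x * v x = indicator {x. n \<bullet> x < a} x * u x" for x
  proof (cases "n \<bullet> x < a")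
    case True
    have "v x = (LINT y|lborel. gauss_kernel (1 / (4 * b)) (x - y) * \<phi> y)"
      unfolding v_def using fourier_gauss_multiplier[OF \<phi> Re_inverse_4_pos[OF b], of "-1" x] by simp
    also have "\<dots> = u x"
      unfolding u_def
    proof (rule integral_cong_AE)
      show "AE y in lborel. gauss_kernel (1 / (4 * b)) (x - y) * \<phi> y = q (x - y) * \<phi> y"
        using supp
      proof eventually_elim
        fix y assume *: "n \<bullet> y < a \<longrightarrow> \<phi> y = 0"
        show "gauss_kernel (1 / (4 * b)) (x - y) * \<phi> y = q (x - y) * \<phi> y"
        proof (cases "\<phi> y = 0")
          case False
          with * True have "n \<bullet> (x - y) < 0" by (simp add: inner_diff_right)
          then show ?thesis by (simp add: ker q_def)
        qed simp
      qed
    qed simp_all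
    finally show ?thesis by simp
  qed simp
  have intu: "integrable lborel u"
    unfolding u_def using lborel_pair.integrable_fst[OF integrable_norm_conv[OF intq \<phi>]] .
  define B where "B = norm \<kappa> ^ DIM('a) * (LINT y|lborel. norm (\<phi> y))"
  have ub: "norm (u x) \<le> B" for x
  proof -
    have "norm (u x) \<le> (LINT y|lborel. norm \<kappa> ^ DIM('a) * norm (\<phi> y))"
      unfolding u_def
    proof (rule Bochner_Integration.integral_norm_bound_integral)
      show l: "norm (q (x - y) * \<phi> y) \<le> norm \<kappa> ^ DIM('a) * norm (\<phi> y)" for y
        using qb by (simp add: norm_mult mult_right_mono)
      show i: "integrable lborel (\<lambda>y. norm \<kappa> ^ DIM('a) * norm (\<phi> y))"
        using \<phi> by simp
      show "integrable lborel (\<lambda>y. q (x - y) * \<phi> y)"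
        using i by (rule Bochner_Integration.integrable_bound) (use l in \<open>auto intro!: order_trans[OF _ abs_ge_self]\<close>)
    qed
    then show ?thesis by (simp add: B_def)
  qed
  have contu: "continuous_on UNIV u"
    unfolding continuous_on_sequentially
  proof (intro allI impI ballI, elim conjE)
    fix xs :: "nat \<Rightarrow> 'a" and x assume xs: "xs \<longlonglongrightarrow> x"
    have "(\<lambda>j. LINT y|lborel. q (xs j - y) * \<phi> y) \<longlonglongrightarrow> (LINT y|lborel. q (x - y) * \<phi> y)"
    proof (rule integral_dominated_convergence[where w="\<lambda>y. norm \<kappa> ^ DIM('a) * norm (\<phi> y)"])
      show "integrable lborel (\<lambda>y. norm \<kappa> ^ DIM('a) * norm (\<phi> y))"
        using \<phi> by simp
      show "AE y in lborel. norm (q (xs j - y) * \<phi> y) \<le> norm \<kappa> ^ DIM('a) * norm (\<phi> y)" for j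
        using qb by (simp add: norm_mult mult_right_mono)
      have "n \<noteq> 0" using n by auto
      then have "AE y in lborel. n \<bullet> y \<noteq> n \<bullet> x"
        by (rule AE_lborel_not_hyperplane)
      then show "AE y in lborel. (\<lambda>j. q (xs j - y) * \<phi> y) \<longlonglongrightarrow> q (x - y) * \<phi> y"
      proof eventually_elim
        fix y assume y: "n \<bullet> y \<noteq> n \<bullet> x"
        have l1: "(\<lambda>j. n \<bullet> (xs j - y)) \<longlonglongrightarrow> n \<bullet> (x - y)"
          by (intro tendsto_intros xs)
        have g: "(\<lambda>j. gauss b (xs j - y)) \<longlonglongrightarrow> gauss b (x - y)"
          unfolding gauss_def by (intro tendsto_intros xs)
        have "(\<lambda>j. indicator {z. n \<bullet> z < 0} (xs j - y) :: complex) \<longlonglongrightarrow> indicator {z. n \<bullet> z < 0} (x - y)"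
        proof (cases "n \<bullet> (x - y) < 0")
          case True
          have "\<forall>\<^sub>F j in sequentially. indicator {z. n \<bullet> z < 0} (xs j - y) = (1 :: complex)"
            using order_tendstoD(2)[OF l1 True] by eventually_elim simp
          then show ?thesis
            using True by (simp add: tendsto_eventually)
        next
          case False
          with y have gt: "n \<bullet> (x - y) > 0" by (simp add: inner_diff_right)
          have "\<forall>\<^sub>F j in sequentially. indicator {z. n \<bullet> z < 0} (xs j - y) = (0 :: complex)"
            using order_tendstoD(1)[OF l1 gt] by eventually_elim simp
          then show ?thesis
            using gt by (simp add: tendsto_eventually)
        qed
        then show "(\<lambda>j. q (xs j - y) * \<phi> y) \<longlonglongrightarrow> q (x - y) * \<phi> y"
          unfolding q_def by (intro tendsto_intros g)
      qed
    qed simp_all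
    then show "(u \<circ> xs) \<longlonglongrightarrow> u x"
      by (simp add: u_def o_def)
  qed
  have intu2: "integrable lborel (\<lambda>x. (norm (u x))\<^sup>2)"
  proof (rule Bochner_Integration.integrable_bound[OF integrable_mult_right[OF integrable_norm[OF intu], of B]])
    show "AE x in lborel. norm ((norm (u x))\<^sup>2) \<le> norm (B * norm (u x))"
      using ub by (auto simp: power2_eq_square abs_mult intro!: mult_right_mono order_trans[OF ub abs_ge_self])
  qed simp
  define F where "F = fourier_int (-1) \<phi>"
  have [measurable]: "F \<in> borel_measurable borel"
    by (simp add: F_def)
  define m where "m \<xi> = norm (half_gauss b (n \<bullet> \<xi>)) * sqrt (norm b / pi)" for \<xi> :: 'a
  have [measurable]: "m \<in> borel_measurable borel"
    unfolding m_def[abs_def] by measurable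
  have m0: "0 \<le> m \<xi>" for \<xi>
    by (simp add: m_def)
  have Fu: "norm (fourier_int (-1) u \<xi>) \<le> m \<xi> * norm (F \<xi>)" for \<xi>
  proof -
    have "fourier_int (-1) u \<xi> = (LINT x|lborel. exp (of_real (-1) * \<i> * of_real (\<xi> \<bullet> x)) * q x) * F \<xi>"
      unfolding u_def F_def by (rule fourier_int_conv[OF intq \<phi>])
    also have "(LINT x|lborel. exp (of_real (-1) * \<i> * of_real (\<xi> \<bullet> x)) * q x) =
      \<kappa> ^ DIM('a) * (LINT x|lborel. exp (of_real (-1) * \<i> * of_real (\<xi> \<bullet> x)) * (indicator {x. n \<bullet> x < 0} x * gauss b x))"
      unfolding q_def by (subst integral_mult_right_zero[symmetric]) (simp add: mult_ac)
    finally have "norm (fourier_int (-1) u \<xi>) = norm \<kappa> ^ DIM('a) *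
        norm (LINT x|lborel. exp (of_real (-1) * \<i> * of_real (\<xi> \<bullet> x)) * (indicator {x. n \<bullet> x < 0} x * gauss b x)) * norm (F \<xi>)"
      by (simp only: norm_mult norm_power)
    also have "\<dots> \<le> norm \<kappa> ^ DIM('a) * (norm (csqrt (of_real pi / b)) ^ (DIM('a) - 1) * norm (half_gauss b (n \<bullet> \<xi>))) * norm (F \<xi>)"
      by (intro mult_right_mono mult_left_mono half_space_gauss_fourier n b) auto
    also have "norm \<kappa> ^ DIM('a) * (norm (csqrt (of_real pi / b)) ^ (DIM('a) - 1) * norm (half_gauss b (n \<bullet> \<xi>))) = m \<xi>"
    proof -
      have "norm \<kappa> * norm (csqrt (of_real pi / b)) = 1"
        unfolding n\<kappa> using b0 by (simp add: norm_divide real_sqrt_mult[symmetric])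
      then have "norm \<kappa> ^ (DIM('a) - 1) * norm (csqrt (of_real pi / b)) ^ (DIM('a) - 1) = 1"
        by (simp only: power_mult_distrib[symmetric] power_one)
      moreover have "norm \<kappa> ^ DIM('a) = norm \<kappa> * norm \<kappa> ^ (DIM('a) - 1)"
        by (metis DIM_positive Suc_diff_1 power_Suc)
      ultimately have "norm \<kappa> ^ DIM('a) * (norm (csqrt (of_real pi / b)) ^ (DIM('a) - 1) * h) = h * norm \<kappa>" for h
        by (simp only: mult.assoc mult.assoc[symmetric, of "norm \<kappa> ^ (DIM('a) - 1)"] mult_1 mult.commute)
      then show ?thesis
        by (simp only: m_def n\<kappa>)
    qed
    finally show ?thesis .
  qed
  have Fu2: "(norm (fourier_int (-1) u \<xi>))\<^sup>2 \<le> (m \<xi>)\<^sup>2 * (norm (F \<xi>))\<^sup>2" for \<xi>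
    using power_mono[OF Fu[of \<xi>] norm_ge_zero, of 2] by (simp add: power_mult_distrib)
  have F2: "integrable lborel (\<lambda>\<xi>. (norm (F \<xi>))\<^sup>2)"
    unfolding F_def by (rule fourier_Bessel[OF \<phi> \<phi>2]) simp
  have M2: "(m \<xi>)\<^sup>2 \<le> M\<^sup>2" for \<xi>
    using M[of "n \<bullet> \<xi>"] m0[of \<xi>] by (auto simp: m_def intro!: power_mono)
  have intm: "integrable lborel (\<lambda>\<xi>. (m \<xi>)\<^sup>2 * (norm (F \<xi>))\<^sup>2)"
    by (rule Bochner_Integration.integrable_bound[OF integrable_mult_right[OF F2, of "M\<^sup>2"]])
       (use M2 in \<open>auto simp: abs_mult intro!: mult_right_mono\<close>)
  have intFu: "integrable lborel (\<lambda>\<xi>. (norm (fourier_int (-1) u \<xi>))\<^sup>2)"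
    by (rule fourier_Bessel[OF intu intu2]) simp
  have "(LINT x|lborel. (norm (indicator {x. n \<bullet> x < a} x * v x))\<^sup>2) = (LINT x|lborel. (norm (indicator {x. n \<bullet> x < a} x * u x))\<^sup>2)"
    unfolding vu ..
  also have "\<dots> \<le> (LINT x|lborel. (norm (u x))\<^sup>2)"
  proof (rule integral_mono)
    show l: "(norm (indicator {x. n \<bullet> x < a} x * u x))\<^sup>2 \<le> (norm (u x))\<^sup>2" for x
      by (auto simp: indicator_def)
    show "integrable lborel (\<lambda>x. (norm (indicator {x. n \<bullet> x < a} x * u x))\<^sup>2)"
      using intu2 by (rule Bochner_Integration.integrable_bound) (use l in auto)
  qed (rule intu2)
  also have "\<dots> \<le> (LINT \<xi>|lborel. (norm (fourier_int (-1) u \<xi>))\<^sup>2)"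
    using ub by (intro fourier_reverse_Bessel intu contu intFu) auto
  also have "\<dots> \<le> (LINT \<xi>|lborel. (m \<xi>)\<^sup>2 * (norm (F \<xi>))\<^sup>2)"
    by (intro integral_mono intFu intm Fu2)
  finally show ?thesis
    by (simp add: m_def F_def)
qed

lemma fourier_int_real_symmetric:
  fixes \<psi> :: "'a::euclidean_space \<Rightarrow> real"
  assumes [measurable]: "\<psi> \<in> borel_measurable borel"
  shows "norm (fourier_int s (\<lambda>x. of_real (\<psi> x)) (- \<xi>)) = norm (fourier_int s (\<lambda>x. of_real (\<psi> x)) \<xi>)"
proof -
  have "(LINT x|lborel. exp (of_real s * \<i> * of_real ((- \<xi>) \<bullet> x)) * of_real (\<psi> x)) =
    (LINT x|lborel. cnj (exp (of_real s * \<i> * of_real (\<xi> \<bullet> x)) * of_real (\<psi> x)))"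
    by (simp add: exp_cnj)
  also have "\<dots> = cnj (LINT x|lborel. exp (of_real s * \<i> * of_real (\<xi> \<bullet> x)) * of_real (\<psi> x))"
    by (rule Bochner_Integration.integral_cnj)
  finally show ?thesis
    by (simp add: fourier_int_lborel norm_mult)
qed

lemma continuous_on_theta_tilde: "continuous_on S theta_tilde"
proof -
  have eq: "theta_tilde = (\<lambda>y. 1/2 + (1 - \<i>) / 2 * fresnel (y / sqrt pi))"
    by (simp add: theta_tilde_eq_fresnel fun_eq_iff)
  show ?thesis
    unfolding eq by (intro continuous_intros continuous_on_compose2[OF continuous_on_fresnel[of UNIV]]) auto
qed

lemma norm_theta_tilde_le: "norm (theta_tilde y) \<le> 2"
proof -
  have "norm (theta_tilde y) \<le> norm (1/2 :: complex) + norm ((1 - \<i>) / 2) * norm (fresnel (y / sqrt pi))"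
    unfolding theta_tilde_eq_fresnel norm_mult[symmetric] by (rule norm_triangle_ineq)
  also have "\<dots> \<le> 1/2 + 1 * 1"
  proof (intro add_mono mult_mono norm_fresnel_le_1)
    have "norm (1 - \<i>) \<le> norm (1::complex) + norm \<i>"
      by (rule norm_triangle_ineq4)
    then show "norm ((1 - \<i>) / 2) \<le> 1" by (simp add: norm_divide)
  qed auto
  finally show ?thesis by simp
qed

lemma sym_theta_multiplier_bound:
  fixes \<psi> :: "'a::euclidean_space \<Rightarrow> real" and n :: 'a
  assumes [measurable]: "\<psi> \<in> borel_measurable borel"
    and F2: "integrable lborel (\<lambda>\<xi>. (norm (fourier_int s (\<lambda>x. of_real (\<psi> x)) \<xi>))\<^sup>2)"
    and C: "\<And>x. sym theta_tilde x \<le> C"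
  shows "(LINT \<xi>|lborel. (norm (theta_tilde (- (n \<bullet> \<xi> / r))))\<^sup>2 * (norm (fourier_int s (\<lambda>x. of_real (\<psi> x)) \<xi>))\<^sup>2)
     \<le> C\<^sup>2 * (LINT \<xi>|lborel. (norm (fourier_int s (\<lambda>x. of_real (\<psi> x)) \<xi>))\<^sup>2)"
proof -
  define F where "F \<xi> = (norm (fourier_int s (\<lambda>x. of_real (\<psi> x)) \<xi>))\<^sup>2" for \<xi>
  define T where "T y = (norm (theta_tilde y))\<^sup>2" for y
  have [measurable]: "F \<in> borel_measurable borel"
    unfolding F_def[abs_def] by measurable
  have [measurable]: "T \<in> borel_measurable borel"
    unfolding T_def[abs_def]
    by (intro borel_measurable_continuous_onI continuous_intros continuous_on_theta_tilde)
  have Fm: "F (- \<xi>) = F \<xi>" for \<xi>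
    by (simp add: F_def fourier_int_real_symmetric)
  have intF: "integrable lborel F"
    using F2 by (simp add: F_def[abs_def])
  have T4: "norm (T y) \<le> 4" for y
    using power_mono[OF norm_theta_tilde_le[of y] norm_ge_zero, of 2] by (simp add: T_def)
  have i: "integrable lborel (\<lambda>\<xi>. T (h \<xi>) * F \<xi>)" if [measurable]: "h \<in> borel_measurable borel" for h :: "'a \<Rightarrow> real"
    by (rule Bochner_Integration.integrable_bound[OF integrable_mult_right[OF intF, of 4]])
       (use T4 in \<open>auto simp: abs_mult intro!: mult_right_mono\<close>)
  have sq: "(T y + T (- y)) / 2 \<le> C\<^sup>2" for y
  proof -
    have "(2 powr (- 1 / 2))\<^sup>2 = (1/2 :: real)"
      by (simp add: power2_eq_square powr_add[symmetric] powr_minus_divide)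
    then have "(sym theta_tilde y)\<^sup>2 = (T y + T (- y)) / 2"
      unfolding sym_def power_mult_distrib by (simp add: T_def)
    moreover have "0 \<le> sym theta_tilde y"
      by (simp add: sym_def)
    ultimately show ?thesis
      using power_mono[OF C[of y], of 2] by simp
  qed
  have "(LINT \<xi>|lborel. T (- (n \<bullet> \<xi> / r)) * F \<xi>) = (LINT \<xi>|lborel. T (n \<bullet> \<xi> / r) * F \<xi>)"
    using lborel_integral_affine[of "\<lambda>\<xi>. T (- (n \<bullet> \<xi> / r)) * F \<xi>" "-1" 0] by (simp add: Fm)
  then have "(LINT \<xi>|lborel. T (- (n \<bullet> \<xi> / r)) * F \<xi>) = ((LINT \<xi>|lborel. T (n \<bullet> \<xi> / r) * F \<xi>) + (LINT \<xi>|lborel. T (- (n \<bullet> \<xi> / r)) * F \<xi>)) / 2"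
    by simp
  also have "\<dots> = (LINT \<xi>|lborel. (T (n \<bullet> \<xi> / r) * F \<xi> + T (- (n \<bullet> \<xi> / r)) * F \<xi>) / 2)"
    by (subst Bochner_Integration.integral_add[symmetric]) (auto intro!: i)
  also have "\<dots> \<le> (LINT \<xi>|lborel. C\<^sup>2 * F \<xi>)"
  proof (rule integral_mono)
    show "integrable lborel (\<lambda>\<xi>. (T (n \<bullet> \<xi> / r) * F \<xi> + T (- (n \<bullet> \<xi> / r)) * F \<xi>) / 2)"
      by (intro integrable_divide Bochner_Integration.integrable_add i) measurable
    show "(T (n \<bullet> \<xi> / r) * F \<xi> + T (- (n \<bullet> \<xi> / r)) * F \<xi>) / 2 \<le> C\<^sup>2 * F \<xi>" for \<xi>
      using mult_right_mono[OF sq[of "n \<bullet> \<xi> / r"], of "F \<xi>"] by (simp add: F_def algebra_simps add_divide_distrib)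
  qed (use intF in simp)
  finally show ?thesis
    by (simp add: T_def F_def)
qed

lemma half_gauss_multiplier_limit:
  fixes F :: "'a::euclidean_space \<Rightarrow> complex" and n :: 'a and \<epsilon> :: "nat \<Rightarrow> real"
  assumes f: "f > 0" and \<epsilon>: "\<And>k. \<epsilon> k > 0" "\<And>k. \<epsilon> k \<le> 1" "\<epsilon> \<longlonglongrightarrow> 0"
    and [measurable]: "F \<in> borel_measurable borel" and F2: "integrable lborel (\<lambda>\<xi>. (norm (F \<xi>))\<^sup>2)"
  defines "b \<equiv> \<lambda>k. of_real (\<epsilon> k) - \<i> * of_real f / 2"
  shows "(\<lambda>k. LINT \<xi>|lborel. (norm (half_gauss (b k) (n \<bullet> \<xi>)) * sqrt (norm (b k) / pi))\<^sup>2 * (norm (F \<xi>))\<^sup>2)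
    \<longlonglongrightarrow> (LINT \<xi>|lborel. (norm (theta_tilde (- (n \<bullet> \<xi> / sqrt f))))\<^sup>2 * (norm (F \<xi>))\<^sup>2)"
    and "norm (half_gauss (b k) \<eta>) * sqrt (norm (b k) / pi) \<le> 2 * sqrt (pi / f) * sqrt ((1 + f) / pi)"
proof -
  have le: "norm (half_gauss (b k) \<eta>) * sqrt (norm (b k) / pi) \<le> 2 * sqrt (pi / f) * sqrt ((1 + f) / pi)" for k \<eta>
  proof (intro mult_mono)
    show "norm (half_gauss (b k) \<eta>) \<le> 2 * sqrt (pi / f)"
      unfolding b_def by (rule norm_half_gauss_le[OF f \<epsilon>(1)])
    have "norm (b k) \<le> norm (complex_of_real (\<epsilon> k)) + norm (\<i> * of_real f / 2)"
      unfolding b_def by (rule norm_triangle_ineq4)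
    also have "\<dots> \<le> 1 + f"
      using \<epsilon>(1,2)[of k] f by (simp add: norm_mult norm_divide)
    finally show "sqrt (norm (b k) / pi) \<le> sqrt ((1 + f) / pi)"
      by (intro real_sqrt_le_mono divide_right_mono) auto
  qed (use f in auto)
  then show "norm (half_gauss (b k) \<eta>) * sqrt (norm (b k) / pi) \<le> 2 * sqrt (pi / f) * sqrt ((1 + f) / pi)" .
  have [measurable]: "theta_tilde \<in> borel_measurable borel"
    by (intro borel_measurable_continuous_onI continuous_on_theta_tilde)
  show "(\<lambda>k. LINT \<xi>|lborel. (norm (half_gauss (b k) (n \<bullet> \<xi>)) * sqrt (norm (b k) / pi))\<^sup>2 * (norm (F \<xi>))\<^sup>2)
    \<longlonglongrightarrow> (LINT \<xi>|lborel. (norm (theta_tilde (- (n \<bullet> \<xi> / sqrt f))))\<^sup>2 * (norm (F \<xi>))\<^sup>2)"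
  proof (rule integral_dominated_convergence[where w="\<lambda>\<xi>. (2 * sqrt (pi / f) * sqrt ((1 + f) / pi))\<^sup>2 * (norm (F \<xi>))\<^sup>2"])
    show "integrable lborel (\<lambda>\<xi>. (2 * sqrt (pi / f) * sqrt ((1 + f) / pi))\<^sup>2 * (norm (F \<xi>))\<^sup>2)"
      using F2 by simp
    show "AE \<xi> in lborel. (\<lambda>k. (norm (half_gauss (b k) (n \<bullet> \<xi>)) * sqrt (norm (b k) / pi))\<^sup>2 * (norm (F \<xi>))\<^sup>2)
      \<longlonglongrightarrow> (norm (theta_tilde (- (n \<bullet> \<xi> / sqrt f))))\<^sup>2 * (norm (F \<xi>))\<^sup>2"
      unfolding b_def by (intro AE_I2 tendsto_mult tendsto_power tendsto_const half_gauss_limit[OF f \<epsilon>(1,3)])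
    show "AE \<xi> in lborel. norm ((norm (half_gauss (b k) (n \<bullet> \<xi>)) * sqrt (norm (b k) / pi))\<^sup>2 * (norm (F \<xi>))\<^sup>2) \<le>
      (2 * sqrt (pi / f) * sqrt ((1 + f) / pi))\<^sup>2 * (norm (F \<xi>))\<^sup>2" for k
    proof (intro AE_I2)
      fix \<xi>
      have "(norm (half_gauss (b k) (n \<bullet> \<xi>)) * sqrt (norm (b k) / pi))\<^sup>2 \<le> (2 * sqrt (pi / f) * sqrt ((1 + f) / pi))\<^sup>2"
        by (rule power_mono[OF le]) simp
      from mult_right_mono[OF this, of "(norm (F \<xi>))\<^sup>2"]
      show "norm ((norm (half_gauss (b k) (n \<bullet> \<xi>)) * sqrt (norm (b k) / pi))\<^sup>2 * (norm (F \<xi>))\<^sup>2) \<le>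
        (2 * sqrt (pi / f) * sqrt ((1 + f) / pi))\<^sup>2 * (norm (F \<xi>))\<^sup>2"
        by (simp add: abs_mult)
    qed
  qed measurable
qed

section \<open>Square-integrable functions\<close>

lemma borel_measurable_lebesgueI: "f \<in> borel_measurable borel \<Longrightarrow> f \<in> borel_measurable lebesgue"
  by (rule measurable_completion) simp

lemma lebesgue_measurable_AE_borel:
  fixes f :: "'a::euclidean_space \<Rightarrow> complex"
  assumes "f \<in> borel_measurable lebesgue"
  obtains f' where "f' \<in> borel_measurable borel" "AE x in lebesgue. f x = f' x"
proof -
  have "(\<lambda>x. Re (f x)) \<in> borel_measurable lebesgue" "(\<lambda>x. Im (f x)) \<in> borel_measurable lebesgue"
    using assms by auto
  from this[THEN completion_ex_borel_measurable_real]
  obtain r i where ri: "r \<in> borel_measurable lborel" "i \<in> borel_measurable lborel"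
    "AE x in lborel. Re (f x) = r x" "AE x in lborel. Im (f x) = i x"
    by blast
  show thesis
  proof
    show "(\<lambda>x. Complex (r x) (i x)) \<in> borel_measurable borel"
      using ri(1,2) unfolding Complex_eq by measurable
    have "AE x in lborel. f x = Complex (r x) (i x)"
      using ri(3,4) by eventually_elim (simp add: complex_eq_iff)
    then show "AE x in lebesgue. f x = Complex (r x) (i x)"
      by (rule AE_completion)
  qed
qed

lemma fourier_int_cong_AE:
  assumes "AE x in lebesgue. f x = f' x" "f \<in> borel_measurable lebesgue" "f' \<in> borel_measurable lebesgue"
  shows "fourier_int s f = fourier_int s f'"
proof
  fix \<xi> :: 'a
  have [measurable]: "(\<lambda>x. exp (complex_of_real s * \<i> * complex_of_real (\<xi> \<bullet> x))) \<in> borel_measurable lebesgue"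
    by (rule borel_measurable_lebesgueI) measurable
  show "fourier_int s f \<xi> = fourier_int s f' \<xi>"
    unfolding fourier_int_def using assms
    by (intro arg_cong2[where f=times] refl integral_cong_AE) (auto intro!: borel_measurable_times)
qed

lemma L2norm_cong_AE:
  assumes "AE x in lebesgue. f x = f' x" "f \<in> borel_measurable lebesgue" "f' \<in> borel_measurable lebesgue"
  shows "L2norm f = L2norm f'"
  unfolding L2norm_def using assms by (intro arg_cong[where f=sqrt] integral_cong_AE) auto

lemma L2fun_cong_AE:
  assumes "AE x in lebesgue. f x = f' x" "f' \<in> borel_measurable lebesgue" "L2fun f"
  shows "L2fun f'"
proof -
  have [measurable]: "f \<in> borel_measurable lebesgue" "f' \<in> borel_measurable lebesgue"
    using assms by (auto simp: L2fun_def)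
  have "integrable lebesgue (\<lambda>x. (norm (f x))\<^sup>2) \<longleftrightarrow> integrable lebesgue (\<lambda>x. (norm (f' x))\<^sup>2)"
    using assms(1) by (intro integrable_cong_AE) auto
  then show ?thesis
    using assms by (auto simp: L2fun_def)
qed

lemma L2fun_borel: "f \<in> borel_measurable borel \<Longrightarrow> L2fun f \<longleftrightarrow> integrable lborel (\<lambda>x. (norm (f x))\<^sup>2)"
  by (simp add: L2fun_def borel_measurable_lebesgueI integrable_completion)

lemma L2norm_borel: "f \<in> borel_measurable borel \<Longrightarrow> L2norm f = sqrt (LINT x|lborel. (norm (f x))\<^sup>2)"
  unfolding L2norm_def by (subst integral_completion) auto

lemma L2norm_nonneg: "0 \<le> L2norm f"
  by (simp add: L2norm_def)

lemma L2norm_sq: "(L2norm f)\<^sup>2 = integral\<^sup>L lebesgue (\<lambda>x. (norm (f x))\<^sup>2)"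
  by (simp add: L2norm_def)

lemma
  assumes f: "L2fun f" and g: "g \<in> borel_measurable lebesgue" and le: "\<And>x. norm (g x) \<le> norm (f x)"
  shows L2fun_mono: "L2fun g" and L2norm_mono: "L2norm g \<le> L2norm f"
proof -
  have f2: "integrable lebesgue (\<lambda>x. (norm (f x))\<^sup>2)"
    using f by (simp add: L2fun_def)
  have le2: "(norm (g x))\<^sup>2 \<le> (norm (f x))\<^sup>2" for x
    using le by (simp add: power_mono)
  have g2: "integrable lebesgue (\<lambda>x. (norm (g x))\<^sup>2)"
    using f2 by (rule Bochner_Integration.integrable_bound) (use g le2 in auto)
  then show "L2fun g"
    using g by (simp add: L2fun_def)
  show "L2norm g \<le> L2norm f"
    unfolding L2norm_def by (intro real_sqrt_le_mono integral_mono g2 f2 le2)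
qed

lemma
  assumes f: "L2fun f" and g: "L2fun g"
  shows L2fun_add: "L2fun (\<lambda>x. f x + g x)" and L2norm_triangle: "L2norm (\<lambda>x. f x + g x) \<le> L2norm f + L2norm g"
proof -
  have [measurable]: "f \<in> borel_measurable lebesgue" "g \<in> borel_measurable lebesgue"
    and int: "integrable lebesgue (\<lambda>x. (norm (f x))\<^sup>2)" "integrable lebesgue (\<lambda>x. (norm (g x))\<^sup>2)"
    using f g by (auto simp: L2fun_def)
  have pt: "(norm (f x + g x))\<^sup>2 \<le> (1 + t) * (norm (f x))\<^sup>2 + (1 + 1 / t) * (norm (g x))\<^sup>2" if "t > 0" for x t
  proof -
    have "(norm (f x + g x))\<^sup>2 \<le> (norm (f x) + norm (g x))\<^sup>2"
      by (intro power_mono norm_triangle_ineq) simp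
    moreover have "2 * norm (f x) * norm (g x) \<le> t * (norm (f x))\<^sup>2 + 1 / t * (norm (g x))\<^sup>2"
      using zero_le_power2[of "t * norm (f x) - norm (g x)"] that
      by (simp add: power2_eq_square field_simps)
    ultimately show ?thesis
      by (simp add: power2_sum algebra_simps)
  qed
  have intt: "integrable lebesgue (\<lambda>x. (1 + t) * (norm (f x))\<^sup>2 + (1 + 1 / t) * (norm (g x))\<^sup>2)" for t
    using int by simp
  have i: "integrable lebesgue (\<lambda>x. (norm (f x + g x))\<^sup>2)"
    using intt[of 1] by (rule Bochner_Integration.integrable_bound) (use pt[of 1] in \<open>auto intro: order_trans[OF _ abs_ge_self]\<close>)
  then show "L2fun (\<lambda>x. f x + g x)"
    by (simp add: L2fun_def)
  have le: "(L2norm (\<lambda>x. f x + g x))\<^sup>2 \<le> (1 + t) * (L2norm f)\<^sup>2 + (1 + 1 / t) * (L2norm g)\<^sup>2" if "t > 0" for t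
  proof -
    have "(L2norm (\<lambda>x. f x + g x))\<^sup>2 \<le> integral\<^sup>L lebesgue (\<lambda>x. (1 + t) * (norm (f x))\<^sup>2 + (1 + 1 / t) * (norm (g x))\<^sup>2)"
      unfolding L2norm_sq by (intro integral_mono i intt pt that)
    also have "\<dots> = (1 + t) * (L2norm f)\<^sup>2 + (1 + 1 / t) * (L2norm g)\<^sup>2"
      unfolding L2norm_sq using int by simp
    finally show ?thesis .
  qed
  show "L2norm (\<lambda>x. f x + g x) \<le> L2norm f + L2norm g"
  proof (rule field_le_epsilon)
    fix e :: real assume "e > 0"
    define A where "A = L2norm f + e / 2"
    define B where "B = L2norm g + e / 2"
    have A: "A > 0" "L2norm f \<le> A" and B: "B > 0" "L2norm g \<le> B"
      using \<open>e > 0\<close> L2norm_nonneg[of f] L2norm_nonneg[of g] by (auto simp: A_def B_def)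
    have "(L2norm (\<lambda>x. f x + g x))\<^sup>2 \<le> (1 + B / A) * (L2norm f)\<^sup>2 + (1 + 1 / (B / A)) * (L2norm g)\<^sup>2"
      using A B by (intro le) simp
    also have "\<dots> \<le> (1 + B / A) * A\<^sup>2 + (1 + 1 / (B / A)) * B\<^sup>2"
      using A B L2norm_nonneg by (intro add_mono mult_left_mono power_mono) auto
    also have "\<dots> = (A + B)\<^sup>2"
      using A B by (simp add: power2_eq_square field_simps)
    finally have "(L2norm (\<lambda>x. f x + g x))\<^sup>2 \<le> (A + B)\<^sup>2" .
    then have "L2norm (\<lambda>x. f x + g x) \<le> A + B"
      by (rule power2_le_imp_le) (use A(1) B(1) in simp)
    then show "L2norm (\<lambda>x. f x + g x) \<le> L2norm f + L2norm g + e"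
      by (simp add: A_def B_def)
  qed
qed

lemma L2fun_diff:
  assumes "L2fun f" "L2fun g"
  shows "L2fun (\<lambda>x. f x - g x)"
proof -
  have "L2fun (\<lambda>x. - g x)"
    using assms(2) by (auto simp: L2fun_def)
  from L2fun_add[OF assms(1) this] show ?thesis by simp
qed

lemma
  assumes f: "integrable lebesgue f" "L2fun f" and s: "s = 1 \<or> s = -1"
  shows L2fun_fourier_int: "L2fun (fourier_int s f)" and L2norm_fourier_int: "L2norm (fourier_int s f) \<le> L2norm f"
proof -
  have fm: "f \<in> borel_measurable lebesgue"
    using f by (simp add: L2fun_def)
  obtain f' where f': "f' \<in> borel_measurable borel" "AE x in lebesgue. f x = f' x"
    using lebesgue_measurable_AE_borel[OF fm] .
  note [measurable] = f'(1)
  have fm': "f' \<in> borel_measurable lebesgue"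
    by (rule borel_measurable_lebesgueI[OF f'(1)])
  have "integrable lebesgue f'"
    using f(1) f'(2) fm fm' integrable_cong_AE by blast
  then have i1: "integrable lborel f'"
    using integrable_completion[of f' lborel] by simp
  have i2: "integrable lborel (\<lambda>x. (norm (f' x))\<^sup>2)"
    using L2fun_cong_AE[OF f'(2) fm' f(2)] by (simp add: L2fun_borel)
  have eq: "fourier_int s f = fourier_int s f'"
    by (rule fourier_int_cong_AE[OF f'(2) fm fm'])
  show "L2fun (fourier_int s f)"
    unfolding eq using fourier_Bessel(1)[OF i1 i2 s] by (simp add: L2fun_borel)
  have "L2norm (fourier_int s f) \<le> L2norm f'"
    unfolding eq using fourier_Bessel(2)[OF i1 i2 s] by (simp add: L2norm_borel)
  then show "L2norm (fourier_int s f) \<le> L2norm f"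
    by (simp add: L2norm_cong_AE[OF f'(2) fm fm'])
qed

lemma fourier_int_diff:
  assumes "integrable lebesgue f" "integrable lebesgue g"
  shows "fourier_int s (\<lambda>x. f x - g x) \<xi> = fourier_int s f \<xi> - fourier_int s g \<xi>"
proof -
  have [measurable]: "(\<lambda>x. exp (complex_of_real s * \<i> * complex_of_real (\<xi> \<bullet> x))) \<in> borel_measurable lebesgue"
    by (rule borel_measurable_lebesgueI) measurable
  have "integrable lebesgue (\<lambda>x. exp (complex_of_real s * \<i> * complex_of_real (\<xi> \<bullet> x)) * h x)" if "integrable lebesgue h" for h
    using that by (rule Bochner_Integration.integrable_bound) (use that in \<open>auto simp: norm_mult intro!: borel_measurable_times\<close>)
  then show ?thesis
    using assms by (simp add: fourier_int_def right_diff_distrib)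
qed

lemma
  assumes f: "L2fun (f :: 'a::euclidean_space \<Rightarrow> complex)"
  shows integrable_truncation: "integrable lebesgue (\<lambda>x. indicator (ball 0 r) x * f x)"
    and L2fun_truncation: "L2fun (\<lambda>x. indicator (ball 0 r) x * f x)"
    and L2norm_truncation: "L2norm (\<lambda>x. indicator (ball 0 r) x * f x) \<le> L2norm f"
proof -
  have [measurable]: "f \<in> borel_measurable lebesgue" and f2: "integrable lebesgue (\<lambda>x. (norm (f x))\<^sup>2)"
    using f by (auto simp: L2fun_def)
  have [measurable]: "(indicator (ball 0 r) :: 'a \<Rightarrow> complex) \<in> borel_measurable lebesgue"
    by (rule borel_measurable_lebesgueI) (auto intro!: borel_measurable_indicator)
  have [measurable]: "(indicator (ball 0 r) :: 'a \<Rightarrow> real) \<in> borel_measurable lebesgue"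
    by (rule borel_measurable_lebesgueI) (auto intro!: borel_measurable_indicator)
  have "integrable lborel (indicator (ball (0::'a) r) :: 'a \<Rightarrow> real)"
    by (intro integrable_real_indicator emeasure_bounded_finite) auto
  then have ib: "integrable lebesgue (indicator (ball (0::'a) r) :: 'a \<Rightarrow> real)"
    by (subst integrable_completion) auto
  show "integrable lebesgue (\<lambda>x. indicator (ball 0 r) x * f x)"
  proof (rule Bochner_Integration.integrable_bound[OF Bochner_Integration.integrable_add[OF ib f2]])
    have "t \<le> 1 + t\<^sup>2" for t :: real
      using zero_le_power2[of "t - 1/2"] by (simp add: power2_eq_square algebra_simps)
    then show "AE x in lebesgue. norm (indicator (ball 0 r) x * f x) \<le> norm (indicator (ball 0 r) x + (norm (f x))\<^sup>2)"
      by (auto simp: indicator_def)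
  qed measurable
  have m: "(\<lambda>x. indicator (ball 0 r) x * f x) \<in> borel_measurable lebesgue"
    by measurable
  have le: "norm (indicator (ball 0 r) x * f x) \<le> norm (f x)" for x
    by (auto simp: indicator_def)
  show "L2fun (\<lambda>x. indicator (ball 0 r) x * f x)" "L2norm (\<lambda>x. indicator (ball 0 r) x * f x) \<le> L2norm f"
    using L2fun_mono[OF f m le] L2norm_mono[OF f m le] by auto
qed

lemma L2norm_tendsto_0:
  fixes f :: "'a::euclidean_space \<Rightarrow> complex"
  assumes m: "\<And>k. u k \<in> borel_measurable lebesgue" and f: "L2fun f" and le: "\<And>k x. norm (u k x) \<le> C * norm (f x)"
    and lim: "\<And>x. (\<lambda>k. u k x) \<longlonglongrightarrow> 0"
  shows "(\<lambda>k. L2norm (u k)) \<longlonglongrightarrow> 0"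
proof -
  have "(\<lambda>k. integral\<^sup>L lebesgue (\<lambda>x. (norm (u k x))\<^sup>2)) \<longlonglongrightarrow> integral\<^sup>L lebesgue (\<lambda>x::'a. 0)"
  proof (rule integral_dominated_convergence[where M=lebesgue and f="\<lambda>x::'a. 0::real" and
        s="\<lambda>k x. (norm (u k x))\<^sup>2" and w="\<lambda>x. C\<^sup>2 * (norm (f x))\<^sup>2"])
    show "integrable lebesgue (\<lambda>x. C\<^sup>2 * (norm (f x))\<^sup>2)"
      using f by (intro integrable_mult_right) (simp add: L2fun_def)
    show "(\<lambda>x. (norm (u k x))\<^sup>2) \<in> borel_measurable lebesgue" for k
      using m[of k] by measurable
    show "AE x in lebesgue. (\<lambda>k. (norm (u k x))\<^sup>2) \<longlonglongrightarrow> 0"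
    proof (intro AE_I2)
      fix x
      show "(\<lambda>k. (norm (u k x))\<^sup>2) \<longlonglongrightarrow> 0"
        using tendsto_power[OF tendsto_norm_zero[OF lim[of x]], of 2] by simp
    qed
    show "AE x in lebesgue. norm ((norm (u k x))\<^sup>2) \<le> C\<^sup>2 * (norm (f x))\<^sup>2" for k
    proof (intro AE_I2)
      fix x
      show "norm ((norm (u k x))\<^sup>2) \<le> C\<^sup>2 * (norm (f x))\<^sup>2"
        using power_mono[OF le[of k x] norm_ge_zero, of 2] by (simp add: power_mult_distrib)
    qed
  qed simp
  then have "(\<lambda>k. sqrt (integral\<^sup>L lebesgue (\<lambda>x. (norm (u k x))\<^sup>2))) \<longlonglongrightarrow> sqrt 0"
    by (intro tendsto_real_sqrt) (simp only: integral_zero)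
  then show ?thesis
    unfolding L2norm_def real_sqrt_zero .
qed

lemma L2norm_truncation_tendsto:
  assumes f: "L2fun (f :: 'a::euclidean_space \<Rightarrow> complex)"
  shows "(\<lambda>N::nat. L2norm (\<lambda>x. indicator (ball 0 (real N)) x * f x - f x)) \<longlonglongrightarrow> 0"
proof (rule L2norm_tendsto_0[OF _ f, where C=1])
  show "(\<lambda>x. indicator (ball 0 (real N)) x * f x - f x) \<in> borel_measurable lebesgue" for N
    using L2fun_truncation[OF f, of "real N"] f unfolding L2fun_def
    by (intro borel_measurable_diff) blast+
  show "norm (indicator (ball 0 (real N)) x * f x - f x) \<le> 1 * norm (f x)" for N x
    by (auto simp: indicator_def)
  fix x
  have "\<forall>\<^sub>F N in sequentially. indicator (ball 0 (real N)) x * f x - f x = 0"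
    using eventually_gt_at_top[of "nat \<lceil>norm x\<rceil>"]
  proof eventually_elim
    fix N assume "N > nat \<lceil>norm x\<rceil>"
    then have "x \<in> ball 0 (real N)" by simp linarith
    then show "indicator (ball 0 (real N)) x * f x - f x = 0" by simp
  qed
  then show "(\<lambda>N. indicator (ball 0 (real N)) x * f x - f x) \<longlonglongrightarrow> 0"
    by (rule tendsto_eventually)
qed

section \<open>Real-valued functions\<close>

definition damped_freq :: "real \<Rightarrow> nat \<Rightarrow> complex" where
  "damped_freq f k = of_real (1 / real (Suc k)) - \<i> * of_real f / 2"

lemma Re_damped_freq: "Re (damped_freq f k) > 0"
  by (simp add: damped_freq_def)

lemma damped_freq_tendsto: "damped_freq f \<longlonglongrightarrow> - \<i> * of_real f / 2"
proof -
  have "(\<lambda>k. 1 / real (Suc k)) \<longlonglongrightarrow> 0"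
    using LIMSEQ_inverse_real_of_nat by (simp add: inverse_eq_divide)
  then have "damped_freq f \<longlonglongrightarrow> of_real 0 - \<i> * of_real f / 2"
    unfolding damped_freq_def[abs_def] by (intro tendsto_diff tendsto_of_real tendsto_const)
  then show ?thesis by simp
qed

lemma norm_damped_freq_le: "f > 0 \<Longrightarrow> norm (damped_freq f k) \<le> 1 + f"
proof -
  assume "f > 0"
  have "norm (damped_freq f k) \<le> norm (complex_of_real (1 / real (Suc k))) + norm (\<i> * of_real f / 2)"
    unfolding damped_freq_def by (rule norm_triangle_ineq4)
  also have "\<dots> \<le> 1 + f"
  proof (intro add_mono)
    show "norm (complex_of_real (1 / real (Suc k))) \<le> 1"
      unfolding norm_of_real by simp
  qed (use \<open>f > 0\<close> in \<open>simp add: norm_mult norm_divide\<close>)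
  finally show ?thesis .
qed

lemma borel_measurable_mult_f [measurable]: "mult_f f \<in> borel_measurable borel"
  unfolding mult_f_def[abs_def] by measurable

lemma norm_mult_f: "norm (mult_f f \<xi>) = 1"
  by (simp add: mult_f_def norm_exp_eq_Re)

lemma norm_gauss_le_1: "Re g \<ge> 0 \<Longrightarrow> norm (gauss g x) \<le> 1"
  by (simp add: norm_gauss)

lemma norm_gauss_damped_le: "norm (gauss (1 / (4 * damped_freq f k)) \<xi>) \<le> 1"
  using Re_inverse_4_pos[OF Re_damped_freq] by (intro norm_gauss_le_1 less_imp_le)

lemma gauss_damped_tendsto_mult_f:
  assumes "f > 0"
  shows "(\<lambda>k. gauss (1 / (4 * damped_freq f k)) \<xi>) \<longlonglongrightarrow> mult_f f \<xi>"
proof -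
  have "(\<lambda>k. gauss (1 / (4 * damped_freq f k)) \<xi>) \<longlonglongrightarrow> gauss (1 / (4 * (- \<i> * of_real f / 2))) \<xi>"
    unfolding gauss_def using assms by (intro tendsto_intros damped_freq_tendsto) auto
  also have "gauss (1 / (4 * (- \<i> * of_real f / 2))) \<xi> = mult_f f \<xi>"
  proof -
    have "1 / (4 * (- \<i> * of_real f / 2)) = \<i> / (2 * of_real f)"
      using assms by (simp add: field_simps)
    then show ?thesis
      by (simp add: gauss_def mult_f_def)
  qed
  finally show ?thesis .
qed

lemma integrable_lebesgueI:
  fixes f :: "'a::euclidean_space \<Rightarrow> 'b::{banach, second_countable_topology}"
  shows "integrable lborel f \<Longrightarrow> integrable lebesgue f"
  using integrable_completion[OF borel_measurable_integrable, of lborel f] by blast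

lemma inverse_fourier_multiplier_estimate:
  fixes g g1 w :: "'a::euclidean_space \<Rightarrow> complex"
  assumes g: "fourierL2 1 (\<lambda>\<xi>. mult_f f \<xi> * g1 \<xi>) g" and g1: "L2fun g1"
    and w: "integrable lebesgue w" "L2fun w"
  shows "L2norm (\<lambda>x. g x - fourier_int 1 w x) \<le> L2norm (\<lambda>\<xi>. mult_f f \<xi> * g1 \<xi> - w \<xi>)"
proof -
  define m where "m \<xi> = mult_f f \<xi> * g1 \<xi>" for \<xi>
  have m: "L2fun m"
  proof (rule L2fun_mono[OF g1])
    show "m \<in> borel_measurable lebesgue"
      unfolding m_def[abs_def] using g1 borel_measurable_lebesgueI[OF borel_measurable_mult_f]
      by (intro borel_measurable_times) (auto simp: L2fun_def)
  qed (simp add: m_def norm_mult norm_mult_f)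
  define mN where "mN N \<xi> = indicator (ball 0 (real N)) \<xi> * m \<xi>" for N \<xi>
  have mN: "integrable lebesgue (mN N)" "L2fun (mN N)" for N
    using integrable_truncation[OF m, of "real N"] L2fun_truncation[OF m, of "real N"] by (simp_all add: mN_def[abs_def])
  have gL: "L2fun g" and lim: "(\<lambda>N. L2norm (\<lambda>x. g x - fourier_int 1 (mN N) x)) \<longlonglongrightarrow> 0"
    using g by (simp_all add: fourierL2_def mN_def[abs_def] m_def)
  have lim2: "(\<lambda>N. L2norm (\<lambda>\<xi>. mN N \<xi> - m \<xi>)) \<longlonglongrightarrow> 0"
    unfolding mN_def by (rule L2norm_truncation_tendsto[OF m])
  have "L2norm (\<lambda>x. g x - fourier_int 1 w x) \<le>
    L2norm (\<lambda>x. g x - fourier_int 1 (mN N) x) + (L2norm (\<lambda>\<xi>. mN N \<xi> - m \<xi>) + L2norm (\<lambda>\<xi>. m \<xi> - w \<xi>))" for N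
  proof -
    have F1: "L2fun (fourier_int 1 (mN N))"
      using mN[of N] by (intro L2fun_fourier_int) auto
    have d: "L2fun (\<lambda>\<xi>. mN N \<xi> - w \<xi>)" "integrable lebesgue (\<lambda>\<xi>. mN N \<xi> - w \<xi>)"
      using mN[of N] w by (auto intro: L2fun_diff)
    have "L2norm (\<lambda>x. g x - fourier_int 1 w x) = L2norm (\<lambda>x. (g x - fourier_int 1 (mN N) x) + fourier_int 1 (\<lambda>\<xi>. mN N \<xi> - w \<xi>) x)"
      by (simp add: fourier_int_diff[OF mN(1) w(1)])
    also have "\<dots> \<le> L2norm (\<lambda>x. g x - fourier_int 1 (mN N) x) + L2norm (fourier_int 1 (\<lambda>\<xi>. mN N \<xi> - w \<xi>))"
      by (rule L2norm_triangle[OF L2fun_diff[OF gL F1] L2fun_fourier_int[OF d(2,1)]]) simp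
    also have "L2norm (fourier_int 1 (\<lambda>\<xi>. mN N \<xi> - w \<xi>)) \<le> L2norm (\<lambda>\<xi>. mN N \<xi> - w \<xi>)"
      using d by (intro L2norm_fourier_int) auto
    also have "L2norm (\<lambda>\<xi>. mN N \<xi> - w \<xi>) = L2norm (\<lambda>\<xi>. (mN N \<xi> - m \<xi>) + (m \<xi> - w \<xi>))"
      by simp
    also have "\<dots> \<le> L2norm (\<lambda>\<xi>. mN N \<xi> - m \<xi>) + L2norm (\<lambda>\<xi>. m \<xi> - w \<xi>)"
      by (intro L2norm_triangle L2fun_diff mN m w)
    finally show ?thesis by simp
  qed
  moreover have "(\<lambda>N. L2norm (\<lambda>x. g x - fourier_int 1 (mN N) x) + (L2norm (\<lambda>\<xi>. mN N \<xi> - m \<xi>) + L2norm (\<lambda>\<xi>. m \<xi> - w \<xi>)))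
     \<longlonglongrightarrow> 0 + (0 + L2norm (\<lambda>\<xi>. m \<xi> - w \<xi>))"
    by (intro tendsto_intros lim lim2)
  ultimately have "L2norm (\<lambda>x. g x - fourier_int 1 w x) \<le> 0 + (0 + L2norm (\<lambda>\<xi>. m \<xi> - w \<xi>))"
    by (intro LIMSEQ_le_const) auto
  then show ?thesis by (simp add: m_def)
qed

theorem real_half_space_bound:
  fixes n :: "'a::euclidean_space" and \<phi> :: "'a \<Rightarrow> real" and g :: "'a \<Rightarrow> complex"
  assumes f: "f > 0" and n: "norm n = 1" and \<phi>: "L2fun (\<lambda>x. complex_of_real (\<phi> x))"
    and supp: "supported_in {x. n \<bullet> x \<ge> a} (\<lambda>x. complex_of_real (\<phi> x))"
    and D: "is_D f (\<lambda>x. complex_of_real (\<phi> x)) g" and C: "\<And>x. sym theta_tilde x \<le> C"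
  shows "L2norm (\<lambda>x. indicator (- {x. n \<bullet> x \<ge> a}) x * g x) \<le> C * L2norm (\<lambda>x. complex_of_real (\<phi> x))"
proof -
  have C0: "C \<ge> 0"
    by (rule order_trans[OF _ C[of 0]]) (simp add: sym_def)
  obtain g1 where g1: "fourierL2 (-1) (\<lambda>x. complex_of_real (\<phi> x)) g1" and g: "fourierL2 1 (\<lambda>\<xi>. mult_f f \<xi> * g1 \<xi>) g"
    using D by (auto simp: is_D_def)
  have g1L: "L2fun g1" and gL: "L2fun g"
    using g1 g by (auto simp: fourierL2_def)
  have Cm: "(\<lambda>x. complex_of_real (\<phi> x)) \<in> borel_measurable lebesgue"
    using \<phi> by (simp add: L2fun_def)
  have "(\<lambda>x. Re (complex_of_real (\<phi> x))) \<in> borel_measurable lebesgue"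
    using Cm by measurable
  then have "\<phi> \<in> borel_measurable lebesgue" by simp
  then obtain \<psi> where \<psi>m: "\<psi> \<in> borel_measurable lborel" and \<psi>: "AE x in lborel. \<phi> x = \<psi> x"
    using completion_ex_borel_measurable_real by blast
  have [measurable]: "\<psi> \<in> borel_measurable borel"
    using \<psi>m by simp
  have \<psi>': "AE x in lebesgue. complex_of_real (\<phi> x) = complex_of_real (\<psi> x)"
    using AE_completion[OF \<psi>] by eventually_elim simp
  have \<psi>L: "L2fun (\<lambda>x. complex_of_real (\<psi> x))"
    by (rule L2fun_cong_AE[OF \<psi>' _ \<phi>]) (auto intro!: borel_measurable_lebesgueI)
  define \<Psi> where "\<Psi> N x = complex_of_real (indicator (ball 0 (real N)) x * \<psi> x)" for N x
  have \<Psi>_eq: "\<Psi> N = (\<lambda>x. indicator (ball 0 (real N)) x * complex_of_real (\<psi> x))" for N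
    by (simp add: \<Psi>_def fun_eq_iff of_real_indicator)
  have \<psi>Nm [measurable]: "(\<lambda>x. indicator (ball 0 (real N)) x * \<psi> x) \<in> borel_measurable borel" for N
    by (intro borel_measurable_times borel_measurable_indicator) auto
  have \<Psi>m [measurable]: "\<Psi> N \<in> borel_measurable borel" for N
    unfolding \<Psi>_def[abs_def] by measurable
  have \<Psi>L: "L2fun (\<Psi> N)" and \<Psi>i: "integrable lborel (\<Psi> N)" and \<Psi>2: "integrable lborel (\<lambda>x. (norm (\<Psi> N x))\<^sup>2)"
    and \<Psi>n: "L2norm (\<Psi> N) \<le> L2norm (\<lambda>x. complex_of_real (\<phi> x))" for N
  proof -
    show *: "L2fun (\<Psi> N)"
      unfolding \<Psi>_eq by (rule L2fun_truncation[OF \<psi>L])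
    have "integrable lebesgue (\<Psi> N)"
      unfolding \<Psi>_eq by (rule integrable_truncation[OF \<psi>L])
    then show "integrable lborel (\<Psi> N)"
      by (subst (asm) integrable_completion) auto
    show "integrable lborel (\<lambda>x. (norm (\<Psi> N x))\<^sup>2)"
      using * by (simp add: L2fun_borel)
    have "L2norm (\<Psi> N) \<le> L2norm (\<lambda>x. complex_of_real (\<psi> x))"
      unfolding \<Psi>_eq by (rule L2norm_truncation[OF \<psi>L])
    also have "\<dots> = L2norm (\<lambda>x. complex_of_real (\<phi> x))"
      by (rule L2norm_cong_AE[OF \<psi>' Cm, symmetric]) (auto intro!: borel_measurable_lebesgueI)
    finally show "L2norm (\<Psi> N) \<le> L2norm (\<lambda>x. complex_of_real (\<phi> x))" .
  qed
  have supp\<Psi>: "AE y in lborel. n \<bullet> y < a \<longrightarrow> \<Psi> N y = 0" for N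
  proof -
    have "AE x in lebesgue. n \<bullet> x < a \<longrightarrow> \<psi> x = 0"
      using supp[unfolded supported_in_def] \<psi>' by eventually_elim auto
    then have "AE x in lborel. n \<bullet> x < a \<longrightarrow> \<psi> x = 0"
      by (simp add: AE_completion_iff)
    then show ?thesis
      by eventually_elim (auto simp: \<Psi>_def)
  qed
  define F where "F N = fourier_int (-1) (\<Psi> N)" for N
  have [measurable]: "F N \<in> borel_measurable borel" for N
    by (simp add: F_def)
  have F2: "integrable lborel (\<lambda>\<xi>. (norm (F N \<xi>))\<^sup>2)" "(LINT \<xi>|lborel. (norm (F N \<xi>))\<^sup>2) \<le> (LINT x|lborel. (norm (\<Psi> N x))\<^sup>2)" for N
    unfolding F_def by (rule fourier_Bessel[OF \<Psi>i \<Psi>2]; simp)+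
  have FL: "L2fun (F N)" for N
    using F2 by (simp add: L2fun_borel)
  have Flim: "(\<lambda>N. L2norm (\<lambda>\<xi>. g1 \<xi> - F N \<xi>)) \<longlonglongrightarrow> 0"
  proof -
    have "fourier_int (-1) (\<lambda>x. indicator (ball 0 (real N)) x * complex_of_real (\<phi> x)) = F N" for N
      unfolding F_def
    proof (rule fourier_int_cong_AE)
      show "AE x in lebesgue. indicator (ball 0 (real N)) x * complex_of_real (\<phi> x) = \<Psi> N x"
        using \<psi>' by eventually_elim (simp add: \<Psi>_eq)
      show "(\<lambda>x. indicator (ball 0 (real N)) x * complex_of_real (\<phi> x)) \<in> borel_measurable lebesgue"
        using L2fun_truncation[OF \<phi>, of "real N"] by (simp add: L2fun_def)
    qed (auto intro!: borel_measurable_lebesgueI)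
    then show ?thesis
      using g1 by (simp add: fourierL2_def)
  qed
  define b where "b = damped_freq f"
  define w where "w N k \<xi> = gauss (1 / (4 * b k)) \<xi> * F N \<xi>" for N k \<xi>
  have [measurable]: "w N k \<in> borel_measurable borel" for N k
    unfolding w_def[abs_def] by measurable
  have wL: "L2fun (w N k)" for N k
    by (rule L2fun_mono[OF FL[of N] borel_measurable_lebesgueI])
       (auto simp: w_def b_def norm_mult intro!: mult_left_le_one_le norm_gauss_damped_le)
  have wi: "integrable lebesgue (w N k)" for N k
  proof -
    have "integrable lborel (w N k)"
      unfolding w_def[abs_def]
    proof (rule integrable_gauss_mult_bounded)
      show "norm (F N x) \<le> fourier_const TYPE('a) * (LINT x|lborel. norm (\<Psi> N x))" for x
        unfolding F_def by (rule norm_fourier_int_le[OF \<Psi>i])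
    qed (auto simp: b_def intro!: Re_inverse_4_pos Re_damped_freq)
    then show ?thesis by (rule integrable_lebesgueI)
  qed
  let ?K = "{x. n \<bullet> x < a}"
  have K: "- {x. n \<bullet> x \<ge> a} = ?K" by auto
  have [measurable]: "?K \<in> sets borel"
    by measurable
  define v where "v N k = fourier_int 1 (w N k)" for N k
  have [measurable]: "v N k \<in> borel_measurable borel" for N k
    by (simp add: v_def)
  have vL: "L2fun (v N k)" for N k
    unfolding v_def using wi wL by (intro L2fun_fourier_int) auto
  have [measurable]: "(indicator ?K :: 'a \<Rightarrow> complex) \<in> borel_measurable lebesgue"
    by (intro borel_measurable_lebesgueI borel_measurable_indicator) auto
  have Kmeas: "(\<lambda>x. indicator ?K x * u x) \<in> borel_measurable lebesgue" if "L2fun u" for u :: "'a \<Rightarrow> complex"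
    using that by (intro borel_measurable_times) (auto simp: L2fun_def)
  have Kle: "norm (indicator ?K x * z) \<le> norm z" for x and z :: complex
    by (auto simp: indicator_def)
  have KL: "L2fun (\<lambda>x. indicator ?K x * u x)" "L2norm (\<lambda>x. indicator ?K x * u x) \<le> L2norm u" if "L2fun u" for u :: "'a \<Rightarrow> complex"
    using L2fun_mono[OF that Kmeas[OF that] Kle] L2norm_mono[OF that Kmeas[OF that] Kle] by auto
  define \<beta> where "\<beta> N k = (LINT \<xi>|lborel. (norm (half_gauss (b k) (n \<bullet> \<xi>)) * sqrt (norm (b k) / pi))\<^sup>2 * (norm (F N \<xi>))\<^sup>2)" for N k
  have \<epsilon>: "\<And>k. 1 / real (Suc k) > 0" "\<And>k. 1 / real (Suc k) \<le> 1" "(\<lambda>k. 1 / real (Suc k)) \<longlonglongrightarrow> 0"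
    using LIMSEQ_inverse_real_of_nat by (auto simp: inverse_eq_divide)
  note lim = half_gauss_multiplier_limit[OF f \<epsilon>, folded damped_freq_def, folded b_def]
  have vle: "L2norm (\<lambda>x. indicator ?K x * v N k x) \<le> sqrt (\<beta> N k)" for N k
  proof -
    have "(LINT x|lborel. (norm (indicator ?K x * v N k x))\<^sup>2) \<le> \<beta> N k"
      unfolding v_def w_def[abs_def] \<beta>_def F_def
      by (rule half_space_conv_estimate[OF n _ \<Psi>i \<Psi>2 supp\<Psi>])
         (auto simp: b_def Re_damped_freq intro!: lim(2)[OF _ F2(1), unfolded b_def])
    then show ?thesis
      by (subst L2norm_borel) (auto intro!: borel_measurable_times borel_measurable_indicator)
  qed
  define e where "e N k = L2norm (\<lambda>\<xi>. mult_f f \<xi> * F N \<xi> - w N k \<xi>)" for N k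
  have e: "(\<lambda>k. e N k) \<longlonglongrightarrow> 0" for N
    unfolding e_def
  proof (rule L2norm_tendsto_0[OF _ FL[of N], where C=2])
    show "(\<lambda>\<xi>. mult_f f \<xi> * F N \<xi> - w N k \<xi>) \<in> borel_measurable lebesgue" for k
      by (rule borel_measurable_lebesgueI) measurable
    show "norm (mult_f f \<xi> * F N \<xi> - w N k \<xi>) \<le> 2 * norm (F N \<xi>)" for k \<xi>
    proof -
      have "mult_f f \<xi> * F N \<xi> - w N k \<xi> = (mult_f f \<xi> - gauss (1 / (4 * b k)) \<xi>) * F N \<xi>"
        by (simp add: w_def left_diff_distrib)
      moreover have "norm (mult_f f \<xi> - gauss (1 / (4 * b k)) \<xi>) \<le> 2"
        using norm_triangle_ineq4[of "mult_f f \<xi>" "gauss (1 / (4 * b k)) \<xi>"] norm_gauss_damped_le[of f k \<xi>]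
        by (simp add: norm_mult_f b_def)
      ultimately show ?thesis
        by (simp add: norm_mult mult_right_mono)
    qed
    fix \<xi>
    have "(\<lambda>k. mult_f f \<xi> * F N \<xi> - w N k \<xi>) \<longlonglongrightarrow> mult_f f \<xi> * F N \<xi> - mult_f f \<xi> * F N \<xi>"
      unfolding w_def b_def by (intro tendsto_intros gauss_damped_tendsto_mult_f f)
    then show "(\<lambda>k. mult_f f \<xi> * F N \<xi> - w N k \<xi>) \<longlonglongrightarrow> 0" by simp
  qed
  have mL: "L2fun (\<lambda>\<xi>. mult_f f \<xi> * u \<xi>)" "L2norm (\<lambda>\<xi>. mult_f f \<xi> * u \<xi>) \<le> L2norm u" if "L2fun u" for u
  proof -
    have m: "(\<lambda>\<xi>. mult_f f \<xi> * u \<xi>) \<in> borel_measurable lebesgue"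
      using that borel_measurable_lebesgueI[OF borel_measurable_mult_f]
      by (intro borel_measurable_times) (auto simp: L2fun_def)
    have le: "norm (mult_f f \<xi> * u \<xi>) \<le> norm (u \<xi>)" for \<xi>
      by (simp add: norm_mult norm_mult_f)
    show "L2fun (\<lambda>\<xi>. mult_f f \<xi> * u \<xi>)" "L2norm (\<lambda>\<xi>. mult_f f \<xi> * u \<xi>) \<le> L2norm u"
      using L2fun_mono[OF that m le] L2norm_mono[OF that m le] by auto
  qed
  have main: "L2norm (\<lambda>x. indicator ?K x * g x) \<le> L2norm (\<lambda>\<xi>. g1 \<xi> - F N \<xi>) + e N k + sqrt (\<beta> N k)" for N k
  proof -
    have "L2norm (\<lambda>x. indicator ?K x * g x) = L2norm (\<lambda>x. indicator ?K x * (g x - v N k x) + indicator ?K x * v N k x)"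
      by (simp add: algebra_simps)
    also have "\<dots> \<le> L2norm (\<lambda>x. indicator ?K x * (g x - v N k x)) + L2norm (\<lambda>x. indicator ?K x * v N k x)"
      by (intro L2norm_triangle KL L2fun_diff gL vL)
    also have "L2norm (\<lambda>x. indicator ?K x * (g x - v N k x)) \<le> L2norm (\<lambda>x. g x - v N k x)"
      by (intro KL L2fun_diff gL vL)
    also have "\<dots> \<le> L2norm (\<lambda>\<xi>. mult_f f \<xi> * g1 \<xi> - w N k \<xi>)"
      unfolding v_def by (rule inverse_fourier_multiplier_estimate[OF g g1L wi wL])
    also have "\<dots> = L2norm (\<lambda>\<xi>. mult_f f \<xi> * (g1 \<xi> - F N \<xi>) + (mult_f f \<xi> * F N \<xi> - w N k \<xi>))"
      by (simp add: algebra_simps)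
    also have "\<dots> \<le> L2norm (\<lambda>\<xi>. mult_f f \<xi> * (g1 \<xi> - F N \<xi>)) + e N k"
      unfolding e_def by (intro L2norm_triangle mL L2fun_diff g1L FL wL)
    also have "L2norm (\<lambda>\<xi>. mult_f f \<xi> * (g1 \<xi> - F N \<xi>)) \<le> L2norm (\<lambda>\<xi>. g1 \<xi> - F N \<xi>)"
      by (intro mL L2fun_diff g1L FL)
    finally show ?thesis
      using vle[of N k] by simp
  qed
  have bound: "L2norm (\<lambda>x. indicator ?K x * g x) \<le> L2norm (\<lambda>\<xi>. g1 \<xi> - F N \<xi>) + C * L2norm (\<lambda>x. complex_of_real (\<phi> x))" for N
  proof -
    define T where "T = (LINT \<xi>|lborel. (norm (theta_tilde (- (n \<bullet> \<xi> / sqrt f))))\<^sup>2 * (norm (F N \<xi>))\<^sup>2)"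
    have "(\<lambda>k. \<beta> N k) \<longlonglongrightarrow> T"
      unfolding \<beta>_def T_def by (rule lim(1)) (use F2 in auto)
    then have "(\<lambda>k. L2norm (\<lambda>\<xi>. g1 \<xi> - F N \<xi>) + e N k + sqrt (\<beta> N k)) \<longlonglongrightarrow> L2norm (\<lambda>\<xi>. g1 \<xi> - F N \<xi>) + 0 + sqrt T"
      by (intro tendsto_intros e)
    then have "L2norm (\<lambda>x. indicator ?K x * g x) \<le> L2norm (\<lambda>\<xi>. g1 \<xi> - F N \<xi>) + 0 + sqrt T"
      using main[of N] by (intro LIMSEQ_le_const) auto
    moreover have "sqrt T \<le> C * L2norm (\<lambda>x. complex_of_real (\<phi> x))"
    proof -
      have "T \<le> C\<^sup>2 * (LINT \<xi>|lborel. (norm (F N \<xi>))\<^sup>2)"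
        using sym_theta_multiplier_bound[of "\<lambda>x. indicator (ball 0 (real N)) x * \<psi> x" "-1" C n "sqrt f", folded \<Psi>_def] F2(1)[of N] C
        by (simp add: T_def F_def)
      also have "\<dots> \<le> C\<^sup>2 * (LINT x|lborel. (norm (\<Psi> N x))\<^sup>2)"
        by (intro mult_left_mono F2) simp
      finally have "sqrt T \<le> sqrt (C\<^sup>2 * (LINT x|lborel. (norm (\<Psi> N x))\<^sup>2))"
        by (rule real_sqrt_le_mono)
      also have "\<dots> = C * L2norm (\<Psi> N)"
        using C0 by (simp add: real_sqrt_mult L2norm_borel)
      also have "\<dots> \<le> C * L2norm (\<lambda>x. complex_of_real (\<phi> x))"
        by (intro mult_left_mono \<Psi>n C0)
      finally show ?thesis .
    qed
    ultimately show ?thesis by simp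
  qed
  have "(\<lambda>N. L2norm (\<lambda>\<xi>. g1 \<xi> - F N \<xi>) + C * L2norm (\<lambda>x. complex_of_real (\<phi> x))) \<longlonglongrightarrow> 0 + C * L2norm (\<lambda>x. complex_of_real (\<phi> x))"
    by (intro tendsto_intros Flim)
  then have "L2norm (\<lambda>x. indicator ?K x * g x) \<le> 0 + C * L2norm (\<lambda>x. complex_of_real (\<phi> x))"
    using bound by (intro LIMSEQ_le_const) auto
  then show ?thesis
    by (simp add: K)
qed

section \<open>Complex-valued functions\<close>

lemma is_D_chirp_conv:
  fixes h :: "'a::euclidean_space \<Rightarrow> complex"
  assumes f: "f > 0" and h: "integrable lborel h" and h2: "integrable lborel (\<lambda>x. (norm (h x))\<^sup>2)"
    and supp: "\<And>x. norm x \<ge> R \<Longrightarrow> h x = 0"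
  defines "b \<equiv> - \<i> * of_real f / 2"
  shows "is_D f h (\<lambda>x. LINT y|lborel. gauss_kernel (1 / (4 * b)) (x - y) * h y)"
proof -
  have [measurable]: "h \<in> borel_measurable borel"
    using h by (simp add: borel_measurable_integrable[of lborel, simplified])
  have b0: "b \<noteq> 0" using f by (simp add: b_def)
  define g where "g x = (LINT y|lborel. gauss_kernel (1 / (4 * b)) (x - y) * h y)" for x
  have [measurable]: "g \<in> borel_measurable borel"
    unfolding g_def[abs_def] by (rule lborel.borel_measurable_lebesgue_integral[of _ borel]) measurable
  define F where "F = fourier_int (-1) h"
  have [measurable]: "F \<in> borel_measurable borel"
    by (simp add: F_def)
  have F2: "integrable lborel (\<lambda>\<xi>. (norm (F \<xi>))\<^sup>2)"
    unfolding F_def by (rule fourier_Bessel[OF h h2]) simp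
  then have FL: "L2fun F"
    by (simp add: L2fun_borel)
  have "fourierL2 (-1) h F"
    unfolding fourierL2_def
  proof (intro conjI FL tendsto_eventually)
    show "\<forall>\<^sub>F N in sequentially. L2norm (\<lambda>\<xi>. F \<xi> - fourier_int (-1) (\<lambda>x. indicator (ball 0 (real N)) x * h x) \<xi>) = 0"
      using eventually_gt_at_top[of "nat \<lceil>R\<rceil>"]
    proof eventually_elim
      fix N assume "N > nat \<lceil>R\<rceil>"
      then have "R \<le> real N" by linarith
      then have "(\<lambda>x. indicator (ball 0 (real N)) x * h x) = h"
        using supp by (auto simp: indicator_def fun_eq_iff)
      then show "L2norm (\<lambda>\<xi>. F \<xi> - fourier_int (-1) (\<lambda>x. indicator (ball 0 (real N)) x * h x) \<xi>) = 0"
        by (simp add: F_def L2norm_def)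
    qed
  qed
  moreover have "fourierL2 1 (\<lambda>\<xi>. mult_f f \<xi> * F \<xi>) g"
  proof -
    define m where "m \<xi> = mult_f f \<xi> * F \<xi>" for \<xi>
    have [measurable]: "m \<in> borel_measurable borel"
      unfolding m_def[abs_def] by measurable
    have nm: "norm (m \<xi>) = norm (F \<xi>)" for \<xi>
      by (simp add: m_def norm_mult norm_mult_f)
    have mL: "L2fun m"
      using F2 by (simp add: L2fun_borel nm)
    define w where "w k \<xi> = gauss (1 / (4 * damped_freq f k)) \<xi> * F \<xi>" for k \<xi>
    have [measurable]: "w k \<in> borel_measurable borel" for k
      unfolding w_def[abs_def] by measurable
    have nw: "norm (w k \<xi>) \<le> norm (F \<xi>)" for k \<xi>
      by (auto simp: w_def norm_mult intro!: mult_left_le_one_le norm_gauss_damped_le)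
    have wL: "L2fun (w k)" for k
      by (rule L2fun_mono[OF FL borel_measurable_lebesgueI nw]) measurable
    have wi: "integrable lebesgue (w k)" for k
    proof -
      have "integrable lborel (w k)"
        unfolding w_def[abs_def]
      proof (rule integrable_gauss_mult_bounded)
        show "norm (F x) \<le> fourier_const TYPE('a) * (LINT x|lborel. norm (h x))" for x
          unfolding F_def by (rule norm_fourier_int_le[OF h])
      qed (auto intro!: Re_inverse_4_pos Re_damped_freq)
      then show ?thesis by (rule integrable_lebesgueI)
    qed
    have v: "(\<lambda>k. fourier_int 1 (w k) x) \<longlonglongrightarrow> g x" for x
    proof -
      have "fourier_int 1 (w k) x = (LINT y|lborel. gauss_kernel (1 / (4 * damped_freq f k)) (x - y) * h y)" for k
        using fourier_gauss_multiplier[OF h Re_inverse_4_pos[OF Re_damped_freq], of "-1" f k x]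
        by (simp add: w_def[abs_def] F_def)
      moreover have "(\<lambda>k. LINT y|lborel. gauss_kernel (1 / (4 * damped_freq f k)) (x - y) * h y) \<longlonglongrightarrow> g x"
        unfolding g_def
      proof (rule integral_dominated_convergence[where w="\<lambda>y. (sqrt (4 * pi * (1 + f)) / (2 * pi)) ^ DIM('a) * norm (h y)"])
        show "integrable lborel (\<lambda>y. (sqrt (4 * pi * (1 + f)) / (2 * pi)) ^ DIM('a) * norm (h y))"
          using h by simp
        have "(\<lambda>k. gauss_kernel (1 / (4 * damped_freq f k)) z) \<longlonglongrightarrow> gauss_kernel (1 / (4 * b)) z" for z :: 'a
        proof -
          have l: "damped_freq f \<longlonglongrightarrow> b"
            unfolding b_def by (rule damped_freq_tendsto)
          have l1: "(\<lambda>k. 1 / (4 * damped_freq f k)) \<longlonglongrightarrow> 1 / (4 * b)"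
            using b0 by (intro tendsto_intros l) auto
          have "isCont csqrt (of_real pi / (1 / (4 * b)))"
            by (rule continuous_at_csqrt) (use f in \<open>simp add: b_def complex_nonpos_Reals_iff\<close>)
          moreover have "(\<lambda>k. of_real pi / (1 / (4 * damped_freq f k))) \<longlonglongrightarrow> of_real pi / (1 / (4 * b))"
            using b0 by (intro tendsto_divide tendsto_const l1) auto
          ultimately have "(\<lambda>k. csqrt (of_real pi / (1 / (4 * damped_freq f k)))) \<longlonglongrightarrow> csqrt (of_real pi / (1 / (4 * b)))"
            by (rule isCont_tendsto_compose)
          moreover have "(\<lambda>k. 1 / (4 * (1 / (4 * damped_freq f k)))) \<longlonglongrightarrow> 1 / (4 * (1 / (4 * b)))"
            using b0 by (intro tendsto_divide tendsto_mult tendsto_const l1) auto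
          ultimately show ?thesis
            unfolding gauss_kernel_def gauss_def
            by (intro tendsto_mult tendsto_power tendsto_divide tendsto_exp tendsto_minus tendsto_const) (use b0 in auto)
        qed
        then show "AE y in lborel. (\<lambda>k. gauss_kernel (1 / (4 * damped_freq f k)) (x - y) * h y) \<longlonglongrightarrow> gauss_kernel (1 / (4 * b)) (x - y) * h y"
          by (intro AE_I2 tendsto_mult tendsto_const)
        show "AE y in lborel. norm (gauss_kernel (1 / (4 * damped_freq f k)) (x - y) * h y) \<le> (sqrt (4 * pi * (1 + f)) / (2 * pi)) ^ DIM('a) * norm (h y)" for k
        proof (intro AE_I2)
          fix y
          have d0: "damped_freq f k \<noteq> 0"
            using Re_damped_freq[of f k] by auto
          have g1: "norm (gauss (1 / (4 * (1 / (4 * damped_freq f k)))) (x - y)) \<le> 1"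
            using d0 Re_damped_freq[of f k] by (intro norm_gauss_le_1) simp
          have "norm (csqrt (of_real pi / (1 / (4 * damped_freq f k))) / of_real (2 * pi)) \<le> sqrt (4 * pi * (1 + f)) / (2 * pi)"
          proof -
            have "norm (csqrt (of_real pi / (1 / (4 * damped_freq f k))) / of_real (2 * pi)) = sqrt (4 * pi * norm (damped_freq f k)) / (2 * pi)"
              by (simp add: norm_divide norm_mult mult_ac)
            also have "\<dots> \<le> sqrt (4 * pi * (1 + f)) / (2 * pi)"
              using norm_damped_freq_le[OF f, of k] by (intro divide_right_mono real_sqrt_le_mono mult_left_mono) auto
            finally show ?thesis .
          qed
          then have "norm ((csqrt (of_real pi / (1 / (4 * damped_freq f k))) / of_real (2 * pi)) ^ DIM('a)) \<le> (sqrt (4 * pi * (1 + f)) / (2 * pi)) ^ DIM('a)"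
            unfolding norm_power by (rule power_mono) simp
          then have "norm (gauss_kernel (1 / (4 * damped_freq f k)) (x - y)) \<le> (sqrt (4 * pi * (1 + f)) / (2 * pi)) ^ DIM('a) * 1"
            unfolding gauss_kernel_def norm_mult using f by (intro mult_mono g1) auto
          then show "norm (gauss_kernel (1 / (4 * damped_freq f k)) (x - y) * h y) \<le> (sqrt (4 * pi * (1 + f)) / (2 * pi)) ^ DIM('a) * norm (h y)"
            unfolding norm_mult mult_1_right by (rule mult_right_mono) simp
        qed
      qed measurable
      ultimately show ?thesis by simp
    qed
    have Fatou: "L2fun (\<lambda>x. g x - c x) \<and> L2norm (\<lambda>x. g x - c x) \<le> B"
      if c: "c \<in> borel_measurable lebesgue" and L: "\<And>k. L2fun (\<lambda>x. fourier_int 1 (w k) x - c x)"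
        and le: "\<And>k. L2norm (\<lambda>x. fourier_int 1 (w k) x - c x) \<le> B' k" and B: "B' \<longlonglongrightarrow> B" for c B B'
    proof -
      have B0: "B \<ge> 0"
        using le L2norm_nonneg order_trans by (intro LIMSEQ_le_const[OF B]) blast
      have gm: "(\<lambda>x. g x - c x) \<in> borel_measurable lebesgue"
        by (rule borel_measurable_diff[OF borel_measurable_lebesgueI c]) measurable
      have um: "\<And>k. (\<lambda>x. fourier_int 1 (w k) x - c x) \<in> borel_measurable lebesgue"
        and ui: "\<And>k. integrable lebesgue (\<lambda>x. (norm (fourier_int 1 (w k) x - c x))\<^sup>2)"
        using L by (auto simp: L2fun_def)
      have ul: "integral\<^sup>L lebesgue (\<lambda>x. (norm (fourier_int 1 (w k) x - c x))\<^sup>2) \<le> (B' k)\<^sup>2" for k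
        using power_mono[OF le[of k] L2norm_nonneg, of 2] by (simp add: L2norm_sq)
      have lim: "AE x in lebesgue. (\<lambda>k. fourier_int 1 (w k) x - c x) \<longlonglongrightarrow> g x - c x"
        by (intro AE_I2 tendsto_diff tendsto_const v)
      note F = integral_sq_Fatou[OF um gm lim ui ul tendsto_power[OF B]]
      have "L2norm (\<lambda>x. g x - c x) \<le> sqrt (B\<^sup>2)"
        unfolding L2norm_def by (rule real_sqrt_le_mono[OF F(2)])
      then show ?thesis
        using F(1) gm B0 by (simp add: L2fun_def)
    qed
    have gL: "L2fun g"
    proof -
      have "L2norm (fourier_int 1 (w k)) \<le> L2norm F" for k
      proof -
        have "L2norm (fourier_int 1 (w k)) \<le> L2norm (w k)"
          using wi wL by (intro L2norm_fourier_int) auto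
        also have "\<dots> \<le> L2norm F"
          by (rule L2norm_mono[OF FL borel_measurable_lebesgueI nw]) measurable
        finally show ?thesis .
      qed
      moreover have "L2fun (fourier_int 1 (w k))" for k
        using wi wL by (intro L2fun_fourier_int) auto
      ultimately show ?thesis
        using Fatou[of "\<lambda>_. 0" "\<lambda>_. L2norm F" "L2norm F"] by simp
    qed
    define mN where "mN N \<xi> = indicator (ball 0 (real N)) \<xi> * m \<xi>" for N \<xi>
    have mN: "integrable lebesgue (mN N)" "L2fun (mN N)" for N
      using integrable_truncation[OF mL, of "real N"] L2fun_truncation[OF mL, of "real N"] by (simp_all add: mN_def[abs_def])
    have leN: "L2norm (\<lambda>x. g x - fourier_int 1 (mN N) x) \<le> L2norm (\<lambda>\<xi>. mN N \<xi> - m \<xi>)" for N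
    proof -
      have FN: "L2fun (fourier_int 1 (mN N))"
        using mN by (intro L2fun_fourier_int) auto
      define r where "r k = L2norm (\<lambda>\<xi>. m \<xi> - w k \<xi>)" for k
      have "r \<longlonglongrightarrow> 0"
        unfolding r_def
      proof (rule L2norm_tendsto_0[OF _ FL, where C=2])
        show "(\<lambda>\<xi>. m \<xi> - w k \<xi>) \<in> borel_measurable lebesgue" for k
          by (rule borel_measurable_lebesgueI) measurable
        show "norm (m \<xi> - w k \<xi>) \<le> 2 * norm (F \<xi>)" for k \<xi>
          using norm_triangle_ineq4[of "m \<xi>" "w k \<xi>"] nw[of k \<xi>] nm[of \<xi>] by simp
        fix \<xi>
        have "(\<lambda>k. m \<xi> - w k \<xi>) \<longlonglongrightarrow> m \<xi> - mult_f f \<xi> * F \<xi>"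
          unfolding w_def by (intro tendsto_intros gauss_damped_tendsto_mult_f f)
        then show "(\<lambda>k. m \<xi> - w k \<xi>) \<longlonglongrightarrow> 0" by (simp add: m_def)
      qed
      then have lim: "(\<lambda>k. L2norm (\<lambda>\<xi>. mN N \<xi> - m \<xi>) + r k) \<longlonglongrightarrow> L2norm (\<lambda>\<xi>. mN N \<xi> - m \<xi>) + 0"
        by (intro tendsto_intros)
      have d: "L2fun (\<lambda>x. fourier_int 1 (w k) x - fourier_int 1 (mN N) x)" for k
        using wi wL by (intro L2fun_diff FN L2fun_fourier_int) auto
      have le: "L2norm (\<lambda>x. fourier_int 1 (w k) x - fourier_int 1 (mN N) x) \<le> L2norm (\<lambda>\<xi>. mN N \<xi> - m \<xi>) + r k" for k
      proof -
        have i: "integrable lebesgue (\<lambda>\<xi>. w k \<xi> - mN N \<xi>)"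
          using wi mN by simp
        have "L2norm (\<lambda>x. fourier_int 1 (w k) x - fourier_int 1 (mN N) x) = L2norm (fourier_int 1 (\<lambda>\<xi>. w k \<xi> - mN N \<xi>))"
          by (rule arg_cong[where f=L2norm]) (simp add: fun_eq_iff fourier_int_diff[OF wi mN(1)])
        also have "\<dots> \<le> L2norm (\<lambda>\<xi>. w k \<xi> - mN N \<xi>)"
          by (rule L2norm_fourier_int[OF i L2fun_diff[OF wL mN(2)]]) simp
        also have "\<dots> = L2norm (\<lambda>\<xi>. (mN N \<xi> - m \<xi>) + (m \<xi> - w k \<xi>))"
          unfolding L2norm_def by (simp add: norm_minus_commute)
        also have "\<dots> \<le> L2norm (\<lambda>\<xi>. mN N \<xi> - m \<xi>) + r k"
          unfolding r_def by (intro L2norm_triangle L2fun_diff mN mL wL)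
        finally show ?thesis .
      qed
      have FNm: "fourier_int 1 (mN N) \<in> borel_measurable lebesgue"
        using FN by (simp add: L2fun_def)
      from Fatou[OF FNm d le lim] show ?thesis by simp
    qed
    have limN: "(\<lambda>N. L2norm (\<lambda>\<xi>. mN N \<xi> - m \<xi>)) \<longlonglongrightarrow> 0"
      unfolding mN_def by (rule L2norm_truncation_tendsto[OF mL])
    have "(\<lambda>N. L2norm (\<lambda>x. g x - fourier_int 1 (mN N) x)) \<longlonglongrightarrow> 0"
    proof (rule Lim_null_comparison[OF always_eventually limN], rule allI)
      show "norm (L2norm (\<lambda>x. g x - fourier_int 1 (mN N) x)) \<le> L2norm (\<lambda>\<xi>. mN N \<xi> - m \<xi>)" for N
        unfolding real_norm_def abs_of_nonneg[OF L2norm_nonneg] by (rule leN)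
    qed
    moreover have "mN N = (\<lambda>\<xi>. indicator (ball 0 (real N)) \<xi> * (mult_f f \<xi> * F \<xi>))" for N
      by (simp add: fun_eq_iff mN_def m_def)
    ultimately show ?thesis
      using gL by (simp only: fourierL2_def)
  qed
  ultimately have "is_D f h g"
    unfolding is_D_def by (intro exI conjI)
  then show ?thesis
    unfolding g_def[abs_def] .
qed

theorem complex_half_space_sharp:
  fixes n :: "'a::euclidean_space" and f a c :: real
  assumes f: "f > 0" and n: "norm n = 1" and c: "c < 1"
  shows "\<exists>h g. L2fun h \<and> supported_in {x. n \<bullet> x \<ge> a} h \<and> is_D f h g \<and>
    L2norm (\<lambda>x. indicator (- {x. n \<bullet> x \<ge> a}) x * g x) > c * L2norm h"
proof -
  have nn: "n \<bullet> n = 1"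
    using n by (simp add: dot_square_norm)
  define p where "p = (a + 1) *\<^sub>R n"
  define tent where "tent y = complex_of_real (max 0 (1 - norm (y - p)))" for y :: 'a
  have conttent: "continuous_on UNIV tent"
    unfolding tent_def[abs_def] by (intro continuous_intros)
  then have [measurable]: "tent \<in> borel_measurable borel"
    by (rule borel_measurable_continuous_onI)
  have tent1: "norm (tent y) \<le> 1" for y
    by (simp add: tent_def)
  have tent0: "tent y = 0" if "y \<notin> cball p 1" for y
    using that by (simp add: tent_def dist_norm norm_minus_commute)
  have iball: "integrable lborel (indicator (cball p 1) :: 'a \<Rightarrow> real)"
    by (intro integrable_real_indicator emeasure_bounded_finite) auto
  have tenti: "integrable lborel tent"
    using iball by (rule Bochner_Integration.integrable_bound) (use tent1 tent0 in \<open>auto simp: indicator_def\<close>)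
  have tent2: "integrable lborel (\<lambda>x. (norm (tent x))\<^sup>2)"
    using iball by (rule Bochner_Integration.integrable_bound) (use tent1 tent0 in \<open>auto simp: indicator_def power_le_one\<close>)
  have pos: "(LINT x|lborel. (norm (tent x))\<^sup>2) > 0"
  proof -
    have ib: "integrable lborel (indicator (ball p (1/2)) :: 'a \<Rightarrow> real)"
      by (intro integrable_real_indicator emeasure_bounded_finite) auto
    have "0 < (1/4) * measure lborel (ball p (1/2))"
      using content_ball_pos[of "1/2" p] by simp
    also have "\<dots> = (LINT x|lborel. (1/4) * indicator (ball p (1/2)) x)"
      by simp
    also have "\<dots> \<le> (LINT x|lborel. (norm (tent x))\<^sup>2)"
    proof (rule integral_mono[OF _ tent2])
      show "(1/4) * indicator (ball p (1/2)) x \<le> (norm (tent x))\<^sup>2" for x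
      proof (cases "x \<in> ball p (1/2)")
        case True
        then have "norm (tent x) \<ge> 1/2"
          unfolding tent_def norm_of_real by (simp add: dist_norm norm_minus_commute)
        then have "(1/2)\<^sup>2 \<le> (norm (tent x))\<^sup>2"
          by (intro power_mono) auto
        then show ?thesis using True by (simp add: power_divide)
      qed simp
    qed (use ib in simp)
    finally show ?thesis .
  qed
  define X where "X = fourier_int (-1) tent"
  have [measurable]: "X \<in> borel_measurable borel"
    by (simp add: X_def)
  have X2: "integrable lborel (\<lambda>\<xi>. (norm (X \<xi>))\<^sup>2)"
    unfolding X_def by (rule fourier_Bessel[OF tenti tent2]) simp
  have XX: "(LINT x|lborel. (norm (tent x))\<^sup>2) \<le> (LINT \<xi>|lborel. (norm (X \<xi>))\<^sup>2)"
    unfolding X_def by (rule fourier_reverse_Bessel[OF tenti conttent tent1]) (use X2 in \<open>auto simp: X_def\<close>)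
  define S where "S N = (LINT \<xi>|lborel. indicator {\<xi>. n \<bullet> \<xi> < f * a + real N} \<xi> * (norm (X \<xi>))\<^sup>2)" for N
  have "S \<longlonglongrightarrow> (LINT \<xi>|lborel. (norm (X \<xi>))\<^sup>2)"
    unfolding S_def
  proof (rule integral_dominated_convergence[OF _ _ X2])
    show "AE \<xi> in lborel. (\<lambda>N. indicator {\<xi>. n \<bullet> \<xi> < f * a + real N} \<xi> * (norm (X \<xi>))\<^sup>2) \<longlonglongrightarrow> (norm (X \<xi>))\<^sup>2"
    proof (intro AE_I2 tendsto_eventually)
      fix \<xi>
      show "\<forall>\<^sub>F N in sequentially. indicator {\<xi>. n \<bullet> \<xi> < f * a + real N} \<xi> * (norm (X \<xi>))\<^sup>2 = (norm (X \<xi>))\<^sup>2"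
        using eventually_gt_at_top[of "nat \<lceil>n \<bullet> \<xi> - f * a\<rceil>"]
      proof eventually_elim
        fix N assume "N > nat \<lceil>n \<bullet> \<xi> - f * a\<rceil>"
        then have "n \<bullet> \<xi> < f * a + real N" by linarith
        then show "indicator {\<xi>. n \<bullet> \<xi> < f * a + real N} \<xi> * (norm (X \<xi>))\<^sup>2 = (norm (X \<xi>))\<^sup>2" by simp
      qed
    qed
  qed (auto simp: indicator_def)
  then have "(\<lambda>N. sqrt (S N)) \<longlonglongrightarrow> sqrt (LINT \<xi>|lborel. (norm (X \<xi>))\<^sup>2)"
    by (rule tendsto_real_sqrt)
  moreover have "c * sqrt (LINT x|lborel. (norm (tent x))\<^sup>2) < sqrt (LINT \<xi>|lborel. (norm (X \<xi>))\<^sup>2)"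
  proof -
    have "c * sqrt (LINT x|lborel. (norm (tent x))\<^sup>2) < 1 * sqrt (LINT x|lborel. (norm (tent x))\<^sup>2)"
      using c pos by (intro mult_strict_right_mono) auto
    also have "\<dots> \<le> sqrt (LINT \<xi>|lborel. (norm (X \<xi>))\<^sup>2)"
      using XX by simp
    finally show ?thesis .
  qed
  ultimately have "\<forall>\<^sub>F N in sequentially. c * sqrt (LINT x|lborel. (norm (tent x))\<^sup>2) < sqrt (S N)"
    by (rule order_tendstoD(1))
  then obtain N where N: "c * sqrt (LINT x|lborel. (norm (tent x))\<^sup>2) < sqrt (S N)"
    by (auto simp: eventually_sequentially)
  \<comment> \<open>The chirp factor cancels the one of the propagator, and the plane wave moves the spectrum of the
    tent function into the half-space.\<close>
  define h where "h y = exp (- \<i> * of_real (f / 2 * (norm y)\<^sup>2 + real N * (n \<bullet> y))) * tent y" for y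
  have [measurable]: "h \<in> borel_measurable borel"
    unfolding h_def[abs_def] by measurable
  have nh: "norm (h y) = norm (tent y)" for y
    by (simp add: h_def norm_mult norm_exp_eq_Re)
  have hi: "integrable lborel h"
    using tenti by (rule Bochner_Integration.integrable_bound) (auto simp: nh)
  have h2: "integrable lborel (\<lambda>x. (norm (h x))\<^sup>2)"
    using tent2 by (simp add: nh)
  have hR: "h y = 0" if "norm y \<ge> norm p + 2" for y
  proof -
    have "norm y \<le> norm (y - p) + norm p"
      using norm_triangle_ineq[of "y - p" p] by simp
    then have "y \<notin> cball p 1"
      using that by (simp add: dist_norm norm_minus_commute)
    then show ?thesis by (simp add: h_def tent0)
  qed
  have supp: "h y = 0" if "n \<bullet> y < a" for y
  proof -
    have "n \<bullet> (p - y) \<le> norm (p - y)"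
      using norm_cauchy_schwarz[of n "p - y"] n by simp
    moreover have "n \<bullet> (p - y) > 1"
      using that by (simp add: p_def inner_diff_right nn)
    ultimately have "y \<notin> cball p 1" by (simp add: dist_norm)
    then show ?thesis by (simp add: h_def tent0)
  qed
  define b where "b = - \<i> * of_real f / 2"
  define g where "g x = (LINT y|lborel. gauss_kernel (1 / (4 * b)) (x - y) * h y)" for x
  have [measurable]: "g \<in> borel_measurable borel"
    unfolding g_def[abs_def] by (rule lborel.borel_measurable_lebesgue_integral[of _ borel]) measurable
  have D: "is_D f h g"
    unfolding g_def b_def by (rule is_D_chirp_conv[OF f hi h2 hR])
  have ng: "(norm (g x))\<^sup>2 = f ^ DIM('a) * (norm (X (real N *\<^sub>R n + f *\<^sub>R x)))\<^sup>2" for x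
  proof -
    define \<kappa> where "\<kappa> = (csqrt (of_real pi / (1 / (4 * b))) / of_real (2 * pi)) ^ DIM('a)"
    have b4: "1 / (4 * (1 / (4 * b))) = b"
      using f by (simp add: b_def)
    have "gauss_kernel (1 / (4 * b)) (x - y) * h y = (\<kappa> * exp (\<i> * of_real (f / 2 * (norm x)\<^sup>2))) *
      (exp (of_real (-1) * \<i> * of_real ((real N *\<^sub>R n + f *\<^sub>R x) \<bullet> y)) * tent y)" for y
    proof -
      have sq: "(norm (x - y))\<^sup>2 = (norm x)\<^sup>2 - 2 * (x \<bullet> y) + (norm y)\<^sup>2"
        unfolding power2_norm_eq_inner by (simp add: inner_diff_left inner_diff_right inner_commute)
      have r: "f / 2 * (norm (x - y))\<^sup>2 - (f / 2 * (norm y)\<^sup>2 + real N * (n \<bullet> y)) =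
          f / 2 * (norm x)\<^sup>2 - (real N *\<^sub>R n + f *\<^sub>R x) \<bullet> y"
        unfolding sq by (simp add: inner_add_left algebra_simps)
      have e: "exp (\<i> * of_real A) * exp (- \<i> * of_real B) = exp (\<i> * of_real (A - B))" for A B
        unfolding exp_add[symmetric] by (simp add: right_diff_distrib)
      have gb: "gauss b (x - y) = exp (\<i> * of_real (f / 2 * (norm (x - y))\<^sup>2))"
        by (simp add: gauss_def b_def mult.assoc)
      have m1: "of_real (-1) * \<i> * z = - \<i> * z" for z
        by simp
      have *: "gauss b (x - y) * exp (- \<i> * of_real (f / 2 * (norm y)\<^sup>2 + real N * (n \<bullet> y))) =
        exp (\<i> * of_real (f / 2 * (norm x)\<^sup>2)) * exp (of_real (-1) * \<i> * of_real ((real N *\<^sub>R n + f *\<^sub>R x) \<bullet> y))"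
        unfolding gb m1 e r ..
      have "gauss_kernel (1 / (4 * b)) (x - y) * h y = \<kappa> * (gauss b (x - y) * exp (- \<i> * of_real (f / 2 * (norm y)\<^sup>2 + real N * (n \<bullet> y)))) * tent y"
        unfolding gauss_kernel_def b4 \<kappa>_def[symmetric] h_def by (simp only: mult.assoc)
      then show ?thesis
        unfolding * by (simp only: mult.assoc)
    qed
    then have "g x = (\<kappa> * exp (\<i> * of_real (f / 2 * (norm x)\<^sup>2))) *
      (LINT y|lborel. exp (of_real (-1) * \<i> * of_real ((real N *\<^sub>R n + f *\<^sub>R x) \<bullet> y)) * tent y)"
      unfolding g_def by (simp only: integral_mult_right_zero)
    then have ngx: "norm (g x) = norm \<kappa> * norm (LINT y|lborel. exp (of_real (-1) * \<i> * of_real ((real N *\<^sub>R n + f *\<^sub>R x) \<bullet> y)) * tent y)"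
      by (simp add: norm_mult norm_exp_eq_Re)
    have "norm (X (real N *\<^sub>R n + f *\<^sub>R x)) = fourier_const TYPE('a) * norm (LINT y|lborel. exp (of_real (-1) * \<i> * of_real ((real N *\<^sub>R n + f *\<^sub>R x) \<bullet> y)) * tent y)"
      unfolding X_def by (subst fourier_int_lborel) (simp_all add: norm_mult)
    then have nX: "(norm (X (real N *\<^sub>R n + f *\<^sub>R x)))\<^sup>2 = 1 / (2 * pi) ^ DIM('a) * (norm (LINT y|lborel. exp (of_real (-1) * \<i> * of_real ((real N *\<^sub>R n + f *\<^sub>R x) \<bullet> y)) * tent y))\<^sup>2"
      by (simp only: power_mult_distrib fourier_const_sq)
    have "(norm \<kappa>)\<^sup>2 = (f / (2 * pi)) ^ DIM('a)"
    proof -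
      have "(norm (csqrt (of_real pi / (1 / (4 * b))) / of_real (2 * pi)))\<^sup>2 = norm (of_real pi / (1 / (4 * b))) / (2 * pi)\<^sup>2"
        by (simp add: norm_divide power_divide)
      also have "\<dots> = f / (2 * pi)"
        using f by (simp add: b_def norm_divide norm_mult power2_eq_square)
      finally have "(norm (csqrt (of_real pi / (1 / (4 * b))) / of_real (2 * pi)))\<^sup>2 = f / (2 * pi)" .
      then show ?thesis
        unfolding \<kappa>_def norm_power by (simp only: power_mult[symmetric] mult.commute[of _ 2]) (simp only: power_mult)
    qed
    then show ?thesis
      unfolding ngx nX power_mult_distrib by (simp add: power_divide)
  qed
  have Ng: "L2norm (\<lambda>x. indicator (- {x. n \<bullet> x \<ge> a}) x * g x) = sqrt (S N)"
  proof -
    have [measurable]: "- {x. n \<bullet> x \<ge> a} \<in> sets borel"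
      by measurable
    have "(LINT x|lborel. (norm (indicator (- {x. n \<bullet> x \<ge> a}) x * g x))\<^sup>2) =
      (LINT x|lborel. f ^ DIM('a) * (indicator {\<xi>. n \<bullet> \<xi> < f * a + real N} (real N *\<^sub>R n + f *\<^sub>R x) * (norm (X (real N *\<^sub>R n + f *\<^sub>R x)))\<^sup>2))"
    proof (rule Bochner_Integration.integral_cong[OF refl])
      fix x
      have "n \<bullet> (real N *\<^sub>R n + f *\<^sub>R x) < f * a + real N \<longleftrightarrow> n \<bullet> x < a"
        using f by (simp add: inner_add_right nn)
      then show "(norm (indicator (- {x. n \<bullet> x \<ge> a}) x * g x))\<^sup>2 =
        f ^ DIM('a) * (indicator {\<xi>. n \<bullet> \<xi> < f * a + real N} (real N *\<^sub>R n + f *\<^sub>R x) * (norm (X (real N *\<^sub>R n + f *\<^sub>R x)))\<^sup>2)"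
        by (auto simp: indicator_def ng)
    qed
    also have "\<dots> = S N"
      unfolding S_def using f
      by (subst lborel_integral_affine[where c=f and t="real N *\<^sub>R n"]) auto
    finally show ?thesis
      by (subst L2norm_borel) (auto intro!: borel_measurable_times borel_measurable_indicator)
  qed
  have "L2norm h = sqrt (LINT x|lborel. (norm (tent x))\<^sup>2)"
    by (simp add: L2norm_borel nh)
  with N have "L2norm (\<lambda>x. indicator (- {x. n \<bullet> x \<ge> a}) x * g x) > c * L2norm h"
    unfolding Ng by simp
  moreover have "L2fun h"
    using h2 by (simp add: L2fun_borel)
  moreover have "supported_in {x. n \<bullet> x \<ge> a} h"
    unfolding supported_in_def using supp by (intro AE_I2) auto
  ultimately show ?thesis
    using D by blast
qed

theorem theorem6p2:
  shows "(\<exists>x0::real. (\<forall>x. sym theta_tilde x \<le> sym theta_tilde x0) \<and>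
            sym theta_tilde x0 \<le> 0.837 \<and>
            (\<forall>(ff::real) (a::real) (n::'a::euclidean_space) (\<phi>::'a \<Rightarrow> real) g.
               ff > 0 \<and> norm n = 1 \<and>
               L2fun (\<lambda>x. complex_of_real (\<phi> x)) \<and>
               supported_in {x. n \<bullet> x \<ge> a} (\<lambda>x. complex_of_real (\<phi> x)) \<and>
               is_D ff (\<lambda>x. complex_of_real (\<phi> x)) g
               \<longrightarrow> L2norm (\<lambda>x. indicator (- {x. n \<bullet> x \<ge> a}) x * g x)
                     \<le> sym theta_tilde x0 * L2norm (\<lambda>x. complex_of_real (\<phi> x))))
       \<and> (\<forall>(ff::real) (a::real) (n::'a) (c::real).
            ff > 0 \<and> norm n = 1 \<and> c < 1 \<longrightarrow>
            (\<exists>h g. L2fun h \<and> supported_in {x. n \<bullet> x \<ge> a} h \<and> is_D ff h g \<and>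
               L2norm (\<lambda>x. indicator (- {x. n \<bullet> x \<ge> a}) x * g x) > c * L2norm h))"
proof -
  obtain x0 where x0: "\<forall>x. sym theta_tilde x \<le> sym theta_tilde x0" "sym theta_tilde x0 \<le> 0.837"
    using sym_theta_tilde_attains_max by blast
  then show ?thesis
    using real_half_space_bound complex_half_space_sharp
    by (intro conjI exI[of _ x0]) blast+
qed

end
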